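(* Let $(\eta,\omega_1,\omega_2,\omega_3)$ be an $SU(2)$-structure on a $5$-manifold $N^5$. It is Sasaki-Einstein, i.e. satisfies $$d\eta=-2\omega_3,\qquad d\omega_1=3\eta\wedge\omega_2,\qquad d\omega_2=-3\eta\wedge\omega_1,$$ if and only if the sin-cone $N^5\times(0,\pi)$, with coordinate $0<t<\pi$, equipped with the $SU(3)$-structure $$\begin{aligned}F&=\sin^2t\,(\sin t\,\omega_1+\cos t\,\omega_3)+\sin t\,\eta\wedge dt,\\ \Psi_+&=\sin^3t\,\eta\wedge\omega_2-\sin^2t\,(-\cos t\,\omega_1+\sin t\,\omega_3)\wedge dt,\\ \Psi_-&=\sin^3t\,(-\cos t\,\omega_1+\sin t\,\omega_3)\wedge\eta+\sin^2t\,\omega_2\wedge dt\end{aligned}$$ is a nearly Kähler manifold.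
   Context: An $SU(2)$-structure on a $5$-manifold is a quadruplet $(\eta,\omega_1,\omega_2,\omega_3)$ of a $1$-form $\eta$ and $2$-forms $\omega_i$ with $\omega_i\wedge\omega_j=\delta_{ij}v$ for some $4$-form $v$ with $v\wedge\eta$ nowhere zero, and such that $X\lrcorner\omega_1=Y\lrcorner\omega_2$ implies $\omega_3(X,Y)\ge 0$. An $SU(3)$-structure $(F,\Psi_+,\Psi_-)$ on a $6$-manifold (locally $F=e^{12}+e^{34}+e^{56}$, $\Psi_++i\Psi_-=(e^1+ie^2)\wedge(e^3+ie^4)\wedge(e^5+ie^6)$ for some coframe) is nearly Kähler if $dF=3\Psi_+$ and $d\Psi_-=-2F\wedge F$. *)

theory Defs
  imports "HOL-Analysis.Analysis" "HOL-Library.Function_Algebras"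
begin

subsection \<open>Smooth manifolds\<close>

text \<open>All iterated directional derivatives up to order \<open>k\<close> exist and are continuous. This is
  meaningful for open \<open>S\<close> only, which is how it is used throughout.\<close>

primrec Ck_on :: "nat \<Rightarrow> 'e::euclidean_space set \<Rightarrow> ('e \<Rightarrow> 'f::real_normed_vector) \<Rightarrow> bool" where
  "Ck_on 0 S f \<longleftrightarrow> continuous_on S f"
| "Ck_on (Suc k) S f \<longleftrightarrow>
     (\<forall>x\<in>S. f differentiable (at x)) \<and> (\<forall>v. Ck_on k S (\<lambda>x. frechet_derivative f (at x) v))"

definition smooth_on :: "'e::euclidean_space set \<Rightarrow> ('e \<Rightarrow> 'f::real_normed_vector) \<Rightarrow> bool" where
  "smooth_on S f \<longleftrightarrow> (\<forall>k. Ck_on k S f)"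

text \<open>A space with an atlas indexed by a set \<open>charts\<close>. The coordinate map of chart \<open>i\<close> is
  \<open>coord i\<close>, with values in the Euclidean space \<open>'e\<close>; it is relevant on \<open>cdom i\<close> only. The atlas need
  not be maximal.\<close>

record ('a, 'i, 'e) mfd =
  space_top :: "'a topology"
  charts :: "'i set"
  cdom :: "'i \<Rightarrow> 'a set"
  coord :: "'i \<Rightarrow> 'a \<Rightarrow> 'e"

definition coord_inv :: "('a, 'i, 'e) mfd \<Rightarrow> 'i \<Rightarrow> 'e \<Rightarrow> 'a" where
  "coord_inv M i = inv_into (cdom M i) (coord M i)"

definition transition :: "('a, 'i, 'e) mfd \<Rightarrow> 'i \<Rightarrow> 'i \<Rightarrow> 'e \<Rightarrow> 'e" where
  "transition M i j = coord M j \<circ> coord_inv M i"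

definition smooth_manifold :: "('a, 'i, 'e::euclidean_space) mfd \<Rightarrow> bool" where
  "smooth_manifold M \<longleftrightarrow>
     Hausdorff_space (space_top M) \<and> second_countable (space_top M) \<and>
     (\<Union>i\<in>charts M. cdom M i) = topspace (space_top M) \<and>
     (\<forall>i\<in>charts M. openin (space_top M) (cdom M i) \<and> open (coord M i ` cdom M i) \<and>
        homeomorphic_map (subtopology (space_top M) (cdom M i))
          (top_of_set (coord M i ` cdom M i)) (coord M i)) \<and>
     (\<forall>i\<in>charts M. \<forall>j\<in>charts M.
        smooth_on (coord M i ` (cdom M i \<inter> cdom M j)) (transition M i j))"

definition open_submanifold :: "('a, 'i, 'e) mfd \<Rightarrow> 'a set \<Rightarrow> ('a, 'i, 'e) mfd" where
  "open_submanifold M V =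
     \<lparr>space_top = subtopology (space_top M) V, charts = charts M,
      cdom = (\<lambda>i. cdom M i \<inter> V), coord = coord M\<rparr>"


subsection \<open>Differential forms\<close>

text \<open>As in Bott and Tu, a differential form is a family of local forms, one for each chart of the
  atlas, that agree under the transition maps. \<open>\<alpha> i p vs\<close> is the value at the point \<open>p\<close> on the
  tangent vectors \<open>vs 0, vs 1, \<dots>\<close>, each given by its components in chart \<open>i\<close>. A \<open>k\<close>-form only
  looks at \<open>vs 0, \<dots>, vs (k - 1)\<close>, and only the values with \<open>p \<in> cdom M i\<close> matter; hence the relation
  \<open>form_eq\<close> below. Sums and differences of forms are pointwise sums of functions.\<close>

type_synonym ('a, 'i, 'e, 'r) form = "'i \<Rightarrow> 'a \<Rightarrow> (nat \<Rightarrow> 'e) \<Rightarrow> 'r"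

definition form_eq :: "('a, 'i, 'e) mfd \<Rightarrow> ('a, 'i, 'e, 'r) form \<Rightarrow> ('a, 'i, 'e, 'r) form \<Rightarrow> bool"
  where "form_eq M \<alpha> \<beta> \<longleftrightarrow> (\<forall>i\<in>charts M. \<forall>p\<in>cdom M i. \<alpha> i p = \<beta> i p)"

definition alternating_form :: "nat \<Rightarrow> ((nat \<Rightarrow> 'e::real_vector) \<Rightarrow> real) \<Rightarrow> bool" where
  "alternating_form k \<alpha> \<longleftrightarrow>
     (\<forall>vs ws. (\<forall>m<k. vs m = ws m) \<longrightarrow> \<alpha> vs = \<alpha> ws) \<and>
     (\<forall>vs. \<forall>m<k. linear (\<lambda>v. \<alpha> (vs(m := v)))) \<and>
     (\<forall>vs. \<forall>m<k. \<forall>n<k. m \<noteq> n \<and> vs m = vs n \<longrightarrow> \<alpha> vs = 0)"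

definition diff_form ::
  "('a, 'i, 'e::euclidean_space) mfd \<Rightarrow> nat \<Rightarrow> ('a, 'i, 'e, real) form \<Rightarrow> bool" where
  "diff_form M k \<alpha> \<longleftrightarrow>
     (\<forall>i\<in>charts M. \<forall>p\<in>cdom M i. alternating_form k (\<alpha> i p)) \<and>
     (\<forall>i\<in>charts M. \<forall>vs. smooth_on (coord M i ` cdom M i) (\<lambda>x. \<alpha> i (coord_inv M i x) vs)) \<and>
     (\<forall>i\<in>charts M. \<forall>j\<in>charts M. \<forall>p\<in>cdom M i \<inter> cdom M j. \<forall>vs.
        \<alpha> i p vs = \<alpha> j p (frechet_derivative (transition M i j) (at (coord M i p)) \<circ> vs))"

definition fscale :: "('a \<Rightarrow> 'r) \<Rightarrow> ('a, 'i, 'e, 'r::times) form \<Rightarrow> ('a, 'i, 'e, 'r) form"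
    (infixr \<open>\<odot>\<close> 75) where
  "f \<odot> \<alpha> = (\<lambda>i p vs. f p * \<alpha> i p vs)"

text \<open>Normalised so that \<open>(e \<and> f) (X, Y) = e X * f Y - e Y * f X\<close> for 1-forms. The subscripts are the
  degrees of the two factors.\<close>

definition wedge :: "nat \<Rightarrow> nat \<Rightarrow> ('a, 'i, 'e, 'r::real_normed_field) form \<Rightarrow>
    ('a, 'i, 'e, 'r) form \<Rightarrow> ('a, 'i, 'e, 'r) form" where
  "wedge k l \<alpha> \<beta> = (\<lambda>i p vs.
     (\<Sum>\<sigma> | \<sigma> permutes {..<k + l}.
        of_int (sign \<sigma>) * \<alpha> i p (\<lambda>m. vs (\<sigma> m)) * \<beta> i p (\<lambda>m. vs (\<sigma> (k + m))))
     / (fact k * fact l))"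

abbreviation wedge_syntax (\<open>(_ \<and>\<^bsub>_,_\<^esub> _)\<close> [71, 0, 0, 70] 70) where
  "\<alpha> \<and>\<^bsub>k,l\<^esub> \<beta> \<equiv> wedge k l \<alpha> \<beta>"

definition drop_vec :: "nat \<Rightarrow> (nat \<Rightarrow> 'e) \<Rightarrow> nat \<Rightarrow> 'e" where
  "drop_vec j vs = (\<lambda>m. if m < j then vs m else vs (Suc m))"

text \<open>Exterior derivative of a \<open>k\<close>-form, computed in each chart on constant vector fields (whose
  brackets vanish).\<close>

definition ext_deriv :: "('a, 'i, 'e::euclidean_space) mfd \<Rightarrow> nat \<Rightarrow> ('a, 'i, 'e, real) form \<Rightarrow>
    ('a, 'i, 'e, real) form" where
  "ext_deriv M k \<alpha> = (\<lambda>i p vs.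
     \<Sum>j\<le>k. (- 1) ^ j *
       frechet_derivative (\<lambda>x. \<alpha> i (coord_inv M i x) (drop_vec j vs)) (at (coord M i p)) (vs j))"

definition contract :: "'e \<Rightarrow> ((nat \<Rightarrow> 'e) \<Rightarrow> 'r) \<Rightarrow> (nat \<Rightarrow> 'e) \<Rightarrow> 'r" where
  "contract X \<alpha> = (\<lambda>vs. \<alpha> (case_nat X vs))"

definition complex_form ::
  "('a, 'i, 'e, real) form \<Rightarrow> ('a, 'i, 'e, real) form \<Rightarrow> ('a, 'i, 'e, complex) form" where
  "complex_form \<alpha> \<beta> = (\<lambda>i p vs. Complex (\<alpha> i p vs) (\<beta> i p vs))"

definition coframe ::
  "('a, 'i, 'e::euclidean_space) mfd \<Rightarrow> (nat \<Rightarrow> ('a, 'i, 'e, real) form) \<Rightarrow> bool" where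
  "coframe M e \<longleftrightarrow>
     (\<forall>a\<in>{1..DIM('e)}. diff_form M 1 (e a)) \<and>
     (\<forall>i\<in>charts M. \<forall>p\<in>cdom M i. \<forall>c :: nat \<Rightarrow> real.
        (\<forall>vs. (\<Sum>a = 1..DIM('e). c a * e a i p vs) = 0) \<longrightarrow> (\<forall>a\<in>{1..DIM('e)}. c a = 0))"


subsection \<open>\<open>SU(2)\<close>-structures and \<open>SU(3)\<close>-structures\<close>

text \<open>The forms \<open>\<omega>\<^sub>1, \<omega>\<^sub>2, \<omega>\<^sub>3\<close> are \<open>\<omega> 1, \<omega> 2, \<omega> 3\<close>.\<close>

definition SU2_structure :: "('a, 'i, 'e::euclidean_space) mfd \<Rightarrow> ('a, 'i, 'e, real) form \<Rightarrow>
    (nat \<Rightarrow> ('a, 'i, 'e, real) form) \<Rightarrow> bool" where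
  "SU2_structure N \<eta> \<omega> \<longleftrightarrow>
     smooth_manifold N \<and> DIM('e) = 5 \<and>
     diff_form N 1 \<eta> \<and> (\<forall>r\<in>{1, 2, 3}. diff_form N 2 (\<omega> r)) \<and>
     (\<exists>v. diff_form N 4 v \<and>
        (\<forall>r\<in>{1, 2, 3}. \<forall>s\<in>{1, 2, 3}.
           form_eq N (\<omega> r \<and>\<^bsub>2,2\<^esub> \<omega> s) ((\<lambda>_. if r = s then 1 else 0) \<odot> v)) \<and>
        (\<forall>i\<in>charts N. \<forall>p\<in>cdom N i. (v \<and>\<^bsub>4,1\<^esub> \<eta>) i p \<noteq> (\<lambda>_. 0))) \<and>
     (\<forall>i\<in>charts N. \<forall>p\<in>cdom N i. \<forall>X Y.
        contract X (\<omega> 1 i p) = contract Y (\<omega> 2 i p) \<longrightarrow> \<omega> 3 i p ((\<lambda>_. Y)(0 := X)) \<ge> 0)"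

definition Sasaki_Einstein :: "('a, 'i, 'e::euclidean_space) mfd \<Rightarrow> ('a, 'i, 'e, real) form \<Rightarrow>
    (nat \<Rightarrow> ('a, 'i, 'e, real) form) \<Rightarrow> bool" where
  "Sasaki_Einstein N \<eta> \<omega> \<longleftrightarrow>
     SU2_structure N \<eta> \<omega> \<and>
     form_eq N (ext_deriv N 1 \<eta>) ((\<lambda>_. - 2) \<odot> \<omega> 3) \<and>
     form_eq N (ext_deriv N 2 (\<omega> 1)) ((\<lambda>_. 3) \<odot> (\<eta> \<and>\<^bsub>1,2\<^esub> \<omega> 2)) \<and>
     form_eq N (ext_deriv N 2 (\<omega> 2)) ((\<lambda>_. - 3) \<odot> (\<eta> \<and>\<^bsub>1,2\<^esub> \<omega> 1))"

definition SU3_structure :: "('a, 'i, 'e::euclidean_space) mfd \<Rightarrow> ('a, 'i, 'e, real) form \<Rightarrow>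
    ('a, 'i, 'e, real) form \<Rightarrow> ('a, 'i, 'e, real) form \<Rightarrow> bool" where
  "SU3_structure M F \<Psi>p \<Psi>m \<longleftrightarrow>
     smooth_manifold M \<and> DIM('e) = 6 \<and>
     diff_form M 2 F \<and> diff_form M 3 \<Psi>p \<and> diff_form M 3 \<Psi>m \<and>
     (\<forall>p\<in>topspace (space_top M). \<exists>V e.
        openin (space_top M) V \<and> p \<in> V \<and> coframe (open_submanifold M V) e \<and>
        form_eq (open_submanifold M V) F
          ((e 1 \<and>\<^bsub>1,1\<^esub> e 2) + (e 3 \<and>\<^bsub>1,1\<^esub> e 4) + (e 5 \<and>\<^bsub>1,1\<^esub> e 6)) \<and>
        form_eq (open_submanifold M V) (complex_form \<Psi>p \<Psi>m)
          ((complex_form (e 1) (e 2) \<and>\<^bsub>1,1\<^esub> complex_form (e 3) (e 4))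
             \<and>\<^bsub>2,1\<^esub> complex_form (e 5) (e 6)))"

definition nearly_Kaehler :: "('a, 'i, 'e::euclidean_space) mfd \<Rightarrow> ('a, 'i, 'e, real) form \<Rightarrow>
    ('a, 'i, 'e, real) form \<Rightarrow> ('a, 'i, 'e, real) form \<Rightarrow> bool" where
  "nearly_Kaehler M F \<Psi>p \<Psi>m \<longleftrightarrow>
     SU3_structure M F \<Psi>p \<Psi>m \<and>
     form_eq M (ext_deriv M 2 F) ((\<lambda>_. 3) \<odot> \<Psi>p) \<and>
     form_eq M (ext_deriv M 3 \<Psi>m) ((\<lambda>_. - 2) \<odot> (F \<and>\<^bsub>2,2\<^esub> F))"


subsection \<open>The sin-cone\<close>

text \<open>The product manifold \<open>N \<times> (0, \<pi>)\<close> with the product atlas: the charts of \<open>N\<close> times the identity.\<close>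

definition sin_cone :: "('a, 'i, 'e::euclidean_space) mfd \<Rightarrow> ('a \<times> real, 'i, 'e \<times> real) mfd" where
  "sin_cone N =
     \<lparr>space_top = prod_topology (space_top N) (top_of_set {0<..<pi}), charts = charts N,
      cdom = (\<lambda>i. cdom N i \<times> {0<..<pi}), coord = (\<lambda>i (p, t). (coord N i p, t))\<rparr>"

text \<open>In product charts the projection to \<open>N\<close> is \<open>(x, t) \<mapsto> x\<close>, so the pullback along it restricts to
  the first components of the vectors; likewise \<open>dt\<close> is the last component.\<close>

definition pull :: "('a, 'i, 'e, real) form \<Rightarrow> ('a \<times> real, 'i, 'e \<times> real, real) form" where
  "pull \<alpha> = (\<lambda>i q vs. \<alpha> i (fst q) (\<lambda>m. fst (vs m)))"

definition dt :: "('a \<times> real, 'i, 'e \<times> real, real) form" where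
  "dt = (\<lambda>i q vs. snd (vs 0))"

definition sin_t :: "'a \<times> real \<Rightarrow> real" where "sin_t q = sin (snd q)"

definition cos_t :: "'a \<times> real \<Rightarrow> real" where "cos_t q = cos (snd q)"

definition cone_F :: "('a, 'i, 'e, real) form \<Rightarrow> (nat \<Rightarrow> ('a, 'i, 'e, real) form) \<Rightarrow>
    ('a \<times> real, 'i, 'e \<times> real, real) form" where
  "cone_F \<eta> \<omega> =
     (\<lambda>q. sin_t q ^ 2) \<odot> (sin_t \<odot> pull (\<omega> 1) + cos_t \<odot> pull (\<omega> 3))
     + sin_t \<odot> (pull \<eta> \<and>\<^bsub>1,1\<^esub> dt)"

definition cone_\<Psi>p :: "('a, 'i, 'e, real) form \<Rightarrow> (nat \<Rightarrow> ('a, 'i, 'e, real) form) \<Rightarrow>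
    ('a \<times> real, 'i, 'e \<times> real, real) form" where
  "cone_\<Psi>p \<eta> \<omega> =
     (\<lambda>q. sin_t q ^ 3) \<odot> (pull \<eta> \<and>\<^bsub>1,2\<^esub> pull (\<omega> 2))
     - (\<lambda>q. sin_t q ^ 2) \<odot>
         (((\<lambda>q. - cos_t q) \<odot> pull (\<omega> 1) + sin_t \<odot> pull (\<omega> 3)) \<and>\<^bsub>2,1\<^esub> dt)"

definition cone_\<Psi>m :: "('a, 'i, 'e, real) form \<Rightarrow> (nat \<Rightarrow> ('a, 'i, 'e, real) form) \<Rightarrow>
    ('a \<times> real, 'i, 'e \<times> real, real) form" where
  "cone_\<Psi>m \<eta> \<omega> =
     (\<lambda>q. sin_t q ^ 3) \<odot>
         (((\<lambda>q. - cos_t q) \<odot> pull (\<omega> 1) + sin_t \<odot> pull (\<omega> 3)) \<and>\<^bsub>2,1\<^esub> pull \<eta>)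
     + (\<lambda>q. sin_t q ^ 2) \<odot> (pull (\<omega> 2) \<and>\<^bsub>2,1\<^esub> dt)"

end

theory Submission
  imports Defs
begin

text \<open>
  Write \<open>s = sin t\<close>, \<open>c = cos t\<close>, \<open>\<sigma>\<^sub>1 = s \<omega>\<^sub>1 + c \<omega>\<^sub>3\<close>, \<open>\<sigma>\<^sub>2 = \<omega>\<^sub>2\<close> and \<open>\<sigma>\<^sub>3 = - c \<omega>\<^sub>1 + s \<omega>\<^sub>3\<close>. The triple
  \<open>\<sigma>\<close> is a rotation of the triple \<open>\<omega>\<close>, and the forms of the sin-cone are
  \<open>F = s\<^sup>2 \<sigma>\<^sub>1 + (s \<eta>) \<and> dt\<close> and \<open>\<Psi>\<^sub>+ + i \<Psi>\<^sub>- = s\<^sup>2 (\<sigma>\<^sub>2 + i \<sigma>\<^sub>3) \<and> (s \<eta> + i dt)\<close>. So the theorem has an algebraic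
  part, that these forms are an \<open>SU(3)\<close>-structure, and a differential part, that the two systems of
  equations are equivalent.

  For the algebraic part one needs, near every point of \<open>N\<close>, 1-forms \<open>e\<^sub>1, \<dots>, e\<^sub>4\<close> with
  \<open>\<omega>\<^sub>1 = e\<^sub>1\<^sub>2 + e\<^sub>3\<^sub>4\<close>, \<open>\<omega>\<^sub>2 = e\<^sub>1\<^sub>3 + e\<^sub>4\<^sub>2\<close>, \<open>\<omega>\<^sub>3 = e\<^sub>1\<^sub>4 + e\<^sub>2\<^sub>3\<close>. At a point they come from any vector \<open>X\<close> outside the
  kernel of the \<open>\<omega>\<^sub>r\<close>: the 1-forms \<open>a\<^sub>r = \<omega>\<^sub>r (X, -)\<close> are independent, and the relations
  \<open>\<omega>\<^sub>r \<and> \<omega>\<^sub>s = \<delta>\<^sub>r\<^sub>s v\<close> force \<open>\<omega>\<^sub>1 = \<theta> \<and> a\<^sub>1 + \<kappa> a\<^sub>2 \<and> a\<^sub>3\<close>, and cyclically, with one 1-form \<open>\<theta>\<close> and one number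
  \<open>\<kappa>\<close> (\<open>normal_form\<close>). The sign condition on \<open>\<omega>\<^sub>3\<close> says \<open>\<kappa> > 0\<close>, so the forms \<open>\<theta> / \<surd>\<kappa>\<close> and \<open>\<surd>\<kappa> a\<^sub>r\<close> are as
  wanted. Solving for \<open>\<kappa>\<close> and \<open>\<theta>\<close> shows that they depend smoothly on the point if \<open>X\<close> is constant in a
  chart (\<open>SU2_local_frame\<close>). With \<open>\<eta>\<close> they form a coframe because \<open>v \<and> \<eta>\<close> has no zero. Rotating \<open>e\<^sub>2\<close> and
  \<open>e\<^sub>4\<close> by the angle of the rotation from \<open>\<omega>\<close> to \<open>\<sigma>\<close>, and scaling by \<open>s\<close>, gives the coframe of the cone
  (\<open>SU3_structure_sin_cone\<close>).

  For the differential part one separates the terms with and without \<open>dt\<close> (\<open>ext_deriv_cone_F\<close>,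
  \<open>ext_deriv_cone_Psim\<close>). In \<open>dF = 3 \<Psi>\<^sub>+\<close> they give \<open>d\<eta> = - 2 \<omega>\<^sub>3\<close> and \<open>s d\<omega>\<^sub>1 + c d\<omega>\<^sub>3 = 3 s \<eta> \<and> \<omega>\<^sub>2\<close>, and the
  \<open>dt\<close>-part of \<open>d\<Psi>\<^sub>- = - 2 F \<and> F\<close> gives \<open>d\<omega>\<^sub>2 = - 3 \<eta> \<and> \<omega>\<^sub>1\<close>. At \<open>t = \<pi> / 2\<close> these are the
  Sasaki-Einstein equations. Conversely, the Sasaki-Einstein equations imply \<open>d\<omega>\<^sub>3 = 0\<close>, as
  \<open>\<omega>\<^sub>3 = - d\<eta> / 2\<close>, and then \<open>d(\<omega>\<^sub>1 \<and> \<eta>) = 0\<close> and \<open>d(\<omega>\<^sub>3 \<and> \<eta>) = - 2 v\<close>, which is the part of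
  \<open>d\<Psi>\<^sub>- = - 2 F \<and> F\<close> without \<open>dt\<close>.
\<close>


section \<open>Smooth maps on open sets\<close>

lemma Ck_on_subset: "Ck_on k S f \<Longrightarrow> T \<subseteq> S \<Longrightarrow> Ck_on k T f"
  by (induction k arbitrary: f) (auto intro: continuous_on_subset)

lemma Ck_on_cong:
  assumes "open S" "\<And>x. x \<in> S \<Longrightarrow> f x = g x" "Ck_on k S f"
  shows "Ck_on k S g"
  using assms(2,3)
proof (induction k arbitrary: f g)
  case 0
  then show ?case using continuous_on_cong[of S S f g] by simp
next
  case (Suc k)
  have d: "f differentiable (at x)" if "x \<in> S" for x using Suc.prems that by simp
  have "g differentiable (at x)" if "x \<in> S" for x
    using d[OF that] \<open>open S\<close> that Suc.prems(1) unfolding differentiable_def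
    by (meson has_derivative_transform_within_open)
  moreover have "Ck_on k S (\<lambda>x. frechet_derivative g (at x) v)" for v
  proof (rule Suc.IH)
    show "Ck_on k S (\<lambda>x. frechet_derivative f (at x) v)" using Suc.prems by simp
    show "frechet_derivative f (at x) v = frechet_derivative g (at x) v" if "x \<in> S" for x
      using frechet_derivative_transform_within_open[OF d[OF that] \<open>open S\<close> that] Suc.prems(1)
      by simp
  qed
  ultimately show ?case by simp
qed

lemma Ck_on_SucI:
  assumes "open S" and h: "\<And>x. x \<in> S \<Longrightarrow> (f has_derivative f' x) (at x)"
    and C: "\<And>v. Ck_on k S (\<lambda>x. f' x v)"
  shows "Ck_on (Suc k) S f"
proof -
  have "f differentiable (at x)" if "x \<in> S" for x
    using h[OF that] by (auto simp: differentiable_def)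
  moreover have "Ck_on k S (\<lambda>x. frechet_derivative f (at x) v)" for v
    by (rule Ck_on_cong[OF \<open>open S\<close> _ C[of v]]) (simp add: frechet_derivative_at[OF h, symmetric])
  ultimately show ?thesis by simp
qed

lemma Ck_on_lower: "Ck_on (Suc k) S f \<Longrightarrow> Ck_on k S f"
proof (induction k arbitrary: f)
  case 0
  then show ?case
    by (auto intro!: differentiable_imp_continuous_on simp: differentiable_on_def
        differentiable_at_withinI)
next
  case (Suc k)
  then show ?case using Ck_on.simps(2) by blast
qed

lemma Ck_on_const: "Ck_on k S (\<lambda>x. c)"
  by (induction k arbitrary: c) auto

lemma Ck_on_bounded_linear:
  assumes "bounded_linear L" "open S" "Ck_on k S f"
  shows "Ck_on k S (\<lambda>x. L (f x))"
  using assms(3)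
proof (induction k arbitrary: f)
  case 0
  then show ?case using bounded_linear.continuous_on[OF assms(1)] by auto
next
  case (Suc k)
  have h: "((\<lambda>x. L (f x)) has_derivative (\<lambda>v. L (frechet_derivative f (at x) v))) (at x)"
    if "x \<in> S" for x
    using Suc.prems that
    by (intro bounded_linear.has_derivative[OF assms(1)]) (simp add: frechet_derivative_works)
  have "Ck_on k S (\<lambda>x. L (frechet_derivative f (at x) v))" for v
    using Suc by simp
  with h show ?case by (rule Ck_on_SucI[OF \<open>open S\<close>])
qed

lemma Ck_on_add:
  assumes "open S" "Ck_on k S f" "Ck_on k S g"
  shows "Ck_on k S (\<lambda>x. f x + g x)"
  using assms(2,3)
proof (induction k arbitrary: f g)
  case 0
  then show ?case by (auto intro: continuous_on_add)
next
  case (Suc k)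
  have h: "((\<lambda>x. f x + g x) has_derivative
      (\<lambda>v. frechet_derivative f (at x) v + frechet_derivative g (at x) v)) (at x)" if "x \<in> S" for x
    using Suc.prems that by (intro has_derivative_add) (simp_all add: frechet_derivative_works)
  have "Ck_on k S (\<lambda>x. frechet_derivative f (at x) v + frechet_derivative g (at x) v)" for v
    using Suc by simp
  with h show ?case by (rule Ck_on_SucI[OF \<open>open S\<close>])
qed

lemma Ck_on_scaleR:
  assumes "open S" "Ck_on k S f" "Ck_on k S g"
  shows "Ck_on k S (\<lambda>x. f x *\<^sub>R g x)"
  using assms(2,3)
proof (induction k arbitrary: f g)
  case 0
  then show ?case by (auto intro: continuous_on_scaleR)
next
  case (Suc k)
  have h: "((\<lambda>x. f x *\<^sub>R g x) has_derivative
      (\<lambda>v. f x *\<^sub>R frechet_derivative g (at x) v + frechet_derivative f (at x) v *\<^sub>R g x)) (at x)"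
    if "x \<in> S" for x
    using Suc.prems that by (intro has_derivative_scaleR) (simp_all add: frechet_derivative_works)
  have "Ck_on k S (\<lambda>x. f x *\<^sub>R frechet_derivative g (at x) v
      + frechet_derivative f (at x) v *\<^sub>R g x)" for v
    using Suc.prems by (intro Ck_on_add[OF \<open>open S\<close>] Suc.IH) (auto intro: Ck_on_lower)
  with h show ?case by (rule Ck_on_SucI[OF \<open>open S\<close>])
qed

lemma Ck_on_sum:
  assumes "open S" "\<And>i. i \<in> I \<Longrightarrow> Ck_on k S (f i)"
  shows "Ck_on k S (\<lambda>x. \<Sum>i\<in>I. f i x)"
  using assms(2)
  by (induction I rule: infinite_finite_induct) (simp_all add: Ck_on_const Ck_on_add[OF \<open>open S\<close>])

text \<open>In the chain rule the derivative of the outer map is expanded in a basis, so that the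
  induction hypothesis applies to each of its components.\<close>

lemma Ck_on_compose:
  fixes f :: "'a::euclidean_space \<Rightarrow> 'b::euclidean_space"
    and g :: "'b \<Rightarrow> 'c::real_normed_vector"
  assumes "open S" "f ` S \<subseteq> T" "Ck_on k S f" "Ck_on k T g"
  shows "Ck_on k S (\<lambda>x. g (f x))"
  using assms(3,4)
proof (induction k arbitrary: g)
  case 0
  then show ?case
    using continuous_on_compose2[of T g S f] assms(2) by auto
next
  case (Suc k)
  let ?D = "\<lambda>x v. \<Sum>b\<in>Basis. (frechet_derivative f (at x) v \<bullet> b) *\<^sub>R frechet_derivative g (at (f x)) b"
  have h: "((\<lambda>x. g (f x)) has_derivative ?D x) (at x)" if "x \<in> S" for x
  proof -
    have dg: "g differentiable (at (f x))" and df: "f differentiable (at x)"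
      using Suc.prems that assms(2) by auto
    have "((\<lambda>x. g (f x)) has_derivative
        (\<lambda>v. frechet_derivative g (at (f x)) (frechet_derivative f (at x) v))) (at x)"
      using has_derivative_compose[OF df[unfolded frechet_derivative_works]
          dg[unfolded frechet_derivative_works]] .
    also have "(\<lambda>v. frechet_derivative g (at (f x)) (frechet_derivative f (at x) v)) = ?D x"
    proof
      fix v
      have "frechet_derivative g (at (f x)) (frechet_derivative f (at x) v) =
        frechet_derivative g (at (f x)) (\<Sum>b\<in>Basis. (frechet_derivative f (at x) v \<bullet> b) *\<^sub>R b)"
        by (simp add: euclidean_representation)
      also have "\<dots> = ?D x v"
        using linear_frechet_derivative[OF dg]
        by (simp add: linear_sum linear_scale)
      finally show "frechet_derivative g (at (f x)) (frechet_derivative f (at x) v) = ?D x v" .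
    qed
    finally show ?thesis .
  qed
  have "Ck_on k S (\<lambda>x. ?D x v)" for v
  proof (intro Ck_on_sum Ck_on_scaleR \<open>open S\<close>)
    fix b :: 'b
    show "Ck_on k S (\<lambda>x. frechet_derivative f (at x) v \<bullet> b)"
      using Suc.prems by (intro Ck_on_bounded_linear[OF bounded_linear_inner_left \<open>open S\<close>]) simp
    show "Ck_on k S (\<lambda>x. frechet_derivative g (at (f x)) b)"
      using Suc.prems by (intro Suc.IH) (auto intro: Ck_on_lower)
  qed
  with h show ?case by (rule Ck_on_SucI[OF \<open>open S\<close>])
qed

lemma smooth_on_subset: "smooth_on S f \<Longrightarrow> T \<subseteq> S \<Longrightarrow> smooth_on T f"
  by (auto simp: smooth_on_def intro: Ck_on_subset)

lemma smooth_on_cong: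
  "open S \<Longrightarrow> (\<And>x. x \<in> S \<Longrightarrow> f x = g x) \<Longrightarrow> smooth_on S f \<Longrightarrow> smooth_on S g"
  unfolding smooth_on_def by (blast intro: Ck_on_cong)

lemma smooth_on_const: "smooth_on S (\<lambda>x. c)"
  by (simp add: smooth_on_def Ck_on_const)

lemma smooth_on_bounded_linear:
  "bounded_linear L \<Longrightarrow> open S \<Longrightarrow> smooth_on S f \<Longrightarrow> smooth_on S (\<lambda>x. L (f x))"
  by (simp add: smooth_on_def Ck_on_bounded_linear)

lemma smooth_on_add:
  "open S \<Longrightarrow> smooth_on S f \<Longrightarrow> smooth_on S g \<Longrightarrow> smooth_on S (\<lambda>x. f x + g x)"
  by (simp add: smooth_on_def Ck_on_add)

lemma smooth_on_scaleR:
  "open S \<Longrightarrow> smooth_on S f \<Longrightarrow> smooth_on S g \<Longrightarrow> smooth_on S (\<lambda>x. f x *\<^sub>R g x)"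
  by (simp add: smooth_on_def Ck_on_scaleR)

lemma smooth_on_sum:
  "open S \<Longrightarrow> (\<And>i. i \<in> I \<Longrightarrow> smooth_on S (f i)) \<Longrightarrow> smooth_on S (\<lambda>x. \<Sum>i\<in>I. f i x)"
  by (simp add: smooth_on_def Ck_on_sum)

lemma smooth_on_compose:
  fixes f :: "'a::euclidean_space \<Rightarrow> 'b::euclidean_space"
  assumes "smooth_on T g" "smooth_on S f" "open S" "f ` S \<subseteq> T"
  shows "smooth_on S (\<lambda>x. g (f x))"
  unfolding smooth_on_def
proof
  show "Ck_on k S (\<lambda>x. g (f x))" for k
    using assms(1,2) unfolding smooth_on_def by (simp add: Ck_on_compose[OF assms(3,4), of k g])
qed

lemma smooth_on_mult:
  fixes f g :: "'a::euclidean_space \<Rightarrow> real"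
  shows "open S \<Longrightarrow> smooth_on S f \<Longrightarrow> smooth_on S g \<Longrightarrow> smooth_on S (\<lambda>x. f x * g x)"
  using smooth_on_scaleR[of S f g] by simp

lemma smooth_on_minus: "open S \<Longrightarrow> smooth_on S f \<Longrightarrow> smooth_on S (\<lambda>x. - f x)"
  by (rule smooth_on_bounded_linear[OF bounded_linear_minus[OF bounded_linear_ident]])

lemma smooth_on_diff:
  "open S \<Longrightarrow> smooth_on S f \<Longrightarrow> smooth_on S g \<Longrightarrow> smooth_on S (\<lambda>x. f x - g x)"
  using smooth_on_add[of S f "\<lambda>x. - g x"] smooth_on_minus[of S g] by simp

lemma smooth_on_power:
  fixes f :: "'a::euclidean_space \<Rightarrow> real"
  shows "open S \<Longrightarrow> smooth_on S f \<Longrightarrow> smooth_on S (\<lambda>x. f x ^ n)"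
  by (induction n) (simp_all add: smooth_on_const smooth_on_mult)

lemma smooth_on_ident: "smooth_on S (\<lambda>x. x)"
  unfolding smooth_on_def
proof
  show "Ck_on k S (\<lambda>x. x)" for k by (cases k) (simp_all add: Ck_on_const)
qed

lemma smooth_on_differentiable: "smooth_on S f \<Longrightarrow> x \<in> S \<Longrightarrow> f differentiable (at x)"
  unfolding smooth_on_def by (drule spec[of _ "Suc 0"]) simp

lemma smooth_on_frechet_derivative:
  assumes "smooth_on S f"
  shows "smooth_on S (\<lambda>x. frechet_derivative f (at x) v)"
  unfolding smooth_on_def
proof
  show "Ck_on k S (\<lambda>x. frechet_derivative f (at x) v)" for k
    using assms unfolding smooth_on_def by (auto dest: spec[of _ "Suc k"])
qed

lemma smooth_on_continuous_on: "smooth_on S f \<Longrightarrow> continuous_on S f"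
  unfolding smooth_on_def by (drule spec[of _ 0]) simp

lemma smooth_on_inverse_real: "smooth_on (- {0}) (inverse :: real \<Rightarrow> real)"
  unfolding smooth_on_def
proof
  fix k show "Ck_on k (- {0}) (inverse :: real \<Rightarrow> real)"
  proof (induction k)
    case 0
    show ?case by (auto intro!: continuous_intros)
  next
    case (Suc k)
    show ?case
    proof (rule Ck_on_SucI)
      show "(inverse has_derivative (\<lambda>h. - (inverse x * h * inverse x))) (at x)"
        if "x \<in> - {0}" for x :: real
        using that has_derivative_inverse'[of x UNIV] by simp
      have "Ck_on k (- {0}) (\<lambda>x. (- v) *\<^sub>R (inverse x *\<^sub>R inverse x))" for v :: real
        by (intro Ck_on_scaleR Ck_on_const Suc) auto
      then show "Ck_on k (- {0}) (\<lambda>x. - (inverse x * v * inverse x))" for v :: real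
        by (simp add: mult_ac)
    qed auto
  qed
qed

lemma smooth_on_inverse:
  fixes f :: "'a::euclidean_space \<Rightarrow> real"
  assumes "open S" "smooth_on S f" "\<And>x. x \<in> S \<Longrightarrow> f x \<noteq> 0"
  shows "smooth_on S (\<lambda>x. inverse (f x))"
  by (rule smooth_on_compose[OF smooth_on_inverse_real assms(2,1)]) (use assms(3) in auto)

lemma smooth_on_divide:
  fixes f g :: "'a::euclidean_space \<Rightarrow> real"
  assumes "open S" "smooth_on S f" "smooth_on S g" "\<And>x. x \<in> S \<Longrightarrow> g x \<noteq> 0"
  shows "smooth_on S (\<lambda>x. f x / g x)"
  unfolding divide_inverse using assms by (intro smooth_on_mult smooth_on_inverse)

lemma smooth_on_sqrt_real: "smooth_on {0<..} sqrt"
  unfolding smooth_on_def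
proof
  fix k show "Ck_on k {0<..} sqrt"
  proof (induction k)
    case 0
    show ?case by (auto intro!: continuous_intros)
  next
    case (Suc k)
    show ?case
    proof (rule Ck_on_SucI)
      show "(sqrt has_derivative (\<lambda>h. h * (inverse (sqrt x) / 2))) (at x)"
        if "x \<in> {0<..}" for x :: real
        using has_derivative_real_sqrt[OF _ has_derivative_ident, of x UNIV] that
        by simp
      have "Ck_on k {0<..} (\<lambda>x. inverse (sqrt x))"
      proof -
        have "sqrt ` {0<..} \<subseteq> - {0}" by auto
        with Ck_on_compose[of "{0<..}" sqrt "- {0}" k inverse] smooth_on_inverse_real Suc
        show ?thesis by (simp add: smooth_on_def)
      qed
      then have "Ck_on k {0<..} (\<lambda>x. (v / 2) *\<^sub>R inverse (sqrt x))" for v :: real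
        by (intro Ck_on_scaleR Ck_on_const) auto
      then show "Ck_on k {0<..} (\<lambda>x. v * (inverse (sqrt x) / 2))" for v :: real
        by simp
    qed auto
  qed
qed

lemma smooth_on_sqrt:
  fixes f :: "'a::euclidean_space \<Rightarrow> real"
  assumes "open S" "smooth_on S f" "\<And>x. x \<in> S \<Longrightarrow> f x > 0"
  shows "smooth_on S (\<lambda>x. sqrt (f x))"
  by (rule smooth_on_compose[OF smooth_on_sqrt_real assms(2,1)]) (use assms(3) in auto)

lemma smooth_on_sin_cos_real:
  fixes S :: "real set" assumes "open S"
  shows "smooth_on S sin" "smooth_on S cos"
proof -
  have "Ck_on k S sin \<and> Ck_on k S cos" for k
  proof (induction k)
    case 0
    show ?case by (auto intro!: continuous_intros)
  next
    case (Suc k)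
    have "Ck_on k S (\<lambda>x. cos x *\<^sub>R v)" "Ck_on k S (\<lambda>x. sin x *\<^sub>R (- v))" for v :: real
      by (rule Ck_on_scaleR[OF assms _ Ck_on_const], use Suc in simp)+
    moreover have "(sin has_derivative (\<lambda>v. cos x *\<^sub>R v)) (at x)"
      "(cos has_derivative (\<lambda>v. sin x *\<^sub>R (- v))) (at x)" for x :: real
      by (auto intro!: derivative_eq_intros)
    ultimately show ?case
      using Ck_on_SucI[OF assms, of sin "\<lambda>x v. cos x *\<^sub>R v" k]
        Ck_on_SucI[OF assms, of cos "\<lambda>x v. sin x *\<^sub>R (- v)" k] by simp
  qed
  then show "smooth_on S sin" "smooth_on S cos" by (auto simp: smooth_on_def)
qed

lemma has_real_derivative_along_line:
  fixes f :: "'a::real_normed_vector \<Rightarrow> real"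
  assumes "f differentiable (at (c + s *\<^sub>R u))"
  shows "((\<lambda>s. f (c + s *\<^sub>R u)) has_real_derivative
    frechet_derivative f (at (c + s *\<^sub>R u)) u) (at s)"
proof -
  let ?D = "frechet_derivative f (at (c + s *\<^sub>R u))"
  have "((\<lambda>s. c + s *\<^sub>R u) has_derivative (\<lambda>h. h *\<^sub>R u)) (at s)"
    by (auto intro!: derivative_eq_intros)
  then have "((\<lambda>s. f (c + s *\<^sub>R u)) has_derivative (\<lambda>h. ?D (h *\<^sub>R u))) (at s)"
    using has_derivative_compose assms[unfolded frechet_derivative_works] by blast
  moreover have "?D (h *\<^sub>R u) = ?D u * h" for h
    using linear_scale[OF linear_frechet_derivative[OF assms]] by simp
  ultimately show ?thesis by (simp add: has_field_derivative_def)
qed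

text \<open>The mean value theorem in the direction \<open>u\<close>, applied to \<open>y \<mapsto> f (y + h w) - f y\<close>, and then in the
  direction \<open>w\<close>.\<close>

lemma second_difference_mean_value:
  fixes f :: "'a::euclidean_space \<Rightarrow> real"
  assumes f: "smooth_on S f" and "h > 0"
    and S: "\<forall>s\<in>{0..h}. \<forall>t\<in>{0..h}. x + s *\<^sub>R u + t *\<^sub>R w \<in> S"
  shows "\<exists>s t. 0 < s \<and> s < h \<and> 0 < t \<and> t < h \<and>
    f (x + h *\<^sub>R u + h *\<^sub>R w) - f (x + h *\<^sub>R u) - f (x + h *\<^sub>R w) + f x
    = h * h * frechet_derivative (\<lambda>z. frechet_derivative f (at z) u)
        (at (x + s *\<^sub>R u + t *\<^sub>R w)) w"
proof -
  let ?D = "\<lambda>z. frechet_derivative f (at z) u"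
  have df: "f differentiable (at z)" and dD: "?D differentiable (at z)" if "z \<in> S" for z
    using that smooth_on_differentiable[OF f] smooth_on_differentiable[OF smooth_on_frechet_derivative[OF f]]
    by simp_all
  have "((\<lambda>s. f (x + s *\<^sub>R u + h *\<^sub>R w) - f (x + s *\<^sub>R u)) has_real_derivative
      ?D (x + s *\<^sub>R u + h *\<^sub>R w) - ?D (x + s *\<^sub>R u)) (at s)" if "0 \<le> s" "s \<le> h" for s
    using has_real_derivative_along_line[of f "x + h *\<^sub>R w" s u]
      has_real_derivative_along_line[of f x s u] S[rule_format, of s h] S[rule_format, of s 0] that \<open>h > 0\<close> df
    by (intro DERIV_diff) (simp_all add: add_ac)
  from MVT2[OF \<open>h > 0\<close> this] obtain s where s: "0 < s" "s < h"
    and 1: "f (x + h *\<^sub>R u + h *\<^sub>R w) - f (x + h *\<^sub>R u) - (f (x + h *\<^sub>R w) - f x)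
      = h * (?D (x + s *\<^sub>R u + h *\<^sub>R w) - ?D (x + s *\<^sub>R u))"
    by auto
  have "((\<lambda>t. ?D (x + s *\<^sub>R u + t *\<^sub>R w)) has_real_derivative
      frechet_derivative ?D (at (x + s *\<^sub>R u + t *\<^sub>R w)) w) (at t)" if "0 \<le> t" "t \<le> h" for t
    using S s that dD by (intro has_real_derivative_along_line) simp
  from MVT2[OF \<open>h > 0\<close> this] obtain t where t: "0 < t" "t < h"
    and 2: "?D (x + s *\<^sub>R u + h *\<^sub>R w) - ?D (x + s *\<^sub>R u)
      = h * frechet_derivative ?D (at (x + s *\<^sub>R u + t *\<^sub>R w)) w"
    by auto
  from 1 2 s t show ?thesis by (intro exI[of _ s] exI[of _ t]) (simp add: algebra_simps)
qed

text \<open>Both mixed derivatives are limits of the same second difference, which is symmetric in the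
  two directions.\<close>

lemma frechet_derivative_symmetric:
  fixes f :: "'a::euclidean_space \<Rightarrow> real"
  assumes "open S" and f: "smooth_on S f" and "x \<in> S"
  shows "frechet_derivative (\<lambda>z. frechet_derivative f (at z) u) (at x) w
    = frechet_derivative (\<lambda>z. frechet_derivative f (at z) w) (at x) u" (is "?A x = ?B x")
proof -
  have "\<bar>?A x - ?B x\<bar> \<le> e" if "e > 0" for e
  proof -
    have "continuous_on S ?A" "continuous_on S ?B"
      by (intro smooth_on_continuous_on smooth_on_frechet_derivative f)+
    then have cont: "isCont ?A x" "isCont ?B x"
      using assms by (simp_all add: continuous_on_eq_continuous_at)
    have near: "\<forall>\<^sub>F z in nhds x. dist (g z) (g x) < e / 2" if "isCont g x" for g :: "'a \<Rightarrow> real"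
      using that[unfolded isCont_def tendsto_at_iff_tendsto_nhds] half_gt_zero[OF \<open>e > 0\<close>]
      by (rule tendstoD)
    have "\<forall>\<^sub>F z in nhds x. z \<in> S" using assms by (simp add: eventually_nhds_in_open)
    with near[OF cont(1)] near[OF cont(2)]
    have "\<forall>\<^sub>F z in nhds x. z \<in> S \<and> dist (?A z) (?A x) < e / 2 \<and> dist (?B z) (?B x) < e / 2"
      by eventually_elim simp
    then obtain d where "d > 0" and d: "\<And>z. dist z x < d \<Longrightarrow>
        z \<in> S \<and> dist (?A z) (?A x) < e / 2 \<and> dist (?B z) (?B x) < e / 2"
      unfolding eventually_nhds_metric by blast
    define h where "h = d / (norm u + norm w + 1)"
    have "h > 0" using \<open>d > 0\<close> by (simp add: h_def add_nonneg_pos)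
    have close: "dist (x + s *\<^sub>R u + t *\<^sub>R w) x < d" if "0 \<le> s" "s \<le> h" "0 \<le> t" "t \<le> h" for s t
    proof -
      have "dist (x + s *\<^sub>R u + t *\<^sub>R w) x = norm (s *\<^sub>R u + t *\<^sub>R w)"
        by (simp add: dist_norm add.assoc)
      also have "\<dots> \<le> s * norm u + t * norm w"
        using that norm_triangle_ineq[of "s *\<^sub>R u" "t *\<^sub>R w"] by simp
      also have "\<dots> \<le> h * norm u + h * norm w"
        using that by (intro add_mono mult_right_mono) auto
      also have "\<dots> < h * (norm u + norm w + 1)"
        using \<open>h > 0\<close> by (simp add: algebra_simps)
      also have "\<dots> = d"
        using add_nonneg_pos[of "norm u + norm w" 1] by (simp add: h_def)
      finally show ?thesis .
    qed
    have inS: "\<forall>s\<in>{0..h}. \<forall>t\<in>{0..h}. x + s *\<^sub>R u + t *\<^sub>R w \<in> S"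
      "\<forall>s\<in>{0..h}. \<forall>t\<in>{0..h}. x + s *\<^sub>R w + t *\<^sub>R u \<in> S"
      using d[OF close] by (auto simp: add.assoc add.commute[of "_ *\<^sub>R w"])
    obtain s t where st: "0 < s" "s < h" "0 < t" "t < h"
      and 1: "f (x + h *\<^sub>R u + h *\<^sub>R w) - f (x + h *\<^sub>R u) - f (x + h *\<^sub>R w) + f x
        = h * h * ?A (x + s *\<^sub>R u + t *\<^sub>R w)"
      using second_difference_mean_value[OF f \<open>h > 0\<close> inS(1)] by (elim exE conjE) (rule that)
    obtain s' t' where st': "0 < s'" "s' < h" "0 < t'" "t' < h"
      and 2: "f (x + h *\<^sub>R w + h *\<^sub>R u) - f (x + h *\<^sub>R w) - f (x + h *\<^sub>R u) + f x
        = h * h * ?B (x + s' *\<^sub>R w + t' *\<^sub>R u)"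
      using second_difference_mean_value[OF f \<open>h > 0\<close> inS(2)] by (elim exE conjE) (rule that)
    have "h * h * ?A (x + s *\<^sub>R u + t *\<^sub>R w) = h * h * ?B (x + s' *\<^sub>R w + t' *\<^sub>R u)"
      unfolding 1[symmetric] 2[symmetric] by (simp add: add_ac)
    then have "?A (x + s *\<^sub>R u + t *\<^sub>R w) = ?B (x + s' *\<^sub>R w + t' *\<^sub>R u)"
      using \<open>h > 0\<close> by simp
    moreover have "dist (?A (x + s *\<^sub>R u + t *\<^sub>R w)) (?A x) < e / 2"
      using d[OF close] st by simp
    moreover have "dist (?B (x + s' *\<^sub>R w + t' *\<^sub>R u)) (?B x) < e / 2"
      using d[OF close[of t' s']] st' by (simp add: add_ac)
    ultimately show ?thesis unfolding dist_real_def by linarith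
  qed
  then have "\<bar>?A x - ?B x\<bar> \<le> 0" by (rule field_le_epsilon) simp
  then show ?thesis by simp
qed

section \<open>Differential forms on a manifold and on its sin-cone\<close>

lemma alternating_form_cong:
  assumes "alternating_form k a" "\<And>m. m < k \<Longrightarrow> vs m = ws m"
  shows "a vs = a ws"
proof -
  have "(\<forall>m<k. vs m = ws m) \<longrightarrow> a vs = a ws"
    using assms(1)[unfolded alternating_form_def, THEN conjunct1] by (elim allE)
  then show ?thesis using assms(2) by simp
qed

lemma alternating_form_linear:
  "alternating_form k a \<Longrightarrow> m < k \<Longrightarrow> linear (\<lambda>v. a (vs(m := v)))"
  unfolding alternating_form_def by simp

lemma alternating_form_eq_0:
  assumes "alternating_form k a" "m < k" "n < k" "m \<noteq> n" "vs m = vs n"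
  shows "a vs = 0"
proof -
  have "\<forall>m<k. \<forall>n<k. m \<noteq> n \<and> vs m = vs n \<longrightarrow> a vs = 0"
    using assms(1)[unfolded alternating_form_def, THEN conjunct2, THEN conjunct2] by (rule spec)
  then show ?thesis using assms(2-) by simp
qed

lemma alternating_form_add:
  assumes "alternating_form k a" "alternating_form k b"
  shows "alternating_form k (\<lambda>vs. a vs + b vs)"
  unfolding alternating_form_def
proof (intro conjI allI impI)
  show "a vs + b vs = a ws + b ws" if "\<forall>m<k. vs m = ws m" for vs ws
    using that alternating_form_cong[OF assms(1), of vs ws] alternating_form_cong[OF assms(2), of vs ws]
    by simp
  show "linear (\<lambda>v. a (vs(m := v)) + b (vs(m := v)))" if "m < k" for vs m
    by (rule linear_compose_add[OF assms[THEN alternating_form_linear, OF that]])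
  show "a vs + b vs = 0" if "m < k" "n < k" "m \<noteq> n \<and> vs m = vs n" for vs m n
    using that alternating_form_eq_0[OF assms(1)] alternating_form_eq_0[OF assms(2)] by simp
qed

lemma alternating_form_scale:
  assumes "alternating_form k a"
  shows "alternating_form k (\<lambda>vs. c * a vs)"
  unfolding alternating_form_def
proof (intro conjI allI impI)
  show "c * a vs = c * a ws" if "\<forall>m<k. vs m = ws m" for vs ws
    using that alternating_form_cong[OF assms, of vs ws] by simp
  show "linear (\<lambda>v. c * a (vs(m := v)))" if "m < k" for vs m
    using linear_compose_scale_right[OF alternating_form_linear[OF assms that], of c] by simp
  show "c * a vs = 0" if "m < k" "n < k" "m \<noteq> n \<and> vs m = vs n" for vs m n
    using that alternating_form_eq_0[OF assms] by simp
qed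

lemma alternating_form_compose:
  assumes a: "alternating_form k a" and "linear L"
  shows "alternating_form k (\<lambda>vs. a (\<lambda>m. L (vs m)))"
  unfolding alternating_form_def
proof (intro conjI allI impI)
  show "a (\<lambda>m. L (vs m)) = a (\<lambda>m. L (ws m))" if "\<forall>m<k. vs m = ws m" for vs ws
    using that by (intro alternating_form_cong[OF a]) simp
  show "linear (\<lambda>v. a (\<lambda>i. L ((vs(m := v)) i)))" if "m < k" for vs m
  proof -
    have "linear ((\<lambda>v. a ((\<lambda>i. L (vs i))(m := v))) \<circ> L)"
      by (rule linear_compose[OF \<open>linear L\<close> alternating_form_linear[OF a that]])
    moreover have "(\<lambda>i. L (vs i))(m := L v) = (\<lambda>i. L ((vs(m := v)) i))" for v
      by auto
    ultimately show ?thesis by (simp add: comp_def)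
  qed
  show "a (\<lambda>m. L (vs m)) = 0" if "m < k" "n < k" "m \<noteq> n \<and> vs m = vs n" for vs m n
    using that by (intro alternating_form_eq_0[OF a, of m n]) auto
qed

text \<open>If two arguments coincide, composing the permutations with the transposition of these two
  slots changes the sign of every term of the sum and nothing else.\<close>

lemma alternating_form_wedge:
  fixes a b :: "(nat \<Rightarrow> 'e::real_vector) \<Rightarrow> real"
  assumes a: "alternating_form k a" and b: "alternating_form l b"
  shows "alternating_form (k + l) (\<lambda>vs. (\<Sum>\<sigma> | \<sigma> permutes {..<k + l}.
    of_int (sign \<sigma>) * a (\<lambda>m. vs (\<sigma> m)) * b (\<lambda>m. vs (\<sigma> (k + m)))) / c)"
    (is "alternating_form _ (\<lambda>vs. (\<Sum>\<sigma> | ?P \<sigma>. ?t vs \<sigma>) / c)")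
  unfolding alternating_form_def
proof (intro conjI allI impI)
  fix vs ws :: "nat \<Rightarrow> 'e" assume eq: "\<forall>m<k + l. vs m = ws m"
  have "?t vs \<sigma> = ?t ws \<sigma>" if "?P \<sigma>" for \<sigma>
  proof -
    have *: "vs (\<sigma> m) = ws (\<sigma> m)" if "m < k + l" for m
      using permutes_in_image[OF \<open>?P \<sigma>\<close>, of m] that eq by simp
    have "a (\<lambda>m. vs (\<sigma> m)) = a (\<lambda>m. ws (\<sigma> m))"
      by (rule alternating_form_cong[OF a]) (simp add: *)
    moreover have "b (\<lambda>m. vs (\<sigma> (k + m))) = b (\<lambda>m. ws (\<sigma> (k + m)))"
      by (rule alternating_form_cong[OF b]) (simp add: *)
    ultimately show ?thesis by (simp only:)
  qed
  then have "(\<Sum>\<sigma> | ?P \<sigma>. ?t vs \<sigma>) = (\<Sum>\<sigma> | ?P \<sigma>. ?t ws \<sigma>)"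
    by (intro sum.cong refl) (simp only: mem_Collect_eq)
  then show "(\<Sum>\<sigma> | ?P \<sigma>. ?t vs \<sigma>) / c = (\<Sum>\<sigma> | ?P \<sigma>. ?t ws \<sigma>) / c"
    by (rule arg_cong)
next
  fix vs :: "nat \<Rightarrow> 'e" and m assume "m < k + l"
  have lin: "linear (\<lambda>v. ?t (vs(m := v)) \<sigma>)" if "?P \<sigma>" for \<sigma>
  proof -
    define n where "n = inv \<sigma> m"
    have \<sigma>: "\<sigma> j = m \<longleftrightarrow> j = n" for j
      using permutes_inverses[OF \<open>?P \<sigma>\<close>] by (auto simp: n_def)
    have "n < k + l"
      using permutes_in_image[OF permutes_inv[OF \<open>?P \<sigma>\<close>]] \<open>m < k + l\<close> by (auto simp: n_def)
    show ?thesis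
    proof (cases "n < k")
      case True
      have "a (\<lambda>j. (vs(m := v)) (\<sigma> j)) = a ((\<lambda>j. vs (\<sigma> j))(n := v))" for v
        by (intro alternating_form_cong[OF a]) (simp add: \<sigma>)
      moreover have "b (\<lambda>j. (vs(m := v)) (\<sigma> (k + j))) = b (\<lambda>j. vs (\<sigma> (k + j)))" for v
        using True by (intro alternating_form_cong[OF b]) (simp add: \<sigma>)
      moreover have "linear (\<lambda>v. a ((\<lambda>j. vs (\<sigma> j))(n := v)))"
        by (rule alternating_form_linear[OF a True])
      ultimately show ?thesis
        by (simp add: linear_iff algebra_simps)
    next
      case False
      then have n: "n - k < l" "n = k + (n - k)" using \<open>n < k + l\<close> by auto
      have "a (\<lambda>j. (vs(m := v)) (\<sigma> j)) = a (\<lambda>j. vs (\<sigma> j))" for v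
        using False by (intro alternating_form_cong[OF a]) (auto simp: \<sigma>)
      moreover have "b (\<lambda>j. (vs(m := v)) (\<sigma> (k + j))) = b ((\<lambda>j. vs (\<sigma> (k + j)))(n - k := v))" for v
        using n(2) by (intro alternating_form_cong[OF b]) (auto simp: \<sigma>)
      moreover have "linear (\<lambda>v. b ((\<lambda>j. vs (\<sigma> (k + j)))(n - k := v)))"
        by (rule alternating_form_linear[OF b n(1)])
      ultimately show ?thesis
        by (simp add: linear_iff algebra_simps)
    qed
  qed
  have "linear (\<lambda>v. (\<Sum>\<sigma> | ?P \<sigma>. ?t (vs(m := v)) \<sigma>))"
    by (rule linear_compose_sum) (use lin in blast)
  from linear_compose_scale_right[OF this, of "1 / c"]
  show "linear (\<lambda>v. (\<Sum>\<sigma> | ?P \<sigma>. ?t (vs(m := v)) \<sigma>) / c)" by simp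
next
  fix vs :: "nat \<Rightarrow> 'e" and m n assume m: "m < k + l" and n: "n < k + l" and mn: "m \<noteq> n \<and> vs m = vs n"
  let ?\<tau> = "Transposition.transpose m n"
  have \<tau>: "?P ?\<tau>" using m n by (intro permutes_swap_id) auto
  have swap: "vs (?\<tau> j) = vs j" for j
    using mn by (auto simp: Transposition.transpose_def)
  have "(\<Sum>\<sigma> | ?P \<sigma>. ?t vs \<sigma>) = (\<Sum>\<sigma> | ?P \<sigma>. ?t vs (?\<tau> \<circ> \<sigma>))"
    by (rule setum_permutations_compose_left[OF \<tau>])
  also have "\<dots> = (\<Sum>\<sigma> | ?P \<sigma>. - ?t vs \<sigma>)"
  proof (rule sum.cong[OF refl], clarify)
    fix \<sigma> assume "?P \<sigma>"
    then have "sign (?\<tau> \<circ> \<sigma>) = - sign \<sigma>"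
      using mn sign_compose[OF permutation_swap_id permutes_imp_permutation[OF finite_lessThan]]
      by (simp add: sign_swap_id)
    then show "?t vs (?\<tau> \<circ> \<sigma>) = - ?t vs \<sigma>" by (simp add: swap)
  qed
  also have "\<dots> = - (\<Sum>\<sigma> | ?P \<sigma>. ?t vs \<sigma>)" by (rule sum_negf)
  finally show "(\<Sum>\<sigma> | ?P \<sigma>. ?t vs \<sigma>) / c = 0" by simp
qed


subsection \<open>Smooth atlases\<close>

text \<open>The part of the definition of a manifold that differential forms depend on: the charts and their
  transition maps, but not the topology of the space.\<close>

definition smooth_atlas :: "('a, 'i, 'e::euclidean_space) mfd \<Rightarrow> bool" where
  "smooth_atlas M \<longleftrightarrow> (\<forall>i\<in>charts M. inj_on (coord M i) (cdom M i) \<and>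
     (\<forall>j\<in>charts M. open (coord M i ` (cdom M i \<inter> cdom M j)) \<and>
        smooth_on (coord M i ` (cdom M i \<inter> cdom M j)) (transition M i j)))"

lemma smooth_manifold_imp_smooth_atlas:
  assumes "smooth_manifold M"
  shows "smooth_atlas M"
  unfolding smooth_atlas_def
proof (intro ballI conjI)
  fix i assume i: "i \<in> charts M"
  let ?X = "subtopology (space_top M) (cdom M i)"
  have op: "openin (space_top M) (cdom M i)" "open (coord M i ` cdom M i)"
    and h: "homeomorphic_map ?X (top_of_set (coord M i ` cdom M i)) (coord M i)"
    using assms i unfolding smooth_manifold_def by blast+
  have ts: "topspace ?X = cdom M i"
    using openin_subset[OF op(1)] by auto
  show "inj_on (coord M i) (cdom M i)"
    using h ts unfolding homeomorphic_eq_everything_map by simp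
  fix j assume j: "j \<in> charts M"
  then have "openin (space_top M) (cdom M j)"
    using assms unfolding smooth_manifold_def by blast
  then have "openin ?X (cdom M i \<inter> cdom M j)"
    by (simp add: openin_subtopology_Int2 openin_subtopology_alt)
  then have "openin (top_of_set (coord M i ` cdom M i)) (coord M i ` (cdom M i \<inter> cdom M j))"
    using homeomorphic_map_openness_eq[OF h] by blast
  then show "open (coord M i ` (cdom M i \<inter> cdom M j))"
    using op(2) openin_open_trans by blast
  show "smooth_on (coord M i ` (cdom M i \<inter> cdom M j)) (transition M i j)"
    using assms i j unfolding smooth_manifold_def by blast
qed

lemma smooth_atlas_open: "smooth_atlas M \<Longrightarrow> i \<in> charts M \<Longrightarrow> open (coord M i ` cdom M i)"
  unfolding smooth_atlas_def by (metis inf.idem)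

lemma coord_inv_coord: "inj_on (coord M i) (cdom M i) \<Longrightarrow> p \<in> cdom M i \<Longrightarrow> coord_inv M i (coord M i p) = p"
  unfolding coord_inv_def by (rule inv_into_f_f)

lemma smooth_atlas_coord_inv:
  "smooth_atlas M \<Longrightarrow> i \<in> charts M \<Longrightarrow> p \<in> cdom M i \<Longrightarrow> coord_inv M i (coord M i p) = p"
  unfolding smooth_atlas_def by (simp add: coord_inv_coord)

lemma smooth_atlas_transition:
  "smooth_atlas M \<Longrightarrow> i \<in> charts M \<Longrightarrow> p \<in> cdom M i \<Longrightarrow> transition M i j (coord M i p) = coord M j p"
  by (simp add: transition_def smooth_atlas_coord_inv)


subsection \<open>Closure properties of differential forms\<close>

lemma diff_formD:
  assumes "diff_form M k \<alpha>" "i \<in> charts M"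
  shows diff_form_alternating: "p \<in> cdom M i \<Longrightarrow> alternating_form k (\<alpha> i p)"
    and diff_form_smooth: "smooth_on (coord M i ` cdom M i) (\<lambda>x. \<alpha> i (coord_inv M i x) vs)"
    and diff_form_transition: "j \<in> charts M \<Longrightarrow> p \<in> cdom M i \<Longrightarrow> p \<in> cdom M j \<Longrightarrow>
      \<alpha> i p vs = \<alpha> j p (frechet_derivative (transition M i j) (at (coord M i p)) \<circ> vs)"
  using assms unfolding diff_form_def by blast+

lemma diff_form_add:
  fixes M :: "('a, 'i, 'e::euclidean_space) mfd"
  assumes "smooth_atlas M" and a: "diff_form M k \<alpha>" and b: "diff_form M k \<beta>"
  shows "diff_form M k (\<alpha> + \<beta>)"
  unfolding diff_form_def plus_fun_def
proof (intro conjI ballI allI)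
  show "alternating_form k (\<lambda>vs. \<alpha> i p vs + \<beta> i p vs)" if "i \<in> charts M" "p \<in> cdom M i" for i p
    by (rule alternating_form_add[OF diff_form_alternating[OF a that] diff_form_alternating[OF b that]])
  show "smooth_on (coord M i ` cdom M i)
      (\<lambda>x. \<alpha> i (coord_inv M i x) vs + \<beta> i (coord_inv M i x) vs)" if "i \<in> charts M" for i vs
    by (rule smooth_on_add[OF smooth_atlas_open[OF assms(1) that]
        diff_form_smooth[OF a that] diff_form_smooth[OF b that]])
  fix i j p and vs :: "nat \<Rightarrow> 'e"
  assume "i \<in> charts M" "j \<in> charts M" "p \<in> cdom M i \<inter> cdom M j"
  then show "\<alpha> i p vs + \<beta> i p vs =
      \<alpha> j p (frechet_derivative (transition M i j) (at (coord M i p)) \<circ> vs) +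
      \<beta> j p (frechet_derivative (transition M i j) (at (coord M i p)) \<circ> vs)"
    by (intro arg_cong2[where f = plus] diff_form_transition[OF a] diff_form_transition[OF b]) auto
qed

lemma diff_form_scale:
  fixes M :: "('a, 'i, 'e::euclidean_space) mfd"
  assumes "smooth_atlas M" and a: "diff_form M k \<alpha>"
    and f: "\<And>i. i \<in> charts M \<Longrightarrow> smooth_on (coord M i ` cdom M i) (\<lambda>x. f (coord_inv M i x))"
  shows "diff_form M k (f \<odot> \<alpha>)"
  unfolding diff_form_def fscale_def
proof (intro conjI ballI allI)
  show "alternating_form k (\<lambda>vs. f p * \<alpha> i p vs)" if "i \<in> charts M" "p \<in> cdom M i" for i p
    by (rule alternating_form_scale[OF diff_form_alternating[OF a that]])
  show "smooth_on (coord M i ` cdom M i) (\<lambda>x. f (coord_inv M i x) * \<alpha> i (coord_inv M i x) vs)"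
    if "i \<in> charts M" for i vs
    by (rule smooth_on_mult[OF smooth_atlas_open[OF assms(1) that] f[OF that] diff_form_smooth[OF a that]])
  fix i j p and vs :: "nat \<Rightarrow> 'e"
  assume "i \<in> charts M" "j \<in> charts M" "p \<in> cdom M i \<inter> cdom M j"
  then show "f p * \<alpha> i p vs =
      f p * \<alpha> j p (frechet_derivative (transition M i j) (at (coord M i p)) \<circ> vs)"
    by (intro arg_cong[where f = "times (f p)"] diff_form_transition[OF a]) auto
qed

lemma diff_form_diff:
  assumes "smooth_atlas M" and a: "diff_form M k \<alpha>" and b: "diff_form M k \<beta>"
  shows "diff_form M k (\<alpha> - \<beta>)"
proof -
  have "diff_form M k (\<alpha> + (\<lambda>_. - 1) \<odot> \<beta>)"
    by (intro diff_form_add diff_form_scale assms smooth_on_const)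
  also have "\<alpha> + (\<lambda>_. - 1) \<odot> \<beta> = \<alpha> - \<beta>"
    by (simp add: fscale_def fun_eq_iff)
  finally show ?thesis .
qed

lemma diff_form_wedge:
  fixes M :: "('a, 'i, 'e::euclidean_space) mfd"
  assumes "smooth_atlas M" and a: "diff_form M k \<alpha>" and b: "diff_form M l \<beta>"
  shows "diff_form M (k + l) (\<alpha> \<and>\<^bsub>k,l\<^esub> \<beta>)"
  unfolding diff_form_def
proof (intro conjI ballI allI)
  show "alternating_form (k + l) ((\<alpha> \<and>\<^bsub>k,l\<^esub> \<beta>) i p)" if "i \<in> charts M" "p \<in> cdom M i" for i p
    unfolding wedge_def
    by (rule alternating_form_wedge[OF diff_form_alternating[OF a that] diff_form_alternating[OF b that]])
  show "smooth_on (coord M i ` cdom M i) (\<lambda>x. (\<alpha> \<and>\<^bsub>k,l\<^esub> \<beta>) i (coord_inv M i x) vs)"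
    if "i \<in> charts M" for i vs
    unfolding wedge_def divide_inverse
    by (intro smooth_on_mult smooth_on_sum smooth_on_const smooth_atlas_open[OF assms(1) that]
        diff_form_smooth[OF a that] diff_form_smooth[OF b that])
  fix i j p and vs :: "nat \<Rightarrow> 'e"
  assume i: "i \<in> charts M" and j: "j \<in> charts M" and p: "p \<in> cdom M i \<inter> cdom M j"
  let ?D = "frechet_derivative (transition M i j) (at (coord M i p))"
  have "\<alpha> i p us = \<alpha> j p (?D \<circ> us)" "\<beta> i p us = \<beta> j p (?D \<circ> us)" for us
    using p by (auto intro: diff_form_transition[OF a i j] diff_form_transition[OF b i j])
  then have "\<alpha> i p = (\<lambda>us. \<alpha> j p (?D \<circ> us))" "\<beta> i p = (\<lambda>us. \<beta> j p (?D \<circ> us))"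
    by blast+
  then show "(\<alpha> \<and>\<^bsub>k,l\<^esub> \<beta>) i p vs = (\<alpha> \<and>\<^bsub>k,l\<^esub> \<beta>) j p (?D \<circ> vs)"
    by (simp add: wedge_def comp_def)
qed


subsection \<open>Forms on the sin-cone\<close>

lemma sin_cone_simps [simp]:
  "charts (sin_cone M) = charts M"
  "cdom (sin_cone M) i = cdom M i \<times> {0<..<pi}"
  "coord (sin_cone M) i (p, t) = (coord M i p, t)"
  by (simp_all add: sin_cone_def)

lemma coord_sin_cone_image: "coord (sin_cone M) i ` (A \<times> B) = coord M i ` A \<times> B"
  by (force simp: image_iff)

lemma inj_on_coord_sin_cone:
  "inj_on (coord M i) (cdom M i) \<Longrightarrow> inj_on (coord (sin_cone M) i) (cdom (sin_cone M) i)"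
  by (auto simp: inj_on_def)

lemma coord_inv_sin_cone:
  assumes "smooth_atlas M" "i \<in> charts M" "x \<in> coord M i ` cdom M i" "t \<in> {0<..<pi}"
  shows "coord_inv (sin_cone M) i (x, t) = (coord_inv M i x, t)"
proof -
  obtain p where p: "p \<in> cdom M i" "x = coord M i p" using assms by auto
  have inj: "inj_on (coord M i) (cdom M i)" using assms unfolding smooth_atlas_def by simp
  have "coord_inv (sin_cone M) i (coord (sin_cone M) i (p, t)) = (p, t)"
    using p assms(4) by (intro coord_inv_coord[OF inj_on_coord_sin_cone[OF inj]]) simp
  then show ?thesis using p by (simp add: coord_inv_coord[OF inj])
qed

lemma transition_sin_cone:
  assumes "smooth_atlas M" "i \<in> charts M" "x \<in> coord M i ` cdom M i" "t \<in> {0<..<pi}"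
  shows "transition (sin_cone M) i j (x, t) = (transition M i j x, t)"
  using coord_inv_sin_cone[OF assms] by (simp add: transition_def)

lemma bounded_linear_inl: "bounded_linear (\<lambda>u. (u, 0))"
  and bounded_linear_inr: "bounded_linear (\<lambda>u. (0, u))"
  by (simp_all add: bounded_linear_Pair bounded_linear_ident bounded_linear_zero)

lemma smooth_on_Pair:
  fixes f :: "'a::euclidean_space \<Rightarrow> 'b::real_normed_vector" and g :: "'a \<Rightarrow> 'c::real_normed_vector"
  assumes "open S" "smooth_on S f" "smooth_on S g"
  shows "smooth_on S (\<lambda>x. (f x, g x))"
proof -
  have "smooth_on S (\<lambda>x. (f x, 0::'c) + (0::'b, g x))"
    by (rule smooth_on_add[OF assms(1) smooth_on_bounded_linear[OF bounded_linear_inl assms(1,2)]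
        smooth_on_bounded_linear[OF bounded_linear_inr assms(1,3)]])
  then show ?thesis by simp
qed

lemma smooth_on_compose_fst:
  fixes g :: "'a::euclidean_space \<Rightarrow> 'c::real_normed_vector"
  assumes "open A" "open B" "smooth_on A g"
  shows "smooth_on (A \<times> B) (\<lambda>z :: 'a \<times> 'b::euclidean_space. g (fst z))"
  by (rule smooth_on_compose[OF assms(3)
        smooth_on_bounded_linear[OF bounded_linear_fst open_Times[OF assms(1,2)] smooth_on_ident]])
    (auto simp: open_Times assms)

lemma smooth_on_compose_snd:
  fixes g :: "'b::euclidean_space \<Rightarrow> 'c::real_normed_vector"
  assumes "open A" "open B" "smooth_on B g"
  shows "smooth_on (A \<times> B) (\<lambda>z :: 'a::euclidean_space \<times> 'b. g (snd z))"
  by (rule smooth_on_compose[OF assms(3)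
        smooth_on_bounded_linear[OF bounded_linear_snd open_Times[OF assms(1,2)] smooth_on_ident]])
    (auto simp: open_Times assms)

lemma smooth_atlas_sin_cone:
  assumes M: "smooth_atlas M"
  shows "smooth_atlas (sin_cone M)"
  unfolding smooth_atlas_def
proof (intro ballI conjI)
  fix i assume "i \<in> charts (sin_cone M)"
  then have i: "i \<in> charts M" by simp
  then show "inj_on (coord (sin_cone M) i) (cdom (sin_cone M) i)"
    by (intro inj_on_coord_sin_cone) (use M in \<open>simp add: smooth_atlas_def\<close>)
  fix j assume "j \<in> charts (sin_cone M)"
  then have j: "j \<in> charts M" by simp
  have img: "coord (sin_cone M) i ` (cdom (sin_cone M) i \<inter> cdom (sin_cone M) j)
      = coord M i ` (cdom M i \<inter> cdom M j) \<times> {0<..<pi}"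
    by (simp add: Times_Int_distrib1[symmetric] coord_sin_cone_image)
  have op: "open (coord M i ` (cdom M i \<inter> cdom M j))"
    and sm: "smooth_on (coord M i ` (cdom M i \<inter> cdom M j)) (transition M i j)"
    using M i j unfolding smooth_atlas_def by auto
  then show op': "open (coord (sin_cone M) i ` (cdom (sin_cone M) i \<inter> cdom (sin_cone M) j))"
    unfolding img by (intro open_Times) auto
  show "smooth_on (coord (sin_cone M) i ` (cdom (sin_cone M) i \<inter> cdom (sin_cone M) j))
      (transition (sin_cone M) i j)"
    unfolding img
  proof (rule smooth_on_cong)
    show "open (coord M i ` (cdom M i \<inter> cdom M j) \<times> {0<..<pi})"
      using op' unfolding img .
    show "smooth_on (coord M i ` (cdom M i \<inter> cdom M j) \<times> {0<..<pi})
        (\<lambda>z. (transition M i j (fst z), snd z))"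
      using op by (intro smooth_on_Pair smooth_on_compose_fst sm open_Times
          smooth_on_compose_snd[where g = "\<lambda>x. x"] smooth_on_ident) auto
    show "(transition M i j (fst z), snd z) = transition (sin_cone M) i j z"
      if "z \<in> coord M i ` (cdom M i \<inter> cdom M j) \<times> {0<..<pi}" for z
      using that transition_sin_cone[OF M i, of "fst z" "snd z" j] by auto
  qed
qed

text \<open>The transition maps of the cone do not change the last coordinate. Hence pullbacks from \<open>N\<close> and
  the form \<open>dt\<close> transform as forms on the cone.\<close>

lemma transition_sin_cone_derivative:
  assumes M: "smooth_atlas M" and i: "i \<in> charts M" and j: "j \<in> charts M"
    and p: "p \<in> cdom M i" "p \<in> cdom M j" and t: "t \<in> {0<..<pi}"
  shows "frechet_derivative (transition (sin_cone M) i j) (at (coord (sin_cone M) i (p, t))) v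
    = (frechet_derivative (transition M i j) (at (coord M i p)) (fst v), snd v)"
proof -
  let ?D = "frechet_derivative (transition M i j) (at (coord M i p))"
  let ?S = "coord M i ` (cdom M i \<inter> cdom M j)"
  have op: "open ?S" and sm: "smooth_on ?S (transition M i j)"
    using M i j unfolding smooth_atlas_def by auto
  have D: "(transition M i j has_derivative ?D) (at (fst (coord M i p, t)))"
    using smooth_on_differentiable[OF sm, of "coord M i p"] p by (simp add: frechet_derivative_works)
  have "((\<lambda>z. (transition M i j (fst z), snd z)) has_derivative (\<lambda>v. (?D (fst v), snd v)))
      (at (coord M i p, t))"
    by (rule has_derivative_Pair[OF has_derivative_compose[OF has_derivative_fst[OF has_derivative_ident] D]
          has_derivative_snd[OF has_derivative_ident]])
  moreover have "open (?S \<times> {0<..<pi})" using op by (intro open_Times) auto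
  moreover have "(coord M i p, t) \<in> ?S \<times> {0<..<pi}" using p t by auto
  moreover have "(transition M i j (fst z), snd z) = transition (sin_cone M) i j z"
    if "z \<in> ?S \<times> {0<..<pi}" for z
    using that transition_sin_cone[OF M i, of "fst z" "snd z" j] by auto
  ultimately have "(transition (sin_cone M) i j has_derivative (\<lambda>v. (?D (fst v), snd v)))
      (at (coord M i p, t))"
    by (rule has_derivative_transform_within_open)
  then show ?thesis by (simp add: frechet_derivative_at[symmetric])
qed

lemma diff_form_pull:
  fixes M :: "('a, 'i, 'e::euclidean_space) mfd"
  assumes M: "smooth_atlas M" and a: "diff_form M k \<alpha>"
  shows "diff_form (sin_cone M) k (pull \<alpha>)"
  unfolding diff_form_def pull_def
proof (intro conjI ballI allI)
  fix i assume "i \<in> charts (sin_cone M)"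
  then have i: "i \<in> charts M" by simp
  note op = smooth_atlas_open[OF M i]
  show "alternating_form k (\<lambda>vs. \<alpha> i (fst p) (\<lambda>m. fst (vs m)))" if "p \<in> cdom (sin_cone M) i" for p
    using that i by (intro alternating_form_compose[OF diff_form_alternating[OF a]] linear_fst) auto
  show "smooth_on (coord (sin_cone M) i ` cdom (sin_cone M) i)
      (\<lambda>x. \<alpha> i (fst (coord_inv (sin_cone M) i x)) (\<lambda>m. fst (vs m)))" for vs
  proof (rule smooth_on_cong[OF smooth_atlas_open[OF smooth_atlas_sin_cone[OF M]]])
    show "smooth_on (coord (sin_cone M) i ` cdom (sin_cone M) i)
        (\<lambda>z. \<alpha> i (coord_inv M i (fst z)) (\<lambda>m. fst (vs m)))"
      unfolding coord_sin_cone_image sin_cone_simps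
      using op by (intro smooth_on_compose_fst[OF _ _ diff_form_smooth[OF a i]]) auto
    show "\<alpha> i (coord_inv M i (fst z)) (\<lambda>m. fst (vs m))
        = \<alpha> i (fst (coord_inv (sin_cone M) i z)) (\<lambda>m. fst (vs m))"
      if "z \<in> coord (sin_cone M) i ` cdom (sin_cone M) i" for z
      using that coord_inv_sin_cone[OF M i, of "fst z" "snd z"]
      unfolding coord_sin_cone_image sin_cone_simps by auto
  qed (use i in simp)
  fix j q and vs :: "nat \<Rightarrow> 'e \<times> real"
  assume "j \<in> charts (sin_cone M)" and q: "q \<in> cdom (sin_cone M) i \<inter> cdom (sin_cone M) j"
  then have j: "j \<in> charts M" by simp
  obtain p t where pt: "q = (p, t)" "p \<in> cdom M i" "p \<in> cdom M j" "t \<in> {0<..<pi}" using q by auto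
  show "\<alpha> i (fst q) (\<lambda>m. fst (vs m)) = \<alpha> j (fst q) (\<lambda>m. fst
      ((frechet_derivative (transition (sin_cone M) i j) (at (coord (sin_cone M) i q)) \<circ> vs) m))"
    using diff_form_transition[OF a i j pt(2,3), of "\<lambda>m. fst (vs m)"]
      transition_sin_cone_derivative[OF M i j pt(2-4)]
    by (simp add: pt(1) comp_def del: sin_cone_simps(3))
qed

lemma diff_form_dt:
  fixes M :: "('a, 'i, 'e::euclidean_space) mfd"
  assumes M: "smooth_atlas M"
  shows "diff_form (sin_cone M) 1 (dt :: ('a \<times> real, 'i, 'e \<times> real, real) form)"
  unfolding diff_form_def dt_def
proof (intro conjI ballI allI)
  show "alternating_form 1 (\<lambda>vs. snd (vs 0 :: 'e \<times> real))"
    by (simp add: alternating_form_def linear_snd)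
next
  fix i j q and vs :: "nat \<Rightarrow> 'e \<times> real"
  assume "i \<in> charts (sin_cone M)" "j \<in> charts (sin_cone M)" and q: "q \<in> cdom (sin_cone M) i \<inter> cdom (sin_cone M) j"
  then have i: "i \<in> charts M" and j: "j \<in> charts M" by auto
  obtain p t where pt: "q = (p, t)" "p \<in> cdom M i" "p \<in> cdom M j" "t \<in> {0<..<pi}" using q by auto
  show "snd (vs 0) = snd ((frechet_derivative (transition (sin_cone M) i j) (at (coord (sin_cone M) i q)) \<circ> vs) 0)"
    using transition_sin_cone_derivative[OF M i j pt(2-4)] by (simp add: pt(1) del: sin_cone_simps(3))
qed (rule smooth_on_const)

lemma diff_form_scale_t:
  fixes \<alpha> :: "('a \<times> real, 'i, 'e::euclidean_space \<times> real, real) form"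
  assumes M: "smooth_atlas M" and a: "diff_form (sin_cone M) k \<alpha>" and f: "smooth_on {0<..<pi} f"
  shows "diff_form (sin_cone M) k ((\<lambda>q. f (snd q)) \<odot> \<alpha>)"
proof (rule diff_form_scale[OF smooth_atlas_sin_cone[OF M] a])
  fix i assume "i \<in> charts (sin_cone M)"
  then have i: "i \<in> charts M" by simp
  show "smooth_on (coord (sin_cone M) i ` cdom (sin_cone M) i) (\<lambda>x. f (snd (coord_inv (sin_cone M) i x)))"
  proof (rule smooth_on_cong[OF smooth_atlas_open[OF smooth_atlas_sin_cone[OF M]]])
    show "smooth_on (coord (sin_cone M) i ` cdom (sin_cone M) i) (\<lambda>z. f (snd z))"
      unfolding coord_sin_cone_image sin_cone_simps
      using smooth_atlas_open[OF M i] by (intro smooth_on_compose_snd[OF _ _ f]) auto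
    show "f (snd z) = f (snd (coord_inv (sin_cone M) i z))"
      if "z \<in> coord (sin_cone M) i ` cdom (sin_cone M) i" for z
      using that coord_inv_sin_cone[OF M i, of "fst z" "snd z"]
      unfolding coord_sin_cone_image sin_cone_simps by auto
  qed (use i in simp)
qed

section \<open>Open submanifolds and products\<close>

lemma open_coord_image:
  assumes "smooth_manifold M" "i \<in> charts M" "openin (space_top M) W" "W \<subseteq> cdom M i"
  shows "open (coord M i ` W)"
proof -
  let ?X = "subtopology (space_top M) (cdom M i)"
  have op: "open (coord M i ` cdom M i)"
    and h: "homeomorphic_map ?X (top_of_set (coord M i ` cdom M i)) (coord M i)"
    using assms unfolding smooth_manifold_def by blast+
  have "openin ?X W"
    using openin_subtopology_Int2[OF assms(3), of "cdom M i"] assms(4) by (simp add: inf_absorb2)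
  then have "openin (top_of_set (coord M i ` cdom M i)) (coord M i ` W)"
    using homeomorphic_map_openness_eq[OF h] by blast
  then show ?thesis
    using op openin_open_trans by blast
qed

lemma openin_coord_preimage:
  assumes M: "smooth_manifold M" and i: "i \<in> charts M" and "open U"
  shows "openin (space_top M) {p \<in> cdom M i. coord M i p \<in> U}"
proof -
  let ?X = "subtopology (space_top M) (cdom M i)"
  have op: "openin (space_top M) (cdom M i)"
    and h: "homeomorphic_map ?X (top_of_set (coord M i ` cdom M i)) (coord M i)"
    using M i unfolding smooth_manifold_def by blast+
  have ts: "topspace ?X = cdom M i"
    using openin_subset[OF op] by auto
  have "coord M i ` {p \<in> cdom M i. coord M i p \<in> U} = coord M i ` cdom M i \<inter> U" by auto
  then have "openin (top_of_set (coord M i ` cdom M i)) (coord M i ` {p \<in> cdom M i. coord M i p \<in> U})"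
    using \<open>open U\<close> by (simp add: openin_open_Int)
  then have "openin ?X {p \<in> cdom M i. coord M i p \<in> U}"
    using homeomorphic_map_openness_eq[OF h] ts by auto
  then show ?thesis using op openin_trans_full by blast
qed

lemma open_submanifold_simps [simp]:
  "charts (open_submanifold M V) = charts M"
  "cdom (open_submanifold M V) i = cdom M i \<inter> V"
  "coord (open_submanifold M V) = coord M"
  by (simp_all add: open_submanifold_def)

lemma coord_inv_open_submanifold:
  assumes "smooth_atlas M" "i \<in> charts M" "x \<in> coord M i ` (cdom M i \<inter> V)"
  shows "coord_inv (open_submanifold M V) i x = coord_inv M i x"
proof -
  obtain p where p: "p \<in> cdom M i \<inter> V" "x = coord M i p" using assms by auto
  have inj: "inj_on (coord M i) (cdom M i)" using assms unfolding smooth_atlas_def by simp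
  then have "inj_on (coord (open_submanifold M V) i) (cdom (open_submanifold M V) i)"
    by (auto intro: inj_on_subset)
  from coord_inv_coord[OF this, of p] p coord_inv_coord[OF inj, of p] show ?thesis by simp
qed

lemma smooth_atlas_open_submanifold:
  assumes M: "smooth_manifold M" and V: "openin (space_top M) V"
  shows "smooth_atlas (open_submanifold M V)"
  unfolding smooth_atlas_def
proof (intro ballI conjI)
  note A = smooth_manifold_imp_smooth_atlas[OF M]
  fix i assume "i \<in> charts (open_submanifold M V)"
  then have i: "i \<in> charts M" by simp
  then have "inj_on (coord M i) (cdom M i)" using A unfolding smooth_atlas_def by simp
  then show "inj_on (coord (open_submanifold M V) i) (cdom (open_submanifold M V) i)"
    by (auto intro: inj_on_subset)
  fix j assume "j \<in> charts (open_submanifold M V)"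
  then have j: "j \<in> charts M" by simp
  let ?W = "cdom (open_submanifold M V) i \<inter> cdom (open_submanifold M V) j"
  have "openin (space_top M) (cdom M i)" "openin (space_top M) (cdom M j)"
    using M i j unfolding smooth_manifold_def by blast+
  then have "openin (space_top M) ?W" using V by auto
  then have op: "open (coord M i ` ?W)" by (rule open_coord_image[OF M i]) auto
  then show "open (coord (open_submanifold M V) i ` ?W)" by simp
  have "smooth_on (coord M i ` (cdom M i \<inter> cdom M j)) (transition M i j)"
    using A i j unfolding smooth_atlas_def by blast
  then have "smooth_on (coord M i ` ?W) (transition M i j)"
    by (rule smooth_on_subset) auto
  then show "smooth_on (coord (open_submanifold M V) i ` ?W) (transition (open_submanifold M V) i j)"
    unfolding open_submanifold_simps(3)
  proof (rule smooth_on_cong[OF op, rotated])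
    show "transition M i j x = transition (open_submanifold M V) i j x" if "x \<in> coord M i ` ?W" for x
      using that coord_inv_open_submanifold[OF A i, of x V] unfolding transition_def by auto
  qed
qed

lemma diff_form_open_submanifold:
  fixes M :: "('a, 'i, 'e::euclidean_space) mfd"
  assumes M: "smooth_manifold M" and V: "openin (space_top M) V" and a: "diff_form M k \<alpha>"
  shows "diff_form (open_submanifold M V) k \<alpha>"
  unfolding diff_form_def
proof (intro ballI conjI allI)
  note A = smooth_manifold_imp_smooth_atlas[OF M]
  note A' = smooth_atlas_open_submanifold[OF M V]
  fix i assume "i \<in> charts (open_submanifold M V)"
  then have i: "i \<in> charts M" by simp
  show "alternating_form k (\<alpha> i p)" if "p \<in> cdom (open_submanifold M V) i" for p
    using diff_form_alternating[OF a i] that by simp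
  show "smooth_on (coord (open_submanifold M V) i ` cdom (open_submanifold M V) i)
      (\<lambda>x. \<alpha> i (coord_inv (open_submanifold M V) i x) vs)" for vs
  proof (rule smooth_on_cong[OF smooth_atlas_open[OF A']])
    show "smooth_on (coord (open_submanifold M V) i ` cdom (open_submanifold M V) i)
        (\<lambda>x. \<alpha> i (coord_inv M i x) vs)"
      by (rule smooth_on_subset[OF diff_form_smooth[OF a i]]) auto
    show "\<alpha> i (coord_inv M i x) vs = \<alpha> i (coord_inv (open_submanifold M V) i x) vs"
      if "x \<in> coord (open_submanifold M V) i ` cdom (open_submanifold M V) i" for x
      using that coord_inv_open_submanifold[OF A i, of x V] by simp
  qed (use i in simp)
  fix j p and vs :: "nat \<Rightarrow> 'e"
  assume "j \<in> charts (open_submanifold M V)"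
    and p: "p \<in> cdom (open_submanifold M V) i \<inter> cdom (open_submanifold M V) j"
  then have j: "j \<in> charts M" by simp
  have "frechet_derivative (transition (open_submanifold M V) i j) (at (coord M i p))
      = frechet_derivative (transition M i j) (at (coord M i p))"
  proof (rule frechet_derivative_transform_within_open)
    let ?S = "coord (open_submanifold M V) i `
      (cdom (open_submanifold M V) i \<inter> cdom (open_submanifold M V) j)"
    show "open ?S" and x: "coord M i p \<in> ?S"
      using A' i j p unfolding smooth_atlas_def by auto
    show "transition (open_submanifold M V) i j differentiable at (coord M i p)"
      using A' i j x smooth_on_differentiable unfolding smooth_atlas_def by fastforce
    show "transition (open_submanifold M V) i j x = transition M i j x" if "x \<in> ?S" for x
      using that coord_inv_open_submanifold[OF A i, of x V] unfolding transition_def by auto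
  qed
  then show "\<alpha> i p vs = \<alpha> j p (frechet_derivative (transition (open_submanifold M V) i j)
      (at (coord (open_submanifold M V) i p)) \<circ> vs)"
    using diff_form_transition[OF a i j] p by simp
qed

lemma second_countable_prod_topology:
  assumes "second_countable X" "second_countable Y"
  shows "second_countable (prod_topology X Y)"
proof -
  obtain A where A: "countable A" "\<forall>V\<in>A. openin X V"
    "\<forall>U x. openin X U \<and> x \<in> U \<longrightarrow> (\<exists>V\<in>A. x \<in> V \<and> V \<subseteq> U)"
    using assms(1) unfolding second_countable_def by blast
  obtain B where B: "countable B" "\<forall>V\<in>B. openin Y V"
    "\<forall>U x. openin Y U \<and> x \<in> U \<longrightarrow> (\<exists>V\<in>B. x \<in> V \<and> V \<subseteq> U)"
    using assms(2) unfolding second_countable_def by blast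
  show ?thesis
    unfolding second_countable_def
  proof (intro exI[of _ "(\<lambda>(U, V). U \<times> V) ` (A \<times> B)"] conjI allI impI)
    show "countable ((\<lambda>(U, V). U \<times> V) ` (A \<times> B))" using A(1) B(1) by simp
    show "\<forall>V\<in>(\<lambda>(U, V). U \<times> V) ` (A \<times> B). openin (prod_topology X Y) V"
      using A(2) B(2) by (auto simp: openin_prod_Times_iff)
    fix W z assume W: "openin (prod_topology X Y) W \<and> z \<in> W"
    obtain x y where z: "z = (x, y)" by fastforce
    with W obtain U V where UV: "openin X U" "openin Y V" "x \<in> U" "y \<in> V" "U \<times> V \<subseteq> W"
      unfolding openin_prod_topology_alt by blast
    obtain U' where U': "U' \<in> A" "x \<in> U'" "U' \<subseteq> U" using A(3) UV by blast
    obtain V' where V': "V' \<in> B" "y \<in> V'" "V' \<subseteq> V" using B(3) UV by blast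
    show "\<exists>W'\<in>(\<lambda>(U, V). U \<times> V) ` (A \<times> B). z \<in> W' \<and> W' \<subseteq> W"
      using U' V' UV z by (intro bexI[of _ "U' \<times> V'"]) auto
  qed
qed

lemma second_countable_euclidean:
  "second_countable (euclidean :: 'a::second_countable_topology topology)"
proof -
  obtain B :: "'a set set" where "countable B" "topological_basis B"
    using ex_countable_basis by blast
  then show ?thesis
    unfolding second_countable_def topological_basis_iff
    by (metis open_openin topological_basisE \<open>topological_basis B\<close> topological_basis_open)
qed

lemma smooth_manifold_sin_cone:
  assumes N: "smooth_manifold N"
  shows "smooth_manifold (sin_cone N)"
  unfolding smooth_manifold_def
proof (intro conjI ballI)
  have top: "space_top (sin_cone N) = prod_topology (space_top N) (top_of_set {0<..<pi})"
    by (simp add: sin_cone_def)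
  show "Hausdorff_space (space_top (sin_cone N))"
    unfolding top Hausdorff_space_prod_topology
    using N Hausdorff_space_subtopology Hausdorff_space_euclidean unfolding smooth_manifold_def by blast
  show "second_countable (space_top (sin_cone N))"
    unfolding top using N unfolding smooth_manifold_def
    by (intro second_countable_prod_topology second_countable_subtopology second_countable_euclidean) auto
  show "(\<Union>i\<in>charts (sin_cone N). cdom (sin_cone N) i) = topspace (space_top (sin_cone N))"
    unfolding top using N unfolding smooth_manifold_def by auto
  fix i assume "i \<in> charts (sin_cone N)"
  then have i: "i \<in> charts N" by simp
  have op: "openin (space_top N) (cdom N i)"
    and h: "homeomorphic_map (subtopology (space_top N) (cdom N i))
          (top_of_set (coord N i ` cdom N i)) (coord N i)"
    using N i unfolding smooth_manifold_def by blast+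
  show "openin (space_top (sin_cone N)) (cdom (sin_cone N) i)"
    unfolding top using op by (simp add: openin_prod_Times_iff)
  show "open (coord (sin_cone N) i ` cdom (sin_cone N) i)"
    using smooth_atlas_open[OF smooth_atlas_sin_cone[OF smooth_manifold_imp_smooth_atlas[OF N]], of i] i
    by simp
  obtain g where g: "homeomorphic_maps (subtopology (space_top N) (cdom N i))
      (top_of_set (coord N i ` cdom N i)) (coord N i) g"
    using h homeomorphic_map_maps by blast
  have "homeomorphic_maps
      (prod_topology (subtopology (space_top N) (cdom N i)) (top_of_set {0<..<pi}))
      (prod_topology (top_of_set (coord N i ` cdom N i)) (top_of_set {0<..<pi}))
      (\<lambda>(x, y). (coord N i x, id y)) (\<lambda>(x, y). (g x, id y))"
    using g by (subst homeomorphic_maps_prod) (simp add: homeomorphic_maps_id)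
  moreover have "subtopology (space_top (sin_cone N)) (cdom (sin_cone N) i)
      = prod_topology (subtopology (space_top N) (cdom N i)) (top_of_set {0<..<pi})"
    unfolding top sin_cone_simps subtopology_Times by (simp add: subtopology_subtopology)
  moreover have "top_of_set (coord (sin_cone N) i ` cdom (sin_cone N) i)
      = prod_topology (top_of_set (coord N i ` cdom N i)) (top_of_set {0<..<pi})"
    unfolding sin_cone_simps coord_sin_cone_image subtopology_Times[symmetric] by simp
  moreover have "(\<lambda>(x, y). (coord N i x, id y)) = coord (sin_cone N) i"
    by (simp add: sin_cone_def)
  ultimately show "homeomorphic_map (subtopology (space_top (sin_cone N)) (cdom (sin_cone N) i))
      (top_of_set (coord (sin_cone N) i ` cdom (sin_cone N) i)) (coord (sin_cone N) i)"
    using homeomorphic_map_maps by auto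
next
  fix i j assume "i \<in> charts (sin_cone N)" "j \<in> charts (sin_cone N)"
  then show "smooth_on (coord (sin_cone N) i ` (cdom (sin_cone N) i \<inter> cdom (sin_cone N) j))
      (transition (sin_cone N) i j)"
    using smooth_atlas_sin_cone[OF smooth_manifold_imp_smooth_atlas[OF N]]
    unfolding smooth_atlas_def by blast
qed

lemma sin_cone_open_submanifold:
  "sin_cone (open_submanifold N V) = open_submanifold (sin_cone N) (V \<times> {0<..<pi})"
  by (auto simp: sin_cone_def open_submanifold_def subtopology_Times subtopology_subtopology fun_eq_iff)

text \<open>A 1-form on a manifold covered by a single chart is given by its coefficients in that chart;
  in the other charts the derivatives of the transition maps determine it.\<close>

lemma diff_form_extend:
  fixes M :: "('a, 'i, 'e::euclidean_space) mfd"
  assumes M: "smooth_atlas M" and i: "i \<in> charts M"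
    and global: "\<And>j. j \<in> charts M \<Longrightarrow> cdom M j \<subseteq> cdom M i"
    and lin: "\<And>p. p \<in> cdom M i \<Longrightarrow> linear (a p)"
    and sm: "\<And>w. smooth_on (coord M i ` cdom M i) (\<lambda>x. a (coord_inv M i x) w)"
  shows "diff_form M 1 (\<lambda>j p vs. a p (frechet_derivative (transition M j i) (at (coord M j p)) (vs 0)))"
  unfolding diff_form_def
proof (intro ballI conjI allI)
  have int: "cdom M j \<inter> cdom M i = cdom M j" if "j \<in> charts M" for j using global[OF that] by auto
  have T: "open (coord M j ` cdom M j)" "smooth_on (coord M j ` cdom M j) (transition M j i)"
    if "j \<in> charts M" for j
    using M i that int[OF that] unfolding smooth_atlas_def by force+
  fix j assume j: "j \<in> charts M"
  have linD: "linear (frechet_derivative (transition M j i) (at (coord M j p)))" if "p \<in> cdom M j" for p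
    using that by (intro linear_frechet_derivative smooth_on_differentiable[OF T(2)[OF j]]) simp
  show "alternating_form 1 (\<lambda>vs. a p (frechet_derivative (transition M j i) (at (coord M j p)) (vs 0)))"
    if p: "p \<in> cdom M j" for p
    using linear_compose[OF linD[OF p] lin] global[OF j] p
    by (auto simp: alternating_form_def comp_def)
  show "smooth_on (coord M j ` cdom M j) (\<lambda>x. a (coord_inv M j x)
      (frechet_derivative (transition M j i) (at (coord M j (coord_inv M j x))) (vs 0)))" for vs
  proof (rule smooth_on_cong[OF T(1)[OF j]])
    show "smooth_on (coord M j ` cdom M j) (\<lambda>x. \<Sum>b\<in>Basis.
        (frechet_derivative (transition M j i) (at x) (vs 0) \<bullet> b) *\<^sub>R a (coord_inv M i (transition M j i x)) b)"
    proof (intro smooth_on_sum smooth_on_scaleR T(1)[OF j])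
      fix b :: 'e
      show "smooth_on (coord M j ` cdom M j) (\<lambda>x. frechet_derivative (transition M j i) (at x) (vs 0) \<bullet> b)"
        by (rule smooth_on_bounded_linear[OF bounded_linear_inner_left T(1)[OF j]
            smooth_on_frechet_derivative[OF T(2)[OF j]]])
      show "smooth_on (coord M j ` cdom M j) (\<lambda>x. a (coord_inv M i (transition M j i x)) b)"
      proof (rule smooth_on_compose[OF sm T(2)[OF j] T(1)[OF j]])
        show "transition M j i ` coord M j ` cdom M j \<subseteq> coord M i ` cdom M i"
          using smooth_atlas_transition[OF M j] global[OF j] by auto
      qed
    qed
    fix x assume "x \<in> coord M j ` cdom M j"
    then obtain p where p: "p \<in> cdom M j" "x = coord M j p" by auto
    then have pi: "p \<in> cdom M i" using global[OF j] by auto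
    let ?u = "frechet_derivative (transition M j i) (at x) (vs 0)"
    have "a p ?u = a p (\<Sum>b\<in>Basis. (?u \<bullet> b) *\<^sub>R b)" by (simp add: euclidean_representation)
    also have "\<dots> = (\<Sum>b\<in>Basis. (?u \<bullet> b) *\<^sub>R a p b)"
      using lin[OF pi] by (simp add: linear_sum linear_scale)
    finally show "(\<Sum>b\<in>Basis. (?u \<bullet> b) *\<^sub>R a (coord_inv M i (transition M j i x)) b)
        = a (coord_inv M j x) (frechet_derivative (transition M j i) (at (coord M j (coord_inv M j x))) (vs 0))"
      using p pi by (simp add: smooth_atlas_coord_inv[OF M] smooth_atlas_transition[OF M] i j)
  qed
  fix k p and vs :: "nat \<Rightarrow> 'e"
  assume k: "k \<in> charts M" and p: "p \<in> cdom M j \<inter> cdom M k"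
  let ?x = "coord M j p"
  let ?S = "coord M j ` (cdom M j \<inter> cdom M k)"
  have S: "open ?S" "smooth_on ?S (transition M j k)" "?x \<in> ?S"
    using M j k p unfolding smooth_atlas_def by auto
  have x: "transition M j k ?x = coord M k p"
    using p by (simp add: smooth_atlas_transition[OF M j])
  have d1: "transition M j k differentiable at ?x"
    using S smooth_on_differentiable by blast
  have d2: "transition M k i differentiable at (transition M j k ?x)"
    using p x by (intro smooth_on_differentiable[OF T(2)[OF k]]) simp
  have d3: "transition M j i differentiable at ?x"
    using p by (intro smooth_on_differentiable[OF T(2)[OF j]]) simp
  have "frechet_derivative (transition M j i) (at ?x)
      = frechet_derivative (transition M k i \<circ> transition M j k) (at ?x)"
  proof (rule frechet_derivative_transform_within_open[OF d3 S(1) S(3)])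
    fix y assume "y \<in> ?S"
    then show "transition M j i y = (transition M k i \<circ> transition M j k) y"
      by (auto simp: smooth_atlas_transition[OF M] j k)
  qed
  also have "\<dots> = frechet_derivative (transition M k i) (at (coord M k p)) \<circ>
      frechet_derivative (transition M j k) (at ?x)"
    using frechet_derivative_compose[OF d1 d2] x by simp
  finally show "a p (frechet_derivative (transition M j i) (at ?x) (vs 0)) =
      a p (frechet_derivative (transition M k i) (at (coord M k p))
        ((frechet_derivative (transition M j k) (at ?x) \<circ> vs) 0))"
    by simp
qed

section \<open>Orthonormal triples of 2-forms\<close>

text \<open>The forms carry numerals as indices; \<open>1\<close> is not rewritten to \<open>Suc 0\<close>, so that the facts about
  \<open>\<omega> 1\<close> apply.\<close>

declare One_nat_def [simp del]

text \<open>The products of 1-forms and 2-forms on vectors. For skew \<open>\<alpha>\<close> and \<open>\<beta>\<close>, the sum over all permutations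
  reduces to one term for each shuffle.\<close>

abbreviation wedge11 :: "('v \<Rightarrow> 'r) \<Rightarrow> ('v \<Rightarrow> 'r) \<Rightarrow> 'v \<Rightarrow> 'v \<Rightarrow> 'r::comm_ring" where
  "wedge11 \<alpha> \<beta> x y \<equiv> \<alpha> x * \<beta> y - \<alpha> y * \<beta> x"

abbreviation wedge21 :: "('v \<Rightarrow> 'v \<Rightarrow> 'r) \<Rightarrow> ('v \<Rightarrow> 'r) \<Rightarrow> 'v \<Rightarrow> 'v \<Rightarrow> 'v \<Rightarrow> 'r::comm_ring" where
  "wedge21 \<alpha> \<beta> x y z \<equiv> \<alpha> x y * \<beta> z - \<alpha> x z * \<beta> y + \<alpha> y z * \<beta> x"

abbreviation wedge12 :: "('v \<Rightarrow> 'r) \<Rightarrow> ('v \<Rightarrow> 'v \<Rightarrow> 'r) \<Rightarrow> 'v \<Rightarrow> 'v \<Rightarrow> 'v \<Rightarrow> 'r::comm_ring" where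
  "wedge12 \<alpha> \<beta> x y z \<equiv> \<alpha> x * \<beta> y z - \<alpha> y * \<beta> x z + \<alpha> z * \<beta> x y"

definition wedge22 :: "('v \<Rightarrow> 'v \<Rightarrow> real) \<Rightarrow> ('v \<Rightarrow> 'v \<Rightarrow> real) \<Rightarrow> 'v \<Rightarrow> 'v \<Rightarrow> 'v \<Rightarrow> 'v \<Rightarrow> real" where
  "wedge22 \<alpha> \<beta> a b c d = \<alpha> a b * \<beta> c d - \<alpha> a c * \<beta> b d + \<alpha> a d * \<beta> b c
     + \<alpha> b c * \<beta> a d - \<alpha> b d * \<beta> a c + \<alpha> c d * \<beta> a b"

text \<open>Independence says that no hyperplane contains the image of \<open>z \<mapsto> (a1 z, a2 z, a3 z)\<close>.\<close>

lemma dual_vectors_3: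
  fixes a1 a2 a3 :: "'v::real_vector \<Rightarrow> real"
  assumes lin: "linear a1" "linear a2" "linear a3"
    and ind: "\<And>c1 c2 c3. (\<And>z. c1 * a1 z + c2 * a2 z + c3 * a3 z = 0) \<Longrightarrow> c1 = 0 \<and> c2 = 0 \<and> c3 = 0"
  obtains Y1 Y2 Y3 where "a1 Y1 = 1" "a2 Y1 = 0" "a3 Y1 = 0" "a1 Y2 = 0" "a2 Y2 = 1" "a3 Y2 = 0"
    "a1 Y3 = 0" "a2 Y3 = 0" "a3 Y3 = 1"
proof -
  let ?f = "\<lambda>z. (a1 z, a2 z, a3 z)"
  have linf: "linear ?f"
    using lin by (simp add: linear_iff)
  then have span: "span (range ?f) = range ?f"
    by (simp add: linear_subspace_image span_eq_iff)
  have "range ?f = UNIV"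
  proof (rule ccontr)
    assume "range ?f \<noteq> UNIV"
    then obtain c where c: "c \<noteq> 0" "\<forall>x\<in>range ?f. c \<bullet> x = 0"
      using span_not_UNIV_orthogonal[of "range ?f"] unfolding span by blast
    obtain c1 c2 c3 where "c = (c1, c2, c3)" by (metis prod_cases3)
    with c ind[of c1 c2 c3] show False by (simp add: inner_Pair zero_prod_def add.assoc)
  qed
  then have "(1, 0, 0) \<in> range ?f" "(0, 1, 0) \<in> range ?f" "(0, 0, 1) \<in> range ?f" by auto
  then show thesis using that by auto
qed

text \<open>The algebraic conditions of an \<open>SU(2)\<close>-structure on the tangent space at a point, apart from
  \<open>\<eta>\<close> and the sign condition. The dimension is arbitrary.\<close>

locale orthonormal_triple =
  fixes w :: "nat \<Rightarrow> 'v::real_vector \<Rightarrow> 'v \<Rightarrow> real" and v :: "'v \<Rightarrow> 'v \<Rightarrow> 'v \<Rightarrow> 'v \<Rightarrow> real"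
  assumes linear_left: "r \<in> {1, 2, 3} \<Longrightarrow> linear (\<lambda>x. w r x y)"
    and skew: "r \<in> {1, 2, 3} \<Longrightarrow> w r x y = - w r y x"
    and wedge: "r \<in> {1, 2, 3} \<Longrightarrow> s \<in> {1, 2, 3} \<Longrightarrow>
      wedge22 (w r) (w s) a b c d = (if r = s then v a b c d else 0)"
    and nonzero: "\<exists>a b c d. v a b c d \<noteq> 0"
begin

lemma self: "r \<in> {1, 2, 3} \<Longrightarrow> w r x x = 0"
  using skew[of r x x] by simp

lemma linear_right: "r \<in> {1, 2, 3} \<Longrightarrow> linear (w r x)"
proof -
  assume r: "r \<in> {1, 2, 3}"
  have "w r x = (\<lambda>y. - w r y x)" using skew[OF r] by blast
  then show ?thesis using linear_compose_neg[OF linear_left[OF r, of x]] by simp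
qed

lemmas bilinear_simps =
  linear_add[OF linear_left] linear_diff[OF linear_left] linear_scale[OF linear_left]
  linear_add[OF linear_right] linear_diff[OF linear_right] linear_scale[OF linear_right]

text \<open>If \<open>X\<close> is annihilated by the 4-form, then \<open>w r\<close> is divisible by \<open>w r X\<close>, hence decomposable
  and of square zero, unless \<open>w r X\<close> vanishes.\<close>

lemma kernel_of_volume:
  assumes r: "r \<in> {1, 2, 3}" and X: "\<And>b c d. v X b c d = 0"
  shows "w r X b = 0"
proof (rule ccontr)
  assume nz: "w r X b \<noteq> 0"
  have dec: "w r c d = (w r X c * w r b d - w r X d * w r b c) / w r X b" for c d
    using wedge[OF r r, of X b c d] X nz by (simp add: wedge22_def field_simps)
  have "w r X b * w r X b * v c d e f = 0" for c d e f
  proof -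
    have "w r X b * w r p q = w r X p * w r b q - w r X q * w r b p" for p q
      using dec[of p q] nz by simp
    then have "wedge22 (\<lambda>p q. w r X b * w r p q) (\<lambda>p q. w r X b * w r p q) c d e f = 0"
      by (simp only: wedge22_def) (simp add: algebra_simps)
    moreover have "wedge22 (\<lambda>p q. w r X b * w r p q) (\<lambda>p q. w r X b * w r p q) c d e f
        = w r X b * w r X b * wedge22 (w r) (w r) c d e f"
      by (simp add: wedge22_def algebra_simps)
    ultimately show ?thesis using wedge[OF r r, of c d e f] by simp
  qed
  then show False using nz nonzero by simp
qed

text \<open>A combination \<open>\<Sum> c r * w r\<close> that vanishes on \<open>X\<close> has the square \<open>(\<Sum> (c r)\<^sup>2) v\<close>, so \<open>X\<close> would be in the
  kernel of \<open>v\<close>.\<close>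

lemma independent:
  assumes nz: "w r X b \<noteq> 0" "r \<in> {1, 2, 3}"
    and "\<And>z. c1 * w 1 X z + c2 * w 2 X z + c3 * w 3 X z = 0"
  shows "c1 = 0 \<and> c2 = 0 \<and> c3 = 0"
proof -
  have "(c1\<^sup>2 + c2\<^sup>2 + c3\<^sup>2) * v X b c d = 0" for b c d
  proof -
    let ?u = "\<lambda>p q. c1 * w 1 p q + c2 * w 2 p q + c3 * w 3 p q"
    have "wedge22 ?u ?u X b c d = c1\<^sup>2 * wedge22 (w 1) (w 1) X b c d
        + c2\<^sup>2 * wedge22 (w 2) (w 2) X b c d + c3\<^sup>2 * wedge22 (w 3) (w 3) X b c d
        + 2 * (c1 * c2 * wedge22 (w 1) (w 2) X b c d + c1 * c3 * wedge22 (w 1) (w 3) X b c d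
          + c2 * c3 * wedge22 (w 2) (w 3) X b c d)"
      unfolding wedge22_def by algebra
    also have "\<dots> = (c1\<^sup>2 + c2\<^sup>2 + c3\<^sup>2) * v X b c d"
      by (simp add: wedge algebra_simps)
    finally show ?thesis using assms(3) by (simp add: wedge22_def)
  qed
  moreover have "\<exists>b c d. v X b c d \<noteq> 0"
    using kernel_of_volume[OF nz(2), of X b] nz(1) by blast
  ultimately have "c1\<^sup>2 + c2\<^sup>2 + c3\<^sup>2 = 0" by (metis mult_eq_0_iff)
  then show ?thesis
    by (simp add: add_nonneg_eq_0_iff)
qed

text \<open>The contraction of \<open>v\<close> with \<open>X\<close> is divisible by each of the three independent 1-forms
  \<open>w r X\<close>, hence a multiple of their product.\<close>

lemma volume_contract:
  assumes dual: "\<And>r s. r \<in> {1, 2, 3} \<Longrightarrow> s \<in> {1, 2, 3} \<Longrightarrow> w r X (Y s) = (if r = s then 1 else 0)"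
  shows "v X b c d = v X (Y 1) (Y 2) (Y 3) *
    (w 1 X b * (w 2 X c * w 3 X d - w 3 X c * w 2 X d)
     - w 1 X c * (w 2 X b * w 3 X d - w 3 X b * w 2 X d)
     + w 1 X d * (w 2 X b * w 3 X c - w 3 X b * w 2 X c))"
proof -
  have v: "v X b c d = 2 * (w r X b * w r c d - w r X c * w r b d + w r X d * w r b c)"
    if "r \<in> {1, 2, 3}" for r b c d
    using wedge[OF that that, of X b c d] by (simp add: wedge22_def)
  have div: "w r X e * v X b c d - w r X b * v X e c d + w r X c * v X e b d - w r X d * v X e b c = 0"
    if r: "r \<in> {1, 2, 3}" for r b c d e
    unfolding v[OF r] by (simp add: algebra_simps)
  have 1: "v X b c d = w 1 X b * v X (Y 1) c d - w 1 X c * v X (Y 1) b d + w 1 X d * v X (Y 1) b c" for b c d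
    using div[of 1 "Y 1" b c d] by (simp add: dual algebra_simps)
  have 2: "v X (Y 1) c d = - w 2 X c * v X (Y 2) (Y 1) d + w 2 X d * v X (Y 2) (Y 1) c" for c d
    using div[of 2 "Y 2" "Y 1" c d] by (simp add: dual algebra_simps)
  have 3: "v X (Y 2) (Y 1) d = w 3 X d * v X (Y 3) (Y 2) (Y 1)" for d
    using div[of 3 "Y 3" "Y 2" "Y 1" d] by (simp add: dual algebra_simps)
  have "v X (Y 1) (Y 2) (Y 3) = - v X (Y 3) (Y 2) (Y 1)"
    using 2[of "Y 2" "Y 3"] 3[of "Y 3"] 3[of "Y 2"] by (simp add: dual)
  then show ?thesis
    unfolding 1[of b c d] 2[of c d] 2[of b d] 2[of b c] 3[of b] 3[of c] 3[of d]
    by (simp add: algebra_simps)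
qed

text \<open>In terms of vectors \<open>Y s\<close> dual to the \<open>w r X\<close>, the orthonormality says that the matrix of
  \<open>w r (Y (s + 1)) (Y (s + 2))\<close> is a multiple of the identity up to a skew part; adding multiples of
  \<open>X\<close> to the \<open>Y s\<close> removes the skew part.\<close>

lemma adapted_vectors:
  assumes nz: "w 1 X b \<noteq> 0"
  obtains Y \<kappa> where
    "\<And>r s. r \<in> {1, 2, 3} \<Longrightarrow> s \<in> {1, 2, 3} \<Longrightarrow> w r X (Y s) = (if r = s then 1 else 0)"
    "w 1 (Y 2) (Y 3) = \<kappa>" "w 1 (Y 3) (Y 1) = 0" "w 1 (Y 1) (Y 2) = 0"
    "w 2 (Y 2) (Y 3) = 0" "w 2 (Y 3) (Y 1) = \<kappa>" "w 2 (Y 1) (Y 2) = 0"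
    "w 3 (Y 2) (Y 3) = 0" "w 3 (Y 3) (Y 1) = 0" "w 3 (Y 1) (Y 2) = \<kappa>"
    "v X (Y 1) (Y 2) (Y 3) = 2 * \<kappa>" "\<kappa> \<noteq> 0"
proof -
  obtain Z1 Z2 Z3 where Z: "w 1 X Z1 = 1" "w 2 X Z1 = 0" "w 3 X Z1 = 0"
    "w 1 X Z2 = 0" "w 2 X Z2 = 1" "w 3 X Z2 = 0" "w 1 X Z3 = 0" "w 2 X Z3 = 0" "w 3 X Z3 = 1"
  proof (rule dual_vectors_3[of "w 1 X" "w 2 X" "w 3 X"])
    show "linear (w 1 X)" "linear (w 2 X)" "linear (w 3 X)" by (simp_all add: linear_right)
    show "c1 = 0 \<and> c2 = 0 \<and> c3 = 0" if "\<And>z. c1 * w 1 X z + c2 * w 2 X z + c3 * w 3 X z = 0" for c1 c2 c3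
      by (rule independent[OF nz _ that]) simp
  qed
  define Y where "Y = (\<lambda>s :: nat. if s = 1 then Z1 - w 2 Z1 Z2 *\<^sub>R X
    else if s = 2 then Z2 + w 1 Z1 Z2 *\<^sub>R X else Z3 + w 1 Z1 Z3 *\<^sub>R X)"
  define \<kappa> where "\<kappa> = v X Z1 Z2 Z3 / 2"
  have Y: "Y 1 = Z1 - w 2 Z1 Z2 *\<^sub>R X" "Y 2 = Z2 + w 1 Z1 Z2 *\<^sub>R X" "Y 3 = Z3 + w 1 Z1 Z3 *\<^sub>R X"
    by (simp_all add: Y_def)
  have YX: "w r X (Y s) = (if r = s then 1 else 0)" if "r \<in> {1, 2, 3}" "s \<in> {1, 2, 3}" for r s
    using that Z by (auto simp: Y bilinear_simps self)
  have XZ: "w r Z1 X = - w r X Z1" "w r Z2 X = - w r X Z2" "w r Z3 X = - w r X Z3"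
    if "r \<in> {1, 2, 3}" for r using skew[OF that] by blast+
  have W: "w 1 Z2 Z3 = \<kappa>" "w 2 Z1 Z3 = - \<kappa>" "w 3 Z1 Z2 = \<kappa>"
    "w 2 Z2 Z3 = w 1 Z1 Z3" "w 3 Z2 Z3 = - w 1 Z1 Z2" "w 3 Z1 Z3 = w 2 Z1 Z2"
    using wedge[of 1 1 X Z1 Z2 Z3] wedge[of 2 2 X Z1 Z2 Z3] wedge[of 3 3 X Z1 Z2 Z3]
      wedge[of 1 2 X Z1 Z2 Z3] wedge[of 1 3 X Z1 Z2 Z3] wedge[of 2 3 X Z1 Z2 Z3]
    by (simp_all add: wedge22_def Z \<kappa>_def)
  have ZZ: "w r Z3 Z1 = - w r Z1 Z3" if "r \<in> {1, 2, 3}" for r using skew[OF that] by blast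
  have YY: "w 1 (Y 2) (Y 3) = \<kappa>" "w 1 (Y 3) (Y 1) = 0" "w 1 (Y 1) (Y 2) = 0"
    "w 2 (Y 2) (Y 3) = 0" "w 2 (Y 3) (Y 1) = \<kappa>" "w 2 (Y 1) (Y 2) = 0"
    "w 3 (Y 2) (Y 3) = 0" "w 3 (Y 3) (Y 1) = 0" "w 3 (Y 1) (Y 2) = \<kappa>"
    by (simp_all add: Y bilinear_simps self XZ ZZ Z W)
  have vY: "v X (Y 1) (Y 2) (Y 3) = 2 * \<kappa>"
    using wedge[of 1 1 X "Y 1" "Y 2" "Y 3"] by (simp add: wedge22_def YX YY)
  have "\<kappa> \<noteq> 0"
  proof
    assume "\<kappa> = 0"
    then have "v X b c d = 0" for b c d
      using volume_contract[OF YX, of b c d] vY by simp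
    then show False using kernel_of_volume[of 1 X b] nz by simp
  qed
  then show thesis using that[OF YX YY vY] by blast
qed

text \<open>In terms of the adapted vectors, \<open>\<theta>\<close> is the contraction of \<open>- w 1\<close> with \<open>Y 1\<close>, which is dual to \<open>X\<close>. The
  sign condition holds for \<open>X\<close> and \<open>Y 3 / \<kappa>\<close>, where it says \<open>1 / \<kappa> \<ge> 0\<close>.\<close>

lemma normal_form:
  assumes nz: "w 1 X b \<noteq> 0"
    and pos: "\<And>x y. (\<And>z. w 1 x z = w 2 y z) \<Longrightarrow> w 3 x y \<ge> 0"
  obtains \<kappa> \<theta> Y where "\<kappa> > 0" "linear \<theta>" "\<theta> X = 1"
    "\<And>r s. r \<in> {1, 2, 3} \<Longrightarrow> s \<in> {1, 2, 3} \<Longrightarrow> w r X (Y s) = (if r = s then 1 else (0::real))"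
    "\<And>p q. w 1 p q = \<theta> p * w 1 X q - w 1 X p * \<theta> q + \<kappa> * (w 2 X p * w 3 X q - w 3 X p * w 2 X q)"
    "\<And>p q. w 2 p q = \<theta> p * w 2 X q - w 2 X p * \<theta> q + \<kappa> * (w 3 X p * w 1 X q - w 1 X p * w 3 X q)"
    "\<And>p q. w 3 p q = \<theta> p * w 3 X q - w 3 X p * \<theta> q + \<kappa> * (w 1 X p * w 2 X q - w 2 X p * w 1 X q)"
proof -
  obtain Y \<kappa> where
    YX: "\<And>r s. r \<in> {1, 2, 3} \<Longrightarrow> s \<in> {1, 2, 3} \<Longrightarrow> w r X (Y s) = (if r = s then 1 else 0)"
    and YY: "w 1 (Y 2) (Y 3) = \<kappa>" "w 1 (Y 3) (Y 1) = 0" "w 1 (Y 1) (Y 2) = 0"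
    "w 2 (Y 2) (Y 3) = 0" "w 2 (Y 3) (Y 1) = \<kappa>" "w 2 (Y 1) (Y 2) = 0"
    "w 3 (Y 2) (Y 3) = 0" "w 3 (Y 3) (Y 1) = 0" "w 3 (Y 1) (Y 2) = \<kappa>"
    and "\<kappa> \<noteq> 0"
    using adapted_vectors[OF nz] by metis
  have YY': "w r (Y 3) (Y 2) = - w r (Y 2) (Y 3)" "w r (Y 1) (Y 3) = - w r (Y 3) (Y 1)"
    "w r (Y 2) (Y 1) = - w r (Y 1) (Y 2)" if "r \<in> {1, 2, 3}" for r
    using skew[OF that] by blast+
  define \<theta> where "\<theta> = (\<lambda>z. w 1 z (Y 1))"
  have lin: "linear \<theta>" unfolding \<theta>_def by (rule linear_left) simp
  have \<theta>: "\<theta> X = 1" "\<theta> (Y 1) = 0" "\<theta> (Y 2) = 0" "\<theta> (Y 3) = 0"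
    by (simp_all add: \<theta>_def YX YY YY' self)
  define R where "R = (\<lambda>z. z - \<theta> z *\<^sub>R X - w 1 X z *\<^sub>R Y 1 - w 2 X z *\<^sub>R Y 2 - w 3 X z *\<^sub>R Y 3)"
  \<comment> \<open>\<open>R\<close> projects to the common kernel of the four 1-forms, and the three 2-forms vanish on it.\<close>
  have aR: "w r X (R z) = 0" if "r \<in> {1, 2, 3}" for r z
    using that by (auto simp: R_def bilinear_simps self YX)
  have \<theta>R: "\<theta> (R z) = 0" for z
    unfolding R_def by (simp add: linear_diff[OF lin] linear_scale[OF lin] \<theta>)
  have vR: "v X (R z) c d = 0" for z c d
    using volume_contract[OF YX, of "R z" c d] by (simp add: aR)
  have R0: "w r (R z) u = 0" if r: "r \<in> {1, 2, 3}" for r z u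
  proof -
    have multiple: "w s (R z) u = w s X u * w s (R z) (Y s)" if "s \<in> {1, 2, 3}" for s u
      using wedge[OF that that, of X "R z" u "Y s"] vR aR[OF that] YX[OF that that]
      by (simp add: wedge22_def)
    have same: "w s (R z) (Y s) = w 1 (R z) (Y 1)" if "s \<in> {2, 3}" for s
      using wedge[of 1 s X "R z" "Y 1" "Y s"] that aR[of 1] aR[of s] YX
      by (auto simp: wedge22_def)
    have "w s (R z) (Y s) = 0" if "s \<in> {1, 2, 3}" for s
      using same[of s] \<theta>R[of z] that by (auto simp: \<theta>_def)
    then show ?thesis using multiple[OF r, of u] r by simp
  qed
  have dec: "p = R p + \<theta> p *\<^sub>R X + w 1 X p *\<^sub>R Y 1 + w 2 X p *\<^sub>R Y 2 + w 3 X p *\<^sub>R Y 3" for p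
    by (simp add: R_def)
  have wY: "w r p (Y s) = \<theta> p * w r X (Y s) + w 1 X p * w r (Y 1) (Y s)
      + w 2 X p * w r (Y 2) (Y s) + w 3 X p * w r (Y 3) (Y s)" if "r \<in> {1, 2, 3}" for r s p
    by (subst dec[of p])
      (simp only: linear_add[OF linear_left[OF that]] linear_scale[OF linear_left[OF that]] R0[OF that]
        add_0_left real_scaleR_def)
  have Yw: "w r (Y s) q = - w r q (Y s)" if "r \<in> {1, 2, 3}" for r s q
    using skew[OF that] by blast
  have w: "w r p q = \<theta> p * w r X q + w 1 X p * w r (Y 1) q + w 2 X p * w r (Y 2) q
      + w 3 X p * w r (Y 3) q" if "r \<in> {1, 2, 3}" for r p q
    by (subst dec[of p])
      (simp only: linear_add[OF linear_left[OF that]] linear_scale[OF linear_left[OF that]] R0[OF that]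
        add_0_left real_scaleR_def)
  have forms:
    "w 1 p q = \<theta> p * w 1 X q - w 1 X p * \<theta> q + \<kappa> * (w 2 X p * w 3 X q - w 3 X p * w 2 X q)"
    "w 2 p q = \<theta> p * w 2 X q - w 2 X p * \<theta> q + \<kappa> * (w 3 X p * w 1 X q - w 1 X p * w 3 X q)"
    "w 3 p q = \<theta> p * w 3 X q - w 3 X p * \<theta> q + \<kappa> * (w 1 X p * w 2 X q - w 2 X p * w 1 X q)" for p q
    by (simp add: w[of _ p q] Yw[of _ _ q] wY[of _ q] YX YY YY' self algebra_simps)+
  have "w 1 X z = w 2 ((1 / \<kappa>) *\<^sub>R Y 3) z" for z
    using \<open>\<kappa> \<noteq> 0\<close>
    by (subst forms(2)) (simp add: bilinear_simps linear_scale[OF lin] \<theta> YX)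
  from pos[OF this] have "0 \<le> 1 / \<kappa>" by (simp add: bilinear_simps YX)
  with \<open>\<kappa> \<noteq> 0\<close> have "\<kappa> > 0" by (simp add: zero_le_divide_iff)
  from that[OF this lin \<theta>(1) YX forms] show thesis .
qed

end

section \<open>Wedge products on vectors\<close>

lemma sum_permutations_lessThan_Suc:
  "sum f {\<sigma>. \<sigma> permutes {..<Suc n}}
    = (\<Sum>b<n. \<Sum>\<sigma> | \<sigma> permutes {..<n}. f (Transposition.transpose n b \<circ> \<sigma>))
      + (\<Sum>\<sigma> | \<sigma> permutes {..<n}. f \<sigma>)"
  by (simp add: lessThan_Suc sum_over_permutations_insert add.commute)

lemma sum_permutations_2:
  fixes f :: "(nat \<Rightarrow> nat) \<Rightarrow> 'a::comm_monoid_add"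
  shows "sum f {\<sigma>. \<sigma> permutes {..<2}} = f (Transposition.transpose 1 0) + f id"
proof -
  have "sum f {\<sigma>. \<sigma> permutes {..<Suc 1}} = f (Transposition.transpose 1 0) + f id"
    unfolding sum_permutations_lessThan_Suc
    by (simp add: sum_permutations_lessThan_Suc[where n = 0] One_nat_def)
  then show ?thesis by (simp add: eval_nat_numeral One_nat_def)
qed

lemma sum_permutations_3:
  fixes f :: "(nat \<Rightarrow> nat) \<Rightarrow> 'a::comm_monoid_add"
  shows "sum f {\<sigma>. \<sigma> permutes {..<3}} =
    (\<Sum>b<2. f (Transposition.transpose 2 b \<circ> Transposition.transpose 1 0) + f (Transposition.transpose 2 b))
    + (f (Transposition.transpose 1 0) + f id)"
  using sum_permutations_lessThan_Suc[of f 2] by (simp add: sum_permutations_2)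

lemma sum_permutations_4:
  fixes f :: "(nat \<Rightarrow> nat) \<Rightarrow> 'a::comm_monoid_add"
  shows "sum f {\<sigma>. \<sigma> permutes {..<4}} =
    (\<Sum>c<3. (\<Sum>b<2. f (Transposition.transpose 3 c \<circ> (Transposition.transpose 2 b \<circ> Transposition.transpose 1 0))
        + f (Transposition.transpose 3 c \<circ> Transposition.transpose 2 b))
      + (f (Transposition.transpose 3 c \<circ> Transposition.transpose 1 0) + f (Transposition.transpose 3 c)))
    + ((\<Sum>b<2. f (Transposition.transpose 2 b \<circ> Transposition.transpose 1 0) + f (Transposition.transpose 2 b))
    + (f (Transposition.transpose 1 0) + f id))"
  using sum_permutations_lessThan_Suc[of f 3] by (simp add: sum_permutations_3)

lemma sum_lessThan_2_3:
  "sum f {..<2} = f 0 + f (1::nat)" "sum f {..<3} = f 0 + f 1 + f (2::nat)"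
  by (simp_all add: eval_nat_numeral lessThan_Suc One_nat_def add_ac)

lemmas sign_simps =
  sign_compose permutation_swap_id permutation_compose sign_swap_id

lemma wedge_1_1:
  assumes a: "\<And>us. \<alpha> i p us = A (us 0)" and b: "\<And>us. \<beta> i p us = B (us 0)"
  shows "(\<alpha> \<and>\<^bsub>1,1\<^esub> \<beta>) i p vs = wedge11 A B (vs 0) (vs 1)"
  unfolding wedge_def a b one_add_one sum_permutations_2
  by (simp add: sign_simps Transposition.transpose_def)

lemma wedge_2_1:
  assumes a: "\<And>us. \<alpha> i p us = A (us 0) (us 1)" and skew: "\<And>x y. A y x = - A x y"
    and b: "\<And>us. \<beta> i p us = B (us 0)"
  shows "(\<alpha> \<and>\<^bsub>2,1\<^esub> \<beta>) i p vs = wedge21 A B (vs 0) (vs 1) (vs 2)"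
proof -
  have "2 + (1::nat) = 3" by simp
  then show ?thesis
    unfolding wedge_def a b using skew[of "vs 0" "vs 1"] skew[of "vs 0" "vs 2"] skew[of "vs 1" "vs 2"]
    by (simp add: sum_permutations_3 sum_lessThan_2_3 sign_simps Transposition.transpose_def One_nat_def[symmetric] field_simps)
qed

lemma wedge_1_2:
  assumes a: "\<And>us. \<alpha> i p us = A (us 0)"
    and b: "\<And>us. \<beta> i p us = B (us 0) (us 1)" and skew: "\<And>x y. B y x = - B x y"
  shows "(\<alpha> \<and>\<^bsub>1,2\<^esub> \<beta>) i p vs = wedge12 A B (vs 0) (vs 1) (vs 2)"
proof -
  have "1 + (2::nat) = 3" by simp
  then show ?thesis
    unfolding wedge_def a b using skew[of "vs 0" "vs 1"] skew[of "vs 0" "vs 2"] skew[of "vs 1" "vs 2"]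
    by (simp add: sum_permutations_3 sum_lessThan_2_3 sign_simps Transposition.transpose_def One_nat_def[symmetric] field_simps)
qed

lemma wedge_2_2:
  assumes a: "\<And>us. \<alpha> i p us = A (us 0) (us 1)" and skewA: "\<And>x y. A y x = - A x y"
    and b: "\<And>us. \<beta> i p us = B (us 0) (us 1)" and skewB: "\<And>x y. B y x = - B x y"
  shows "(\<alpha> \<and>\<^bsub>2,2\<^esub> \<beta>) i p vs = wedge22 A B (vs 0) (vs 1) (vs 2) (vs 3)"
proof -
  have "2 + (2::nat) = 4" by simp
  then show ?thesis
    unfolding wedge_def a b wedge22_def
    using skewA[of "vs 0" "vs 1"] skewA[of "vs 0" "vs 2"] skewA[of "vs 0" "vs 3"]
      skewA[of "vs 1" "vs 2"] skewA[of "vs 1" "vs 3"] skewA[of "vs 2" "vs 3"]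
      skewB[of "vs 0" "vs 1"] skewB[of "vs 0" "vs 2"] skewB[of "vs 0" "vs 3"]
      skewB[of "vs 1" "vs 2"] skewB[of "vs 1" "vs 3"] skewB[of "vs 2" "vs 3"]
    by (simp add: sum_permutations_4 sum_lessThan_2_3 sign_simps Transposition.transpose_def One_nat_def[symmetric] field_simps)
qed

definition ev1 :: "((nat \<Rightarrow> 'e) \<Rightarrow> 'r) \<Rightarrow> 'e \<Rightarrow> 'r" where
  "ev1 a x = a (\<lambda>_. x)"

definition ev2 :: "((nat \<Rightarrow> 'e) \<Rightarrow> 'r) \<Rightarrow> 'e \<Rightarrow> 'e \<Rightarrow> 'r" where
  "ev2 a x y = a ((\<lambda>_. y)(0 := x))"

lemma ev1: "alternating_form 1 a \<Longrightarrow> a us = ev1 a (us 0)"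
  unfolding ev1_def by (rule alternating_form_cong) auto

lemma linear_ev1: "alternating_form 1 a \<Longrightarrow> linear (ev1 a)"
  using alternating_form_linear[of 1 a 0 "\<lambda>_. 0"]
  by (simp add: ev1[of a "(\<lambda>_. 0)(0 := _)"])

lemma ev2: "alternating_form 2 a \<Longrightarrow> a us = ev2 a (us 0) (us 1)"
  unfolding ev2_def by (rule alternating_form_cong) (auto simp: less_2_cases_iff One_nat_def)

lemma linear_ev2: "alternating_form 2 a \<Longrightarrow> linear (\<lambda>x. ev2 a x y)"
  using alternating_form_linear[of 2 a 0 "\<lambda>_. y"] by (simp add: ev2_def)

lemma skew_ev2:
  assumes a: "alternating_form 2 a"
  shows "ev2 a x y = - ev2 a y x"
proof -
  have 0: "ev2 a z z = 0" for z
    unfolding ev2_def by (rule alternating_form_eq_0[OF a, of 0 1]) auto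
  have lin: "linear (ev2 a z)" for z
  proof -
    have "linear (\<lambda>v. a (((\<lambda>_. z))(1 := v)))" by (rule alternating_form_linear[OF a]) simp
    then show ?thesis by (simp add: ev2[OF a, of "(\<lambda>_. z)(1 := _)"])
  qed
  have "0 = ev2 a (x + y) (x + y)" using 0 by simp
  also have "\<dots> = ev2 a x y + ev2 a y x"
    using 0[of x] 0[of y] by (simp only: linear_add[OF linear_ev2[OF a]] linear_add[OF lin])
  finally show ?thesis by simp
qed

section \<open>Adapted local coframes\<close>

lemma SU2_structureD:
  assumes "SU2_structure N \<eta> \<omega>"
  shows SU2_structure_manifold: "smooth_manifold N"
    and SU2_structure_eta: "diff_form N 1 \<eta>"
    and SU2_structure_omega: "r \<in> {1, 2, 3} \<Longrightarrow> diff_form N 2 (\<omega> r)"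
  using assms unfolding SU2_structure_def by blast+

lemma wedge_2_2_ev2:
  assumes "diff_form M 2 \<alpha>" "diff_form M 2 \<beta>" "i \<in> charts M" "p \<in> cdom M i"
  shows "(\<alpha> \<and>\<^bsub>2,2\<^esub> \<beta>) i p vs = wedge22 (ev2 (\<alpha> i p)) (ev2 (\<beta> i p)) (vs 0) (vs 1) (vs 2) (vs 3)"
  by (intro wedge_2_2 ev2 skew_ev2 diff_form_alternating[OF assms(1,3,4)]
      diff_form_alternating[OF assms(2,3,4)])

text \<open>All conditions of an \<open>SU(2)\<close>-structure on the tangent space at \<open>p\<close>, in terms of bilinear forms. The
  4-form \<open>v\<close> of the definition is \<open>\<omega>\<^sub>1 \<and> \<omega>\<^sub>1\<close>.\<close>

lemma SU2_structure_triple: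
  fixes N :: "('a, 'i, 'e::euclidean_space) mfd"
  assumes SU2: "SU2_structure N \<eta> \<omega>" and i: "i \<in> charts N" and p: "p \<in> cdom N i"
  obtains v where "orthonormal_triple (\<lambda>r. ev2 (\<omega> r i p)) v"
    and "\<And>x y. (\<And>z. ev2 (\<omega> 1 i p) x z = ev2 (\<omega> 2 i p) y z) \<Longrightarrow> ev2 (\<omega> 3 i p) x y \<ge> 0"
    and "\<exists>vs. ((\<omega> 1 \<and>\<^bsub>2,2\<^esub> \<omega> 1) \<and>\<^bsub>4,1\<^esub> \<eta>) i p vs \<noteq> 0"
proof -
  obtain v where v: "diff_form N 4 v"
    and w: "\<forall>r\<in>{1, 2, 3}. \<forall>s\<in>{1, 2, 3}.
      form_eq N (\<omega> r \<and>\<^bsub>2,2\<^esub> \<omega> s) ((\<lambda>_. if r = s then 1 else 0) \<odot> v)"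
    and nz: "\<forall>i\<in>charts N. \<forall>p\<in>cdom N i. (v \<and>\<^bsub>4,1\<^esub> \<eta>) i p \<noteq> (\<lambda>_. 0)"
    using SU2 unfolding SU2_structure_def by blast
  define v' where "v' = (\<lambda>a b c d. v i p (\<lambda>m. if m = 0 then a else if m = 1 then b else if m = 2 then c else d))"
  have v': "v i p us = v' (us 0) (us 1) (us 2) (us 3)" for us
    unfolding v'_def
    by (rule alternating_form_cong[OF diff_form_alternating[OF v i p]])
      (auto simp: eval_nat_numeral less_Suc_eq One_nat_def)
  have wv: "(\<omega> r \<and>\<^bsub>2,2\<^esub> \<omega> s) i p us = (if r = s then v i p us else 0)"
    if "r \<in> {1, 2, 3}" "s \<in> {1, 2, 3}" for r s us
  proof -
    have "form_eq N (\<omega> r \<and>\<^bsub>2,2\<^esub> \<omega> s) ((\<lambda>_. if r = s then 1 else 0) \<odot> v)" using w that by blast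
    then have "(\<omega> r \<and>\<^bsub>2,2\<^esub> \<omega> s) i p = ((\<lambda>_. if r = s then 1 else 0) \<odot> v) i p"
      using i p unfolding form_eq_def by blast
    then show ?thesis by (simp add: fscale_def)
  qed
  have alt: "alternating_form 2 (\<omega> r i p)" if "r \<in> {1, 2, 3}" for r
    by (rule diff_form_alternating[OF SU2_structure_omega[OF SU2 that] i p])
  have eq: "(\<omega> 1 \<and>\<^bsub>2,2\<^esub> \<omega> 1) i p = v i p"
    using wv[of 1 1] by auto
  have "\<exists>vs. (v \<and>\<^bsub>4,1\<^esub> \<eta>) i p vs \<noteq> 0"
    using nz i p by blast
  then have "\<exists>vs. ((\<omega> 1 \<and>\<^bsub>2,2\<^esub> \<omega> 1) \<and>\<^bsub>4,1\<^esub> \<eta>) i p vs \<noteq> 0"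
    unfolding wedge_def[of 4] eq .
  moreover have "orthonormal_triple (\<lambda>r. ev2 (\<omega> r i p)) v'"
  proof (rule orthonormal_triple.intro)
    show "linear (\<lambda>x. ev2 (\<omega> r i p) x y)" if "r \<in> {1, 2, 3}" for r y
      by (rule linear_ev2[OF alt[OF that]])
    show "ev2 (\<omega> r i p) x y = - ev2 (\<omega> r i p) y x" if "r \<in> {1, 2, 3}" for r x y
      by (rule skew_ev2[OF alt[OF that]])
    show "wedge22 (ev2 (\<omega> r i p)) (ev2 (\<omega> s i p)) a b c d = (if r = s then v' a b c d else 0)"
      if "r \<in> {1, 2, 3}" "s \<in> {1, 2, 3}" for r s a b c d
      using wedge_2_2_ev2[OF SU2_structure_omega[OF SU2 that(1)] SU2_structure_omega[OF SU2 that(2)] i p,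
          of "\<lambda>m. if m = 0 then a else if m = 1 then b else if m = 2 then c else d"]
        wv[OF that, of "\<lambda>m. if m = 0 then a else if m = 1 then b else if m = 2 then c else d"]
      by (cases "r = s") (simp_all add: v'_def)
    show "\<exists>a b c d. v' a b c d \<noteq> 0"
    proof (rule ccontr)
      assume "\<nexists>a b c d. v' a b c d \<noteq> 0"
      then have "v i p us = 0" for us using v'[of us] by simp
      then have "(v \<and>\<^bsub>4,1\<^esub> \<eta>) i p = (\<lambda>_. 0)" by (simp add: wedge_def)
      then show False using nz i p by blast
    qed
  qed
  moreover have "ev2 (\<omega> 3 i p) x y \<ge> 0" if "\<And>z. ev2 (\<omega> 1 i p) x z = ev2 (\<omega> 2 i p) y z" for x y
  proof -
    have "contract x (\<omega> 1 i p) = contract y (\<omega> 2 i p)"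
    proof
      fix us :: "nat \<Rightarrow> 'e"
      have "\<omega> r i p (case_nat z us) = ev2 (\<omega> r i p) z (us 0)" if "r \<in> {1, 2, 3}" for r z
        using ev2[OF alt[OF that], of "case_nat z us"] by (simp add: One_nat_def)
      then show "contract x (\<omega> 1 i p) us = contract y (\<omega> 2 i p) us"
        using that by (simp add: contract_def)
    qed
    then show ?thesis using SU2 i p unfolding SU2_structure_def ev2_def by blast
  qed
  ultimately show thesis using that by blast
qed

lemma basis_enumeration:
  obtains h :: "nat \<Rightarrow> 'e::euclidean_space"
  where "bij_betw h {..<DIM('e)} Basis"
    and "\<And>c n. n < DIM('e) \<Longrightarrow> (\<Sum>m<DIM('e). c m *\<^sub>R h m) \<bullet> h n = c n"
    and "\<And>y. (\<Sum>m<DIM('e). (y \<bullet> h m) *\<^sub>R h m) = y"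
proof -
  obtain h :: "nat \<Rightarrow> 'e" where h: "bij_betw h {..<DIM('e)} Basis"
    using ex_bij_betw_nat_finite[OF finite_Basis] unfolding atLeast0LessThan by blast
  have "(\<Sum>m<DIM('e). c m *\<^sub>R h m) \<bullet> h n = c n" if n: "n < DIM('e)" for c n
  proof -
    have "h m \<bullet> h n = (if m = n then 1 else 0)" if "m < DIM('e)" for m
    proof -
      have "h m \<in> Basis" "h n \<in> Basis" using bij_betwE[OF h] that n by auto
      moreover have "h m = h n \<longleftrightarrow> m = n"
        using inj_on_eq_iff[OF bij_betw_imp_inj_on[OF h]] that n by simp
      ultimately show ?thesis by (simp add: inner_Basis)
    qed
    then have "(\<Sum>m<DIM('e). c m *\<^sub>R h m) \<bullet> h n = (\<Sum>m<DIM('e). if m = n then c m else 0)"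
      unfolding inner_sum_left by (intro sum.cong) auto
    then show ?thesis using n by simp
  qed
  moreover have "(\<Sum>m<DIM('e). (y \<bullet> h m) *\<^sub>R h m) = y" for y
    using sum.reindex_bij_betw[OF h, of "\<lambda>b. (y \<bullet> b) *\<^sub>R b"] by (simp add: euclidean_representation)
  ultimately show thesis using that h by blast
qed

text \<open>The \<open>f m\<close> are the components of an endomorphism. It is injective, hence surjective, and a vector
  \<open>z\<close> with \<open>f m z = c m\<close> turns the dependence relation into \<open>\<Sum> (c m)\<^sup>2 = 0\<close>.\<close>

lemma independent_if_no_common_kernel:
  fixes f :: "nat \<Rightarrow> 'e::euclidean_space \<Rightarrow> real"
  assumes lin: "\<And>m. m < DIM('e) \<Longrightarrow> linear (f m)"
    and ker: "\<And>R. (\<And>m. m < DIM('e) \<Longrightarrow> f m R = 0) \<Longrightarrow> R = 0"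
    and dep: "\<And>z. (\<Sum>m<DIM('e). c m * f m z) = 0" and n: "n < DIM('e)"
  shows "c n = 0"
proof -
  obtain h :: "nat \<Rightarrow> 'e" where
    h: "\<And>c n. n < DIM('e) \<Longrightarrow> (\<Sum>m<DIM('e). c m *\<^sub>R h m) \<bullet> h n = c n"
    using basis_enumeration by metis
  let ?G = "\<lambda>z. \<Sum>m<DIM('e). f m z *\<^sub>R h m"
  have G: "linear ?G"
  proof (rule linear_compose_sum, rule ballI)
    fix m assume "m \<in> {..<DIM('e)}"
    then have "linear (f m)" using lin by simp
    then show "linear (\<lambda>z. f m z *\<^sub>R h m)"
      by (simp add: linear_iff scaleR_left_distrib)
  qed
  have "inj ?G"
    unfolding linear_injective_0[OF G]
  proof (intro allI impI)
    fix R assume "?G R = 0"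
    then have "f m R = 0" if "m < DIM('e)" for m
      using h[OF that, of "\<lambda>m. f m R"] by simp
    then show "R = 0" using ker by blast
  qed
  then have "surj ?G" by (rule linear_injective_imp_surjective[OF G]) simp
  from surjD[OF this, of "\<Sum>m<DIM('e). c m *\<^sub>R h m"]
  obtain z where z: "?G z = (\<Sum>m<DIM('e). c m *\<^sub>R h m)" by (elim exE) (rule that, rule sym)
  have "f m z = c m" if "m < DIM('e)" for m
    using h[OF that, of "\<lambda>m. f m z"] h[OF that, of c] z by simp
  then have "(\<Sum>m<DIM('e). c m * c m) = 0" using dep[of z] by simp
  then have "\<forall>m\<in>{..<DIM('e)}. c m * c m = 0"
    by (subst (asm) sum_nonneg_eq_0_iff) auto
  then show ?thesis using n by simp
qed

text \<open>For \<open>a us \<noteq> 0\<close>, the components of a vector with respect to the basis \<open>us\<close> are, by Cramer's rule,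
  the quotients \<open>a (us(m := R)) / a us\<close>.\<close>

lemma alternating_form_top_degree_kernel:
  fixes a :: "(nat \<Rightarrow> 'e::euclidean_space) \<Rightarrow> real"
  assumes a: "alternating_form DIM('e) a" and nz: "a us \<noteq> 0"
    and ker: "\<And>m. m < DIM('e) \<Longrightarrow> a (us(m := R)) = 0"
  shows "R = 0"
proof -
  obtain h :: "nat \<Rightarrow> 'e" where
    h: "\<And>y. (\<Sum>m<DIM('e). (y \<bullet> h m) *\<^sub>R h m) = y"
    using basis_enumeration by metis
  let ?L = "\<lambda>z. \<Sum>m<DIM('e). a (us(m := z)) *\<^sub>R h m"
  have L: "linear ?L"
  proof (rule linear_compose_sum, rule ballI)
    fix m assume "m \<in> {..<DIM('e)}"
    then have "linear (\<lambda>z. a (us(m := z)))" using alternating_form_linear[OF a] by simp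
    then show "linear (\<lambda>z. a (us(m := z)) *\<^sub>R h m)"
      by (simp add: linear_iff scaleR_left_distrib)
  qed
  have Lus: "?L (us m) = a us *\<^sub>R h m" if m: "m < DIM('e)" for m
  proof -
    have "a (us(n := us m)) = (if n = m then a us else 0)" if "n < DIM('e)" for n
      using alternating_form_eq_0[OF a that m, of "us(n := us m)"] by auto
    then have "?L (us m) = (\<Sum>n<DIM('e). if n = m then a us *\<^sub>R h n else 0)"
      by (intro sum.cong) auto
    then show ?thesis using m by simp
  qed
  have "?L (\<Sum>m<DIM('e). ((y \<bullet> h m) / a us) *\<^sub>R us m) = y" for y
  proof -
    have "?L (\<Sum>m<DIM('e). ((y \<bullet> h m) / a us) *\<^sub>R us m)
        = (\<Sum>m<DIM('e). ((y \<bullet> h m) / a us) *\<^sub>R ?L (us m))"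
      by (simp only: linear_sum[OF L] linear_scale[OF L])
    also have "\<dots> = (\<Sum>m<DIM('e). (y \<bullet> h m) *\<^sub>R h m)"
      using nz by (intro sum.cong) (simp_all add: Lus)
    finally show ?thesis using h by simp
  qed
  then have "surj ?L"
    by (rule surjI[of ?L "\<lambda>y. \<Sum>m<DIM('e). ((y \<bullet> h m) / a us) *\<^sub>R us m"])
  then have "inj ?L" by (rule linear_surjective_imp_injective[OF L]) simp
  moreover have "?L R = 0" using ker by simp
  ultimately show ?thesis unfolding linear_injective_0[OF L] by blast
qed

text \<open>A common zero of the five 1-forms is in the kernel of \<open>\<omega>\<^sub>1\<close> and of \<open>\<eta>\<close>, hence in that of the 5-form
  \<open>\<omega>\<^sub>1 \<and> \<omega>\<^sub>1 \<and> \<eta>\<close>, which is not zero.\<close>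

lemma coframe_independent:
  fixes N :: "('a, 'i, 'e::euclidean_space) mfd"
  assumes SU2: "SU2_structure N \<eta> \<omega>" and i: "i \<in> charts N" and p: "p \<in> cdom N i"
    and lin: "linear E1" "linear E2" "linear E3" "linear E4"
    and \<omega>1: "\<And>x y. ev2 (\<omega> 1 i p) x y = E1 x * E2 y - E1 y * E2 x + (E3 x * E4 y - E3 y * E4 x)"
    and dep: "\<And>z. c1 * E1 z + c2 * E2 z + c3 * E3 z + c4 * E4 z + c5 * ev1 (\<eta> i p) z = 0"
  shows "c1 = 0 \<and> c2 = 0 \<and> c3 = 0 \<and> c4 = 0 \<and> c5 = 0"
proof -
  have dim: "DIM('e) = 5" using SU2 unfolding SU2_structure_def by blast
  note \<eta> = SU2_structure_eta[OF SU2]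
  have \<omega>: "diff_form N 2 (\<omega> 1)" using SU2_structure_omega[OF SU2] by simp
  have M: "smooth_atlas N" by (rule smooth_manifold_imp_smooth_atlas[OF SU2_structure_manifold[OF SU2]])
  let ?a = "((\<omega> 1 \<and>\<^bsub>2,2\<^esub> \<omega> 1) \<and>\<^bsub>4,1\<^esub> \<eta>) i p"
  have "diff_form N (2 + 2 + 1) ((\<omega> 1 \<and>\<^bsub>2,2\<^esub> \<omega> 1) \<and>\<^bsub>2 + 2,1\<^esub> \<eta>)"
    by (intro diff_form_wedge M \<omega> \<eta>)
  then have alt: "alternating_form DIM('e) ?a"
    using diff_form_alternating i p dim by fastforce
  obtain us where us: "?a us \<noteq> 0"
    using SU2_structure_triple[OF SU2 i p] by metis
  have ev\<eta>: "\<eta> i p us = ev1 (\<eta> i p) (us 0)" for us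
    by (rule ev1[OF diff_form_alternating[OF \<eta> i p]])
  have lin\<eta>: "linear (ev1 (\<eta> i p))"
    by (rule linear_ev1[OF diff_form_alternating[OF \<eta> i p]])
  have ker: "R = 0" if R: "E1 R = 0" "E2 R = 0" "E3 R = 0" "E4 R = 0" "ev1 (\<eta> i p) R = 0" for R
  proof (rule alternating_form_top_degree_kernel[OF alt us])
    fix m assume "m < DIM('e)"
    then have m: "m < 5" using dim by simp
    have 0: "(\<omega> 1 \<and>\<^bsub>2,2\<^esub> \<omega> 1) i p (\<lambda>n. (us(m := R)) (\<sigma> n)) * \<eta> i p (\<lambda>n. (us(m := R)) (\<sigma> (4 + n))) = 0"
      if \<sigma>: "\<sigma> permutes {..<4 + 1}" for \<sigma>
    proof -
      obtain n where n: "n < 5" "\<sigma> n = m"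
      proof -
        have "m \<in> \<sigma> ` {..<4 + 1}" using permutes_image[OF \<sigma>] m by simp
        then show thesis using that by auto
      qed
      have w0: "ev2 (\<omega> 1 i p) R z = 0" "ev2 (\<omega> 1 i p) z R = 0" for z
        using R by (simp_all add: \<omega>1)
      consider "n = 0" | "n = 1" | "n = 2" | "n = 3" | "n = 4" using n by linarith
      then show ?thesis
        by cases (use n R(5) in \<open>simp_all add: wedge_2_2_ev2[OF \<omega> \<omega> i p] wedge22_def w0 ev\<eta>\<close>)
    qed
    show "?a (us(m := R)) = 0"
      unfolding wedge_def[of 4] mult.assoc
      by (subst sum.neutral) (auto simp only: 0 mem_Collect_eq mult_zero_right div_0)
  qed
  define f where "f = (\<lambda>m :: nat. if m = 0 then E1 else if m = 1 then E2 else if m = 2 then E3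
    else if m = 3 then E4 else ev1 (\<eta> i p))"
  define c where "c = (\<lambda>m :: nat. if m = 0 then c1 else if m = 1 then c2 else if m = 2 then c3
    else if m = 3 then c4 else c5)"
  have sum5: "(\<Sum>m<5. g m) = g 0 + g 1 + g 2 + g 3 + g 4" for g :: "nat \<Rightarrow> real"
    by (simp add: eval_nat_numeral One_nat_def)
  have "c n = 0" if "n < DIM('e)" for n
  proof (rule independent_if_no_common_kernel[of f c, OF _ _ _ that])
    show "linear (f m)" for m using lin lin\<eta> by (simp add: f_def)
    show "R = 0" if "\<And>m. m < DIM('e) \<Longrightarrow> f m R = 0" for R
      using ker[of R] that[of 0] that[of 1] that[of 2] that[of 3] that[of 4] by (simp add: f_def dim)
    show "(\<Sum>m<DIM('e). c m * f m z) = 0" for z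
      using dep[of z] by (simp add: dim sum5 f_def c_def)
  qed
  from this[of 0] this[of 1] this[of 2] this[of 3] this[of 4] show ?thesis by (simp add: c_def dim)
qed

text \<open>The hypotheses at \<open>(y, z)\<close> are two linear equations for \<open>\<theta> y\<close> and \<open>\<theta> z\<close>; the first one at \<open>(y, x)\<close> then
  gives \<open>\<theta> x\<close>.\<close>

lemma frame_functional_formula:
  fixes \<theta> a b c :: "'v \<Rightarrow> real"
  assumes w1: "\<And>p q. \<alpha> p q = \<theta> p * a q - a p * \<theta> q + \<kappa> * (b p * c q - c p * b q)"
    and w2: "\<And>p q. \<beta> p q = \<theta> p * b q - b p * \<theta> q + \<kappa> * (c p * a q - a p * c q)"
    and D: "a y * b z - b y * a z \<noteq> 0" and y: "a y \<noteq> 0"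
  shows "\<theta> x = ((a y * (\<beta> y z - \<kappa> * (c y * a z - a y * c z))
      - b y * (\<alpha> y z - \<kappa> * (b y * c z - c y * b z))) / (a y * b z - b y * a z) * a x
    - (\<alpha> y x - \<kappa> * (b y * c x - c y * b x))) / a y"
proof -
  have "a y * (\<beta> y z - \<kappa> * (c y * a z - a y * c z))
      - b y * (\<alpha> y z - \<kappa> * (b y * c z - c y * b z)) = \<theta> y * (a y * b z - b y * a z)"
    unfolding w1 w2 by algebra
  then show ?thesis using D y by (simp add: w1)
qed

text \<open>The product with \<open>a\<close> removes the term with \<open>\<theta>\<close>: \<open>a \<and> \<alpha> = \<kappa> a \<and> b \<and> c\<close>.\<close>

lemma conformal_factor_formula:
  fixes \<theta> a b c :: "'v \<Rightarrow> real"
  assumes w1: "\<And>p q. \<alpha> p q = \<theta> p * a q - a p * \<theta> q + \<kappa> * (b p * c q - c p * b q)"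
    and T: "a x * (b y * c z - c y * b z) - a y * (b x * c z - c x * b z)
      + a z * (b x * c y - c x * b y) \<noteq> 0"
  shows "\<kappa> = (a x * \<alpha> y z - a y * \<alpha> x z + a z * \<alpha> x y) /
    (a x * (b y * c z - c y * b z) - a y * (b x * c z - c x * b z)
      + a z * (b x * c y - c x * b y))"
proof -
  have "a x * \<alpha> y z - a y * \<alpha> x z + a z * \<alpha> x y
      = \<kappa> * (a x * (b y * c z - c y * b z) - a y * (b x * c z - c x * b z)
      + a z * (b x * c y - c x * b y))"
    unfolding w1 by algebra
  then show ?thesis using T by simp
qed

text \<open>In a chart, fix a constant vector \<open>X\<close>. The normal form yields at every point the 1-forms
  \<open>w r X\<close>, which are smooth, a conformal factor and a fourth 1-form. The last two are only known to
  exist pointwise; they are smooth since they are rational expressions in the components of the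
  \<open>\<omega> r\<close>.\<close>

lemma SU2_local_frame:
  fixes N :: "('a, 'i, 'e::euclidean_space) mfd"
  assumes SU2: "SU2_structure N \<eta> \<omega>" and p0: "p0 \<in> topspace (space_top N)"
  obtains V and e :: "nat \<Rightarrow> ('a, 'i, 'e, real) form" where "openin (space_top N) V" "p0 \<in> V"
    "\<And>k. k \<in> {1, 2, 3, 4} \<Longrightarrow> diff_form (open_submanifold N V) 1 (e k)"
    "\<And>j p x y. j \<in> charts N \<Longrightarrow> p \<in> cdom N j \<Longrightarrow> p \<in> V \<Longrightarrow> ev2 (\<omega> 1 j p) x y
      = wedge11 (ev1 (e 1 j p)) (ev1 (e 2 j p)) x y + wedge11 (ev1 (e 3 j p)) (ev1 (e 4 j p)) x y"
    "\<And>j p x y. j \<in> charts N \<Longrightarrow> p \<in> cdom N j \<Longrightarrow> p \<in> V \<Longrightarrow> ev2 (\<omega> 2 j p) x y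
      = wedge11 (ev1 (e 1 j p)) (ev1 (e 3 j p)) x y + wedge11 (ev1 (e 4 j p)) (ev1 (e 2 j p)) x y"
    "\<And>j p x y. j \<in> charts N \<Longrightarrow> p \<in> cdom N j \<Longrightarrow> p \<in> V \<Longrightarrow> ev2 (\<omega> 3 j p) x y
      = wedge11 (ev1 (e 1 j p)) (ev1 (e 4 j p)) x y + wedge11 (ev1 (e 2 j p)) (ev1 (e 3 j p)) x y"
proof -
  note N = SU2_structure_manifold[OF SU2]
  note M = smooth_manifold_imp_smooth_atlas[OF N]
  obtain i where i: "i \<in> charts N" and pi: "p0 \<in> cdom N i"
    using N p0 unfolding smooth_manifold_def by blast
  define w where "w = (\<lambda>q r. ev2 (\<omega> r i q))"
  have lin: "linear (\<lambda>x. w q r x y)" "w q r x y = - w q r y x"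
    if "q \<in> cdom N i" "r \<in> {1, 2, 3}" for q r x y
    unfolding w_def
    using linear_ev2[OF diff_form_alternating[OF SU2_structure_omega[OF SU2 that(2)] i that(1)]]
      skew_ev2[OF diff_form_alternating[OF SU2_structure_omega[OF SU2 that(2)] i that(1)]] by blast+
  obtain v where v: "orthonormal_triple (w p0) v"
    and pos: "\<And>x y. (\<And>z. w p0 1 x z = w p0 2 y z) \<Longrightarrow> w p0 3 x y \<ge> 0"
    unfolding w_def using SU2_structure_triple[OF SU2 i pi] by metis
  obtain X b where Xb: "w p0 1 X b \<noteq> 0"
  proof (rule ccontr)
    assume "\<not> thesis"
    then have "w p0 1 x y = 0" for x y using that by blast
    then have "v a b c d = 0" for a b c d
      using orthonormal_triple.wedge[OF v, of 1 1 a b c d] by (simp add: wedge22_def)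
    then show False using orthonormal_triple.nonzero[OF v] by blast
  qed
  define a where "a = (\<lambda>q r z. w q r X z)"
  obtain Y where Y: "\<And>r s. r \<in> {1, 2, 3} \<Longrightarrow> s \<in> {1, 2, 3} \<Longrightarrow> a p0 r (Y s) = (if r = s then 1 else 0)"
    unfolding a_def using orthonormal_triple.normal_form[OF v Xb pos] by metis
  \<comment> \<open>The denominators of the two formulas, at the vectors dual to the \<open>a p0 r\<close>. They are \<open>1\<close> at \<open>p0\<close>, and \<open>V\<close>
    is the set where they do not vanish.\<close>
  define D where "D = (\<lambda>q. a q 1 (Y 1) * a q 2 (Y 2) - a q 2 (Y 1) * a q 1 (Y 2))"
  define T where "T = (\<lambda>q. a q 1 (Y 1) * (a q 2 (Y 2) * a q 3 (Y 3) - a q 3 (Y 2) * a q 2 (Y 3))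
      - a q 1 (Y 2) * (a q 2 (Y 1) * a q 3 (Y 3) - a q 3 (Y 1) * a q 2 (Y 3))
      + a q 1 (Y 3) * (a q 2 (Y 1) * a q 3 (Y 2) - a q 3 (Y 1) * a q 2 (Y 2)))"
  define f where "f = (\<lambda>q. a q 1 (Y 1) * D q * T q)"
  have f0: "f p0 \<noteq> 0" by (simp add: f_def D_def T_def Y)
  let ?S = "coord N i ` cdom N i"
  have S: "open ?S" by (rule smooth_atlas_open[OF M i])
  have smw: "smooth_on ?S (\<lambda>x. w (coord_inv N i x) r y z)" if "r \<in> {1, 2, 3}" for r y z
    unfolding w_def ev2_def by (rule diff_form_smooth[OF SU2_structure_omega[OF SU2 that] i])
  have sma: "smooth_on ?S (\<lambda>x. a (coord_inv N i x) r z)" if "r \<in> {1, 2, 3}" for r z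
    unfolding a_def by (rule smw[OF that])
  have smf: "smooth_on ?S (\<lambda>x. f (coord_inv N i x))"
    unfolding f_def D_def T_def
    by (intro smooth_on_mult smooth_on_diff smooth_on_add S sma) auto
  define U where "U = ?S \<inter> (\<lambda>x. f (coord_inv N i x)) -` (- {0})"
  have U: "open U"
    unfolding U_def using smooth_on_continuous_on[OF smf] S by (intro continuous_open_preimage) auto
  define V where "V = {q \<in> cdom N i. coord N i q \<in> U}"
  have V: "openin (space_top N) V" unfolding V_def by (rule openin_coord_preimage[OF N i U])
  have Vi: "V \<subseteq> cdom N i" by (auto simp: V_def)
  have fV: "q \<in> V \<longleftrightarrow> q \<in> cdom N i \<and> f q \<noteq> 0" for q
    by (cases "q \<in> cdom N i") (simp_all add: V_def U_def smooth_atlas_coord_inv[OF M i])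
  have "p0 \<in> V" using fV pi f0 by blast
  let ?P = "\<lambda>q \<kappa> \<theta>. \<kappa> > 0 \<and> linear \<theta> \<and>
    (\<forall>y z. w q 1 y z = \<theta> y * a q 1 z - a q 1 y * \<theta> z + \<kappa> * (a q 2 y * a q 3 z - a q 3 y * a q 2 z)) \<and>
    (\<forall>y z. w q 2 y z = \<theta> y * a q 2 z - a q 2 y * \<theta> z + \<kappa> * (a q 3 y * a q 1 z - a q 1 y * a q 3 z)) \<and>
    (\<forall>y z. w q 3 y z = \<theta> y * a q 3 z - a q 3 y * \<theta> z + \<kappa> * (a q 1 y * a q 2 z - a q 2 y * a q 1 z))"
  have "\<exists>\<kappa> \<theta>. ?P q \<kappa> \<theta>" if q: "q \<in> V" for q
  proof -
    have qi: "q \<in> cdom N i" and nz: "w q 1 X (Y 1) \<noteq> 0" using q unfolding fV f_def a_def by auto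
    obtain v where v: "orthonormal_triple (w q) v"
      and pos: "\<And>x y. (\<And>z. w q 1 x z = w q 2 y z) \<Longrightarrow> w q 3 x y \<ge> 0"
      unfolding w_def using SU2_structure_triple[OF SU2 i qi] by metis
    show ?thesis
      unfolding a_def by (rule orthonormal_triple.normal_form[OF v nz pos]) blast+
  qed
  then have "\<exists>\<kappa>. \<forall>q\<in>V. \<exists>\<theta>. ?P q (\<kappa> q) \<theta>" by (intro bchoice) blast
  then obtain \<kappa> where "\<forall>q\<in>V. \<exists>\<theta>. ?P q (\<kappa> q) \<theta>" by blast
  then have "\<exists>\<theta>. \<forall>q\<in>V. ?P q (\<kappa> q) (\<theta> q)" by (rule bchoice)
  then obtain \<theta> where P: "\<forall>q\<in>V. ?P q (\<kappa> q) (\<theta> q)" by blast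
  then have \<kappa>: "\<kappa> q > 0" and \<theta>: "linear (\<theta> q)"
    and w1: "\<And>y z. w q 1 y z = \<theta> q y * a q 1 z - a q 1 y * \<theta> q z + \<kappa> q * (a q 2 y * a q 3 z - a q 3 y * a q 2 z)"
    and w2: "\<And>y z. w q 2 y z = \<theta> q y * a q 2 z - a q 2 y * \<theta> q z + \<kappa> q * (a q 3 y * a q 1 z - a q 1 y * a q 3 z)"
    and w3: "\<And>y z. w q 3 y z = \<theta> q y * a q 3 z - a q 3 y * \<theta> q z + \<kappa> q * (a q 1 y * a q 2 z - a q 2 y * a q 1 z)"
    if "q \<in> V" for q
    using that by blast+
  let ?SV = "coord N i ` V"
  have SV: "open ?SV" by (rule open_coord_image[OF N i V Vi])
  have inV: "coord_inv N i x \<in> V" if "x \<in> ?SV" for x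
    using that Vi smooth_atlas_coord_inv[OF M i] by auto
  have SVS: "?SV \<subseteq> ?S" using Vi by (rule image_mono)
  have smw': "smooth_on ?SV (\<lambda>x. w (coord_inv N i x) r y z)" if "r \<in> {1, 2, 3}" for r y z
    by (rule smooth_on_subset[OF smw[OF that] SVS])
  have sma': "smooth_on ?SV (\<lambda>x. a (coord_inv N i x) r z)" if "r \<in> {1, 2, 3}" for r z
    by (rule smooth_on_subset[OF sma[OF that] SVS])
  have nzV: "a q 1 (Y 1) \<noteq> 0" "D q \<noteq> 0" "T q \<noteq> 0" if "q \<in> V" for q
    using that unfolding fV f_def by auto
  have sm\<kappa>: "smooth_on ?SV (\<lambda>x. \<kappa> (coord_inv N i x))"
  proof (rule smooth_on_cong[OF SV])
    let ?k = "\<lambda>q. (a q 1 (Y 1) * w q 1 (Y 2) (Y 3) - a q 1 (Y 2) * w q 1 (Y 1) (Y 3)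
        + a q 1 (Y 3) * w q 1 (Y 1) (Y 2)) / T q"
    show "smooth_on ?SV (\<lambda>x. ?k (coord_inv N i x))"
    proof (rule smooth_on_divide[OF SV])
      show "smooth_on ?SV (\<lambda>x. T (coord_inv N i x))"
        unfolding T_def by (intro smooth_on_mult smooth_on_diff smooth_on_add SV sma') auto
      show "smooth_on ?SV (\<lambda>x. a (coord_inv N i x) 1 (Y 1) * w (coord_inv N i x) 1 (Y 2) (Y 3)
          - a (coord_inv N i x) 1 (Y 2) * w (coord_inv N i x) 1 (Y 1) (Y 3)
          + a (coord_inv N i x) 1 (Y 3) * w (coord_inv N i x) 1 (Y 1) (Y 2))"
        by (intro smooth_on_mult smooth_on_diff smooth_on_add SV sma' smw') auto
    qed (use nzV inV in blast)
    show "?k (coord_inv N i x) = \<kappa> (coord_inv N i x)" if "x \<in> ?SV" for x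
      unfolding T_def
      by (rule sym, rule conformal_factor_formula[where a = "a (coord_inv N i x) 1" and b = "a (coord_inv N i x) 2" and c = "a (coord_inv N i x) 3" and \<theta> = "\<theta> (coord_inv N i x)" and \<alpha> = "w (coord_inv N i x) 1",
            OF w1[OF inV[OF that]] nzV(3)[OF inV[OF that], unfolded T_def]])
  qed
  have sm\<theta>: "smooth_on ?SV (\<lambda>x. \<theta> (coord_inv N i x) u)" for u
  proof (rule smooth_on_cong[OF SV])
    let ?t = "\<lambda>q. ((a q 1 (Y 1) * (w q 2 (Y 1) (Y 2) - \<kappa> q * (a q 3 (Y 1) * a q 1 (Y 2) - a q 1 (Y 1) * a q 3 (Y 2)))
      - a q 2 (Y 1) * (w q 1 (Y 1) (Y 2) - \<kappa> q * (a q 2 (Y 1) * a q 3 (Y 2) - a q 3 (Y 1) * a q 2 (Y 2))))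
        / D q * a q 1 u
      - (w q 1 (Y 1) u - \<kappa> q * (a q 2 (Y 1) * a q 3 u - a q 3 (Y 1) * a q 2 u))) / a q 1 (Y 1)"
    show "smooth_on ?SV (\<lambda>x. ?t (coord_inv N i x))"
    proof (intro smooth_on_divide smooth_on_mult smooth_on_diff SV sma' smw' sm\<kappa>)
      show "smooth_on ?SV (\<lambda>x. D (coord_inv N i x))"
        unfolding D_def by (intro smooth_on_mult smooth_on_diff SV sma') auto
    qed (use nzV inV in auto)
    show "?t (coord_inv N i x) = \<theta> (coord_inv N i x) u" if "x \<in> ?SV" for x
      unfolding D_def
      by (rule sym, rule frame_functional_formula[where a = "a (coord_inv N i x) 1" and b = "a (coord_inv N i x) 2" and c = "a (coord_inv N i x) 3" and \<theta> = "\<theta> (coord_inv N i x)" and \<alpha> = "w (coord_inv N i x) 1"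
            and \<beta> = "w (coord_inv N i x) 2", OF w1[OF inV[OF that]] w2[OF inV[OF that]]
          nzV(2)[OF inV[OF that], unfolded D_def] nzV(1)[OF inV[OF that]]])
  qed
  have sms: "smooth_on ?SV (\<lambda>x. sqrt (\<kappa> (coord_inv N i x)))"
    using \<kappa> inV by (intro smooth_on_sqrt[OF SV sm\<kappa>]) auto
  define E where "E = (\<lambda>k :: nat. \<lambda>q u. if k = 1 then \<theta> q u / sqrt (\<kappa> q) else sqrt (\<kappa> q) * a q (k - 1) u)"
  have E: "E 1 q u = \<theta> q u / sqrt (\<kappa> q)" "E 2 q u = sqrt (\<kappa> q) * a q 1 u"
    "E 3 q u = sqrt (\<kappa> q) * a q 2 u" "E 4 q u = sqrt (\<kappa> q) * a q 3 u" for q u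
    by (simp_all add: E_def One_nat_def)
  have linE: "linear (E k q)" if "k \<in> {1, 2, 3, 4}" "q \<in> V" for k q
  proof -
    have lina: "linear (a q r)" if "r \<in> {1, 2, 3}" for r
    proof -
      have q: "q \<in> cdom N i" using \<open>q \<in> V\<close> Vi by blast
      have "a q r = (\<lambda>z. - w q r z X)" unfolding a_def using lin(2)[OF q that] by blast
      then show ?thesis using linear_compose_neg[OF lin(1)[OF q that, of X]] by simp
    qed
    show ?thesis
      using that(1) linear_compose_scale_right[OF \<theta>[OF that(2)], of "1 / sqrt (\<kappa> q)"]
        linear_compose_scale_right[OF lina, of _ "sqrt (\<kappa> q)"]
      unfolding E_def by auto
  qed
  let ?M = "open_submanifold N V"
  have M': "smooth_atlas ?M" by (rule smooth_atlas_open_submanifold[OF N V])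
  have inter: "cdom N i \<inter> V = V" using Vi by blast
  define e where "e = (\<lambda>k j p vs. E k p (frechet_derivative (transition ?M j i) (at (coord ?M j p)) (vs (0::nat))))"
  have e: "diff_form ?M 1 (e k)" if k: "k \<in> {1, 2, 3, 4}" for k
    unfolding e_def
  proof (rule diff_form_extend[OF M'])
    show "i \<in> charts ?M" using i by simp
    show "cdom ?M j \<subseteq> cdom ?M i" if "j \<in> charts ?M" for j using Vi by auto
    show "linear (E k q)" if "q \<in> cdom ?M i" for q using linE[OF k] that by simp
    show "smooth_on (coord ?M i ` cdom ?M i) (\<lambda>x. E k (coord_inv ?M i x) u)" for u
      unfolding open_submanifold_simps inter
    proof (rule smooth_on_cong[OF SV])
      show "E k (coord_inv N i x) u = E k (coord_inv ?M i x) u" if "x \<in> ?SV" for x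
        using coord_inv_open_submanifold[OF M i, of x V] that unfolding inter by simp
      consider "k = 1" | "k = 2" | "k = 3" | "k = 4" using k by blast
      then show "smooth_on ?SV (\<lambda>x. E k (coord_inv N i x) u)"
      proof cases
        case 1
        show ?thesis unfolding 1 E
          using \<kappa> inV by (intro smooth_on_divide[OF SV sm\<theta> sms]) (auto simp: less_le)
      qed (simp only: E; intro smooth_on_mult SV sms sma'; simp)+
    qed
  qed
  let ?L = "\<lambda>j p. frechet_derivative (transition ?M j i) (at (coord ?M j p))"
  have eve: "ev1 (e k j p) x = E k p (?L j p x)" for k j p x
    by (simp add: ev1_def e_def)
  have evw: "ev2 (\<omega> r j p) x y = w p r (?L j p x) (?L j p y)"
    if "j \<in> charts N" "p \<in> cdom N j" "p \<in> V" "r \<in> {1, 2, 3}" for j p r x y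
  proof -
    have "diff_form ?M 2 (\<omega> r)"
      by (rule diff_form_open_submanifold[OF N V SU2_structure_omega[OF SU2 that(4)]])
    then have "ev2 (\<omega> r j p) x y = \<omega> r i p (?L j p \<circ> ((\<lambda>_. y)(0 := x)))"
      unfolding ev2_def using that i Vi by (intro diff_form_transition) auto
    also have "?L j p \<circ> ((\<lambda>_. y)(0 := x)) = (\<lambda>_. ?L j p y)(0 := ?L j p x)" by auto
    finally show ?thesis by (simp only: w_def ev2_def)
  qed
  have s: "sqrt (\<kappa> q) * sqrt (\<kappa> q) = \<kappa> q" "sqrt (\<kappa> q) \<noteq> 0" if "q \<in> V" for q
    using \<kappa>[OF that] by auto
  have prods: "x / sqrt (\<kappa> q) * (sqrt (\<kappa> q) * y) = x * y"
    "(sqrt (\<kappa> q) * y) * (sqrt (\<kappa> q) * z) = \<kappa> q * (y * z)" if "q \<in> V" for q x y z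
    using s[OF that] by (auto simp: field_simps)
  show thesis
  proof (rule that[of V e])
    show "openin (space_top N) V" "p0 \<in> V" by fact+
    show "diff_form ?M 1 (e k)" if "k \<in> {1, 2, 3, 4}" for k by (rule e[OF that])
    fix j p x y assume jp: "j \<in> charts N" "p \<in> cdom N j" "p \<in> V"
    show "ev2 (\<omega> 1 j p) x y
      = wedge11 (ev1 (e 1 j p)) (ev1 (e 2 j p)) x y + wedge11 (ev1 (e 3 j p)) (ev1 (e 4 j p)) x y"
      unfolding evw[OF jp, of 1, simplified] eve E prods[OF jp(3)] w1[OF jp(3)]
      by (simp add: algebra_simps)
    show "ev2 (\<omega> 2 j p) x y
      = wedge11 (ev1 (e 1 j p)) (ev1 (e 3 j p)) x y + wedge11 (ev1 (e 4 j p)) (ev1 (e 2 j p)) x y"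
      unfolding evw[OF jp, of 2, simplified] eve E prods[OF jp(3)] w2[OF jp(3)]
      by (simp add: algebra_simps)
    show "ev2 (\<omega> 3 j p) x y
      = wedge11 (ev1 (e 1 j p)) (ev1 (e 4 j p)) x y + wedge11 (ev1 (e 2 j p)) (ev1 (e 3 j p)) x y"
      unfolding evw[OF jp, of 3, simplified] eve E prods[OF jp(3)] w3[OF jp(3)]
      by (simp add: algebra_simps)
  qed
qed

section \<open>Exterior derivatives\<close>

subsection \<open>The forms of the sin-cone on vectors\<close>

lemma ev1_form: "diff_form M 1 \<alpha> \<Longrightarrow> i \<in> charts M \<Longrightarrow> p \<in> cdom M i \<Longrightarrow> \<alpha> i p us = ev1 (\<alpha> i p) (us 0)"
  by (rule ev1[OF diff_form_alternating])

lemma ev2_form: "diff_form M 2 \<alpha> \<Longrightarrow> i \<in> charts M \<Longrightarrow> p \<in> cdom M i \<Longrightarrow> \<alpha> i p us = ev2 (\<alpha> i p) (us 0) (us 1)"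
  by (rule ev2[OF diff_form_alternating])

lemma skew_form: "diff_form M 2 \<alpha> \<Longrightarrow> i \<in> charts M \<Longrightarrow> p \<in> cdom M i \<Longrightarrow> ev2 (\<alpha> i p) y x = - ev2 (\<alpha> i p) x y"
  by (rule skew_ev2[OF diff_form_alternating])

lemma fscale_apply: "(f \<odot> \<alpha>) i p vs = f p * \<alpha> i p vs"
  by (simp add: fscale_def)

lemma cone_F_eval:
  assumes SU2: "SU2_structure N \<eta> \<omega>" and i: "i \<in> charts N" and p: "p \<in> cdom N i"
  shows "cone_F \<eta> \<omega> i (p, t) vs
    = (sin t)\<^sup>2 * (sin t * ev2 (\<omega> 1 i p) (fst (vs 0)) (fst (vs 1)) + cos t * ev2 (\<omega> 3 i p) (fst (vs 0)) (fst (vs 1)))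
      + sin t * (ev1 (\<eta> i p) (fst (vs 0)) * snd (vs 1) - ev1 (\<eta> i p) (fst (vs 1)) * snd (vs 0))"
proof -
  note \<eta> = ev1_form[OF SU2_structure_eta[OF SU2] i p] and \<omega> = ev2_form[OF SU2_structure_omega[OF SU2] i p]
  have "(pull \<eta> \<and>\<^bsub>1,1\<^esub> dt) i (p, t) vs = ev1 (\<eta> i p) (fst (vs 0)) * snd (vs 1)
      - ev1 (\<eta> i p) (fst (vs 1)) * snd (vs 0)"
    by (rule wedge_1_1) (simp_all add: pull_def dt_def \<eta>[of "\<lambda>m. fst (_ m)"])
  then show ?thesis
    unfolding cone_F_def
    by (simp add: fscale_def sin_t_def cos_t_def pull_def
        \<omega>[of 1 "\<lambda>m. fst (vs m)"] \<omega>[of 3 "\<lambda>m. fst (vs m)"])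
qed

lemma sigma3_wedge:
  fixes \<beta> :: "('a \<times> real, 'i, 'e::euclidean_space \<times> real, real) form"
  assumes SU2: "SU2_structure N \<eta> \<omega>" and i: "i \<in> charts N" and p: "p \<in> cdom N i"
    and S: "\<And>x y. S x y = - cos t * ev2 (\<omega> 1 i p) x y + sin t * ev2 (\<omega> 3 i p) x y"
    and b: "\<And>us. \<beta> i (p, t) us = B (us 0)"
  shows "(((\<lambda>q. - cos_t q) \<odot> pull (\<omega> 1) + sin_t \<odot> pull (\<omega> 3)) \<and>\<^bsub>2,1\<^esub> \<beta>) i (p, t) vs
    = wedge21 (\<lambda>v w. S (fst v) (fst w)) B (vs 0) (vs 1) (vs 2)"
proof (rule wedge_2_1[where A = "\<lambda>v w. S (fst v) (fst w)" and B = B])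
  note \<omega> = ev2_form[OF SU2_structure_omega[OF SU2] i p] and skew = skew_form[OF SU2_structure_omega[OF SU2] i p]
  show "((\<lambda>q. - cos_t q) \<odot> pull (\<omega> 1) + sin_t \<odot> pull (\<omega> 3)) i (p, t) us = S (fst (us 0)) (fst (us 1))"
    for us :: "nat \<Rightarrow> 'e \<times> real"
    by (simp add: fscale_def pull_def S sin_t_def cos_t_def
        \<omega>[of 1 "\<lambda>m. fst (us m)"] \<omega>[of 3 "\<lambda>m. fst (us m)"])
  show "S (fst y) (fst x) = - S (fst x) (fst y)" for x y :: "'e \<times> real"
    using skew[of 1 "fst y" "fst x"] skew[of 3 "fst y" "fst x"] by (simp add: S)
qed (rule b)

lemma cone_Psip_eval:
  fixes N :: "('a, 'i, 'e::euclidean_space) mfd"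
  assumes SU2: "SU2_structure N \<eta> \<omega>" and i: "i \<in> charts N" and p: "p \<in> cdom N i"
    and S: "\<And>x y. S x y = - cos t * ev2 (\<omega> 1 i p) x y + sin t * ev2 (\<omega> 3 i p) x y"
  shows "cone_\<Psi>p \<eta> \<omega> i (p, t) vs
    = sin t ^ 3 * (wedge12 (ev1 (\<eta> i p)) (ev2 (\<omega> 2 i p)) (fst (vs 0)) (fst (vs 1)) (fst (vs 2)))
      - (sin t)\<^sup>2 * (wedge21 (\<lambda>v w. S (fst v) (fst w)) snd (vs 0) (vs 1) (vs 2))"
proof -
  note \<eta> = ev1_form[OF SU2_structure_eta[OF SU2] i p] and \<omega> = ev2_form[OF SU2_structure_omega[OF SU2] i p]
    and skew = skew_form[OF SU2_structure_omega[OF SU2] i p]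
  have skew2: "ev2 (\<omega> 2 i p) y x = - ev2 (\<omega> 2 i p) x y" for x y by (rule skew) simp
  have 1: "(pull \<eta> \<and>\<^bsub>1,2\<^esub> pull (\<omega> 2)) i (p, t) vs
      = wedge12 (ev1 (\<eta> i p)) (ev2 (\<omega> 2 i p)) (fst (vs 0)) (fst (vs 1)) (fst (vs 2))"
    by (rule wedge_1_2[where A = "\<lambda>v. ev1 (\<eta> i p) (fst v)" and B = "\<lambda>v w. ev2 (\<omega> 2 i p) (fst v) (fst w)",
        OF _ _ skew2])
      (simp_all add: pull_def \<eta>[of "\<lambda>m. fst (_ m)"] \<omega>[of 2 "\<lambda>m. fst (_ m)"])
  have "dt i (p, t) us = snd (us 0)" for us :: "nat \<Rightarrow> 'e \<times> real" by (simp add: dt_def)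
  note 2 = sigma3_wedge[OF SU2 i p S, where \<beta> = dt and B = snd, OF this]
  show ?thesis
    unfolding cone_\<Psi>p_def
    by (simp add: fscale_apply 1 2) (simp add: sin_t_def)
qed

lemma cone_Psim_eval:
  assumes SU2: "SU2_structure N \<eta> \<omega>" and i: "i \<in> charts N" and p: "p \<in> cdom N i"
    and S: "\<And>x y. S x y = - cos t * ev2 (\<omega> 1 i p) x y + sin t * ev2 (\<omega> 3 i p) x y"
  shows "cone_\<Psi>m \<eta> \<omega> i (p, t) vs
    = sin t ^ 3 * (wedge21 S (ev1 (\<eta> i p)) (fst (vs 0)) (fst (vs 1)) (fst (vs 2)))
      + (sin t)\<^sup>2 * (wedge21 (\<lambda>v w. ev2 (\<omega> 2 i p) (fst v) (fst w)) snd (vs 0) (vs 1) (vs 2))"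
proof -
  note \<eta> = ev1_form[OF SU2_structure_eta[OF SU2] i p] and \<omega> = ev2_form[OF SU2_structure_omega[OF SU2] i p]
    and skew = skew_form[OF SU2_structure_omega[OF SU2] i p]
  have skew2: "ev2 (\<omega> 2 i p) y x = - ev2 (\<omega> 2 i p) x y" for x y by (rule skew) simp
  have 1: "(pull (\<omega> 2) \<and>\<^bsub>2,1\<^esub> dt) i (p, t) vs
      = wedge21 (\<lambda>v w. ev2 (\<omega> 2 i p) (fst v) (fst w)) snd (vs 0) (vs 1) (vs 2)"
    by (rule wedge_2_1[where A = "\<lambda>v w. ev2 (\<omega> 2 i p) (fst v) (fst w)" and B = snd,
        OF _ skew2])
      (simp_all add: pull_def dt_def \<omega>[of 2 "\<lambda>m. fst (_ m)"])
  have "pull \<eta> i (p, t) us = ev1 (\<eta> i p) (fst (us 0))" for us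
    by (simp add: pull_def \<eta>[of "\<lambda>m. fst (us m)"])
  note 2 = sigma3_wedge[OF SU2 i p S, where \<beta> = "pull \<eta>" and B = "\<lambda>v. ev1 (\<eta> i p) (fst v)", OF this]
  show ?thesis
    unfolding cone_\<Psi>m_def
    by (simp add: fscale_apply 1 2) (simp add: sin_t_def)
qed


text \<open>The derivative at \<open>p\<close>, in the direction \<open>u\<close>, of the component of \<open>\<alpha>\<close> at constant vectors \<open>us\<close>.\<close>

definition chart_deriv :: "('a, 'i, 'e::euclidean_space) mfd \<Rightarrow> ('a, 'i, 'e, real) form \<Rightarrow> 'i \<Rightarrow> 'a \<Rightarrow>
    (nat \<Rightarrow> 'e) \<Rightarrow> 'e \<Rightarrow> real" where
  "chart_deriv M \<alpha> i p us = frechet_derivative (\<lambda>x. \<alpha> i (coord_inv M i x) us) (at (coord M i p))"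

lemma has_derivative_chart_deriv:
  assumes "diff_form M k \<alpha>" "i \<in> charts M" "p \<in> cdom M i"
  shows "((\<lambda>x. \<alpha> i (coord_inv M i x) us) has_derivative chart_deriv M \<alpha> i p us) (at (coord M i p))"
  unfolding chart_deriv_def
  using smooth_on_differentiable[OF diff_form_smooth[OF assms(1,2)]] assms(3)
  by (simp add: frechet_derivative_works[symmetric])

lemma chart_deriv_cong:
  assumes M: "smooth_atlas M" and a: "diff_form M k \<alpha>" and i: "i \<in> charts M" and p: "p \<in> cdom M i"
    and "\<And>m. m < k \<Longrightarrow> us m = ws m"
  shows "chart_deriv M \<alpha> i p us = chart_deriv M \<alpha> i p ws"
  unfolding chart_deriv_def
proof (rule frechet_derivative_transform_within_open[OF _ smooth_atlas_open[OF M i]])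
  show "(\<lambda>x. \<alpha> i (coord_inv M i x) us) differentiable at (coord M i p)"
    using smooth_on_differentiable[OF diff_form_smooth[OF a i]] p by blast
  show "\<alpha> i (coord_inv M i x) us = \<alpha> i (coord_inv M i x) ws" if "x \<in> coord M i ` cdom M i" for x
  proof -
    have "coord_inv M i x \<in> cdom M i" using that smooth_atlas_coord_inv[OF M i] by auto
    then show ?thesis using assms(5) by (rule alternating_form_cong[OF diff_form_alternating[OF a i]])
  qed
qed (use p in auto)

definition pair :: "'e \<Rightarrow> 'e \<Rightarrow> nat \<Rightarrow> 'e" where "pair x y = (\<lambda>_. y)(0 := x)"

lemma pair_simps [simp]: "pair x y 0 = x" "pair x y 1 = y"
  by (simp_all add: pair_def)

lemma ext_deriv_chart_deriv:
  "ext_deriv M k \<alpha> i p vs = (\<Sum>j\<le>k. (- 1) ^ j * chart_deriv M \<alpha> i p (drop_vec j vs) (vs j))"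
  by (simp add: ext_deriv_def chart_deriv_def)

lemma sum_atMost_1_2_3:
  "(\<Sum>j\<le>1. g j) = g 0 + g (1::nat)" "(\<Sum>j\<le>2. g j) = g 0 + g 1 + g (2::nat)"
  "(\<Sum>j\<le>3. g j) = g 0 + g 1 + g 2 + g (3::nat)" for g :: "nat \<Rightarrow> real"
  by (simp_all add: eval_nat_numeral One_nat_def)

lemma ext_deriv_1:
  assumes M: "smooth_atlas M" and a: "diff_form M 1 \<alpha>" and i: "i \<in> charts M" and p: "p \<in> cdom M i"
  shows "ext_deriv M 1 \<alpha> i p vs
    = chart_deriv M \<alpha> i p (\<lambda>_. vs 1) (vs 0) - chart_deriv M \<alpha> i p (\<lambda>_. vs 0) (vs 1)"
proof -
  have "chart_deriv M \<alpha> i p (drop_vec 0 vs) = chart_deriv M \<alpha> i p (\<lambda>_. vs 1)"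
    "chart_deriv M \<alpha> i p (drop_vec 1 vs) = chart_deriv M \<alpha> i p (\<lambda>_. vs 0)"
    by (rule chart_deriv_cong[OF M a i p]; simp add: drop_vec_def One_nat_def)+
  then show ?thesis by (simp add: ext_deriv_chart_deriv sum_atMost_1_2_3)
qed

lemma ext_deriv_2:
  assumes M: "smooth_atlas M" and a: "diff_form M 2 \<alpha>" and i: "i \<in> charts M" and p: "p \<in> cdom M i"
  shows "ext_deriv M 2 \<alpha> i p vs = chart_deriv M \<alpha> i p (pair (vs 1) (vs 2)) (vs 0)
    - chart_deriv M \<alpha> i p (pair (vs 0) (vs 2)) (vs 1) + chart_deriv M \<alpha> i p (pair (vs 0) (vs 1)) (vs 2)"
proof -
  have "chart_deriv M \<alpha> i p (drop_vec 0 vs) = chart_deriv M \<alpha> i p (pair (vs 1) (vs 2))"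
    "chart_deriv M \<alpha> i p (drop_vec 1 vs) = chart_deriv M \<alpha> i p (pair (vs 0) (vs 2))"
    "chart_deriv M \<alpha> i p (drop_vec 2 vs) = chart_deriv M \<alpha> i p (pair (vs 0) (vs 1))"
    by (rule chart_deriv_cong[OF M a i p], drule less_2_cases,
        auto simp: drop_vec_def pair_def One_nat_def eval_nat_numeral)+
  then show ?thesis by (simp add: ext_deriv_chart_deriv sum_atMost_1_2_3)
qed

text \<open>Differentiating \<open>d \<alpha>\<close> once more gives second derivatives of the components of \<open>\<alpha>\<close>, which cancel
  in pairs by symmetry.\<close>

lemma ext_deriv_ext_deriv_1:
  assumes M: "smooth_atlas M" and a: "diff_form M 1 \<alpha>" and b: "diff_form M 2 \<beta>"
    and i: "i \<in> charts M" and p: "p \<in> cdom M i"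
    and eq: "\<And>q us. q \<in> cdom M i \<Longrightarrow> \<beta> i q us = c * ext_deriv M 1 \<alpha> i q us"
  shows "ext_deriv M 2 \<beta> i p vs = 0"
proof -
  let ?S = "coord M i ` cdom M i"
  let ?f = "\<lambda>y x. \<alpha> i (coord_inv M i x) (\<lambda>_. y)"
  let ?D2 = "\<lambda>y u w. frechet_derivative (\<lambda>x. frechet_derivative (?f y) (at x) u) (at (coord M i p)) w"
  have S: "open ?S" by (rule smooth_atlas_open[OF M i])
  have x: "coord M i p \<in> ?S" using p by blast
  have sm: "smooth_on ?S (?f y)" for y by (rule diff_form_smooth[OF a i])
  have D: "((\<lambda>x. frechet_derivative (?f y) (at x) u) has_derivative ?D2 y u) (at (coord M i p))" for y u
    using smooth_on_differentiable[OF smooth_on_frechet_derivative[OF sm] x]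
    by (simp add: frechet_derivative_works)
  have cd: "chart_deriv M \<beta> i p (pair y z) w = c * (?D2 z y w - ?D2 y z w)" for y z w
  proof -
    have "((\<lambda>x. c * (frechet_derivative (?f z) (at x) y - frechet_derivative (?f y) (at x) z))
        has_derivative (\<lambda>w. c * (?D2 z y w - ?D2 y z w))) (at (coord M i p))"
      by (intro has_derivative_mult_right has_derivative_diff D)
    moreover have "c * (frechet_derivative (?f z) (at x) y - frechet_derivative (?f y) (at x) z)
        = \<beta> i (coord_inv M i x) (pair y z)" if "x \<in> ?S" for x
    proof -
      obtain q where q: "q \<in> cdom M i" "x = coord M i q" using \<open>x \<in> ?S\<close> by blast
      then show ?thesis
        by (simp add: smooth_atlas_coord_inv[OF M i] eq ext_deriv_1[OF M a i] chart_deriv_def)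
    qed
    ultimately have "((\<lambda>x. \<beta> i (coord_inv M i x) (pair y z))
        has_derivative (\<lambda>w. c * (?D2 z y w - ?D2 y z w))) (at (coord M i p))"
      by (rule has_derivative_transform_within_open[OF _ S x])
    then show ?thesis unfolding chart_deriv_def by (simp add: frechet_derivative_at[symmetric])
  qed
  have sym: "?D2 y u w = ?D2 y w u" for y u w
    by (rule frechet_derivative_symmetric[OF S sm x])
  show ?thesis
    unfolding ext_deriv_2[OF M b i p] cd
    using sym[of "vs 2" "vs 1" "vs 0"] sym[of "vs 1" "vs 2" "vs 0"] sym[of "vs 0" "vs 2" "vs 1"]
    by (simp add: algebra_simps)
qed

definition triple :: "'e \<Rightarrow> 'e \<Rightarrow> 'e \<Rightarrow> nat \<Rightarrow> 'e" where
  "triple x y z = (\<lambda>m. if m = 0 then x else if m = 1 then y else z)"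

lemma triple_simps [simp]: "triple x y z 0 = x" "triple x y z 1 = y" "triple x y z 2 = z"
  by (simp_all add: triple_def)

lemma ev_pair: "a (pair x y) = ev2 a x y" "a (\<lambda>_. x) = ev1 a x"
  by (simp_all add: ev2_def ev1_def pair_def)

lemma drop_vec_simps:
  "drop_vec 0 vs 0 = vs 1" "drop_vec 0 vs 1 = vs 2" "drop_vec 0 vs 2 = vs 3"
  "drop_vec 1 vs 0 = vs 0" "drop_vec 1 vs 1 = vs 2" "drop_vec 1 vs 2 = vs 3"
  "drop_vec 2 vs 0 = vs 0" "drop_vec 2 vs 1 = vs 1" "drop_vec 2 vs 2 = vs 3"
  "drop_vec 3 vs 0 = vs 0" "drop_vec 3 vs 1 = vs 1" "drop_vec 3 vs 2 = vs 2"
  by (simp_all add: drop_vec_def One_nat_def eval_nat_numeral)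

lemma wedge_2_1_form:
  assumes a: "diff_form M 2 \<alpha>" and b: "diff_form M 1 \<beta>" and i: "i \<in> charts M" and p: "p \<in> cdom M i"
  shows "(\<alpha> \<and>\<^bsub>2,1\<^esub> \<beta>) i p us = wedge21 (ev2 (\<alpha> i p)) (ev1 (\<beta> i p)) (us 0) (us 1) (us 2)"
  by (rule wedge_2_1[where A = "ev2 (\<alpha> i p)" and B = "ev1 (\<beta> i p)"])
    (rule ev2_form[OF a i p] skew_form[OF a i p] ev1_form[OF b i p])+

lemma wedge_1_2_form:
  assumes a: "diff_form M 1 \<alpha>" and b: "diff_form M 2 \<beta>" and i: "i \<in> charts M" and p: "p \<in> cdom M i"
  shows "(\<alpha> \<and>\<^bsub>1,2\<^esub> \<beta>) i p us = ev1 (\<alpha> i p) (us 0) * ev2 (\<beta> i p) (us 1) (us 2)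
    - ev1 (\<alpha> i p) (us 1) * ev2 (\<beta> i p) (us 0) (us 2) + ev1 (\<alpha> i p) (us 2) * ev2 (\<beta> i p) (us 0) (us 1)"
  by (rule wedge_1_2[where A = "ev1 (\<alpha> i p)" and B = "ev2 (\<beta> i p)"])
    (rule ev1_form[OF a i p] ev2_form[OF b i p] skew_form[OF b i p])+

lemma chart_deriv_wedge_2_1:
  assumes M: "smooth_atlas M" and a: "diff_form M 2 \<alpha>" and b: "diff_form M 1 \<beta>"
    and i: "i \<in> charts M" and p: "p \<in> cdom M i"
  shows "chart_deriv M (\<alpha> \<and>\<^bsub>2,1\<^esub> \<beta>) i p us u =
      chart_deriv M \<alpha> i p (pair (us 0) (us 1)) u * ev1 (\<beta> i p) (us 2)
        + ev2 (\<alpha> i p) (us 0) (us 1) * chart_deriv M \<beta> i p (\<lambda>_. us 2) u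
      - (chart_deriv M \<alpha> i p (pair (us 0) (us 2)) u * ev1 (\<beta> i p) (us 1)
        + ev2 (\<alpha> i p) (us 0) (us 2) * chart_deriv M \<beta> i p (\<lambda>_. us 1) u)
      + (chart_deriv M \<alpha> i p (pair (us 1) (us 2)) u * ev1 (\<beta> i p) (us 0)
        + ev2 (\<alpha> i p) (us 1) (us 2) * chart_deriv M \<beta> i p (\<lambda>_. us 0) u)"
proof -
  let ?x = "coord M i p"
  let ?A = "\<lambda>y z x. \<alpha> i (coord_inv M i x) (pair y z)" and ?B = "\<lambda>y x. \<beta> i (coord_inv M i x) (\<lambda>_. y)"
  let ?dA = "\<lambda>y z. chart_deriv M \<alpha> i p (pair y z)" and ?dB = "\<lambda>y. chart_deriv M \<beta> i p (\<lambda>_. y)"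
  have prod: "((\<lambda>x. ?A y z x * ?B w x) has_derivative (\<lambda>h. ?A y z ?x * ?dB w h + ?dA y z h * ?B w ?x)) (at ?x)"
    for y z w
    by (rule has_derivative_mult[OF has_derivative_chart_deriv[OF a i p] has_derivative_chart_deriv[OF b i p]])
  have S: "open (coord M i ` cdom M i)" by (rule smooth_atlas_open[OF M i])
  have "((\<lambda>x. (\<alpha> \<and>\<^bsub>2,1\<^esub> \<beta>) i (coord_inv M i x) us) has_derivative (\<lambda>h.
      (?A (us 0) (us 1) ?x * ?dB (us 2) h + ?dA (us 0) (us 1) h * ?B (us 2) ?x)
      - (?A (us 0) (us 2) ?x * ?dB (us 1) h + ?dA (us 0) (us 2) h * ?B (us 1) ?x)
      + (?A (us 1) (us 2) ?x * ?dB (us 0) h + ?dA (us 1) (us 2) h * ?B (us 0) ?x))) (at ?x)"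
  proof (rule has_derivative_transform_within_open[OF has_derivative_add[OF has_derivative_diff[OF prod prod] prod] S])
    show "?A (us 0) (us 1) x * ?B (us 2) x - ?A (us 0) (us 2) x * ?B (us 1) x + ?A (us 1) (us 2) x * ?B (us 0) x
        = (\<alpha> \<and>\<^bsub>2,1\<^esub> \<beta>) i (coord_inv M i x) us" if "x \<in> coord M i ` cdom M i" for x
    proof -
      have "coord_inv M i x \<in> cdom M i" using that smooth_atlas_coord_inv[OF M i] by auto
      from wedge_2_1_form[OF a b i this] show ?thesis by (simp add: ev_pair)
    qed
  qed (use p in blast)
  then show ?thesis
    unfolding chart_deriv_def[of _ "\<alpha> \<and>\<^bsub>2,1\<^esub> \<beta>"]
    by (simp add: frechet_derivative_at[symmetric] smooth_atlas_coord_inv[OF M i p] ev_pair)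
qed

text \<open>The Leibniz rule \<open>d (\<alpha> \<and> \<beta>) = d \<alpha> \<and> \<beta> + \<alpha> \<and> d \<beta>\<close>.\<close>

lemma ext_deriv_wedge_2_1:
  assumes M: "smooth_atlas M" and a: "diff_form M 2 \<alpha>" and b: "diff_form M 1 \<beta>"
    and i: "i \<in> charts M" and p: "p \<in> cdom M i"
    and A: "\<And>us. ext_deriv M 2 \<alpha> i p us = A (us 0) (us 1) (us 2)"
    and B: "\<And>us. ext_deriv M 1 \<beta> i p us = B (us 0) (us 1)"
  shows "ext_deriv M 3 (\<alpha> \<and>\<^bsub>2,1\<^esub> \<beta>) i p vs =
      A (vs 0) (vs 1) (vs 2) * ev1 (\<beta> i p) (vs 3) - A (vs 0) (vs 1) (vs 3) * ev1 (\<beta> i p) (vs 2)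
      + A (vs 0) (vs 2) (vs 3) * ev1 (\<beta> i p) (vs 1) - A (vs 1) (vs 2) (vs 3) * ev1 (\<beta> i p) (vs 0)
      + wedge22 (ev2 (\<alpha> i p)) B (vs 0) (vs 1) (vs 2) (vs 3)"
proof -
  have A': "A x y z = chart_deriv M \<alpha> i p (pair y z) x - chart_deriv M \<alpha> i p (pair x z) y
      + chart_deriv M \<alpha> i p (pair x y) z" for x y z
    using A[of "triple x y z"] ext_deriv_2[OF M a i p, of "triple x y z"] by simp
  have B': "B x y = chart_deriv M \<beta> i p (\<lambda>_. y) x - chart_deriv M \<beta> i p (\<lambda>_. x) y" for x y
    using B[of "pair x y"] ext_deriv_1[OF M b i p, of "pair x y"] by simp
  show ?thesis
    unfolding ext_deriv_chart_deriv sum_atMost_1_2_3 chart_deriv_wedge_2_1[OF M a b i p] drop_vec_simps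
      A' B' wedge22_def
    by (simp add: algebra_simps)
qed

lemma cone_term_has_derivative:
  fixes N :: "('a, 'i, 'e::euclidean_space) mfd"
  assumes N: "smooth_atlas N" and a: "diff_form N k \<alpha>" and i: "i \<in> charts N" and p: "p \<in> cdom N i"
    and f: "(f has_real_derivative f') (at t)"
  shows "((\<lambda>z. f (snd z) * \<alpha> i (coord_inv N i (fst z)) us) has_derivative
    (\<lambda>v. f t * chart_deriv N \<alpha> i p us (fst v) + f' * snd v * \<alpha> i p us)) (at (coord N i p, t))"
proof -
  have 1: "((\<lambda>z :: 'e \<times> real. f (snd z)) has_derivative (\<lambda>v. f' * snd v)) (at (coord N i p, t))"
    using has_derivative_compose[OF has_derivative_snd[OF has_derivative_ident], of f "(*) f'" "(coord N i p, t)" UNIV] f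
    by (simp add: has_field_derivative_def)
  have 2: "((\<lambda>z :: 'e \<times> real. \<alpha> i (coord_inv N i (fst z)) us) has_derivative
      (\<lambda>v. chart_deriv N \<alpha> i p us (fst v))) (at (coord N i p, t))"
    using has_derivative_compose[OF has_derivative_fst[OF has_derivative_ident], of "\<lambda>x. \<alpha> i (coord_inv N i x) us"
        "chart_deriv N \<alpha> i p us" "(coord N i p, t)" UNIV] has_derivative_chart_deriv[OF a i p, of us]
    by simp
  show ?thesis
    using has_derivative_mult[OF 1 2] by (simp add: smooth_atlas_coord_inv[OF N i p])
qed

text \<open>It is enough to differentiate a formula for \<open>G\<close> in the product coordinates.\<close>

lemma chart_deriv_cone:
  assumes N: "smooth_atlas N" and i: "i \<in> charts N" and p: "p \<in> cdom N i" and t: "t \<in> {0<..<pi}"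
    and L: "((\<lambda>z. g (coord_inv N i (fst z)) (snd z)) has_derivative L) (at (coord N i p, t))"
    and g: "\<And>q s. q \<in> cdom N i \<Longrightarrow> G i (q, s) vs = g q s"
  shows "chart_deriv (sin_cone N) G i (p, t) vs = L"
proof -
  let ?S = "coord N i ` cdom N i \<times> {0<..<pi}"
  have "((\<lambda>z. G i (coord_inv (sin_cone N) i z) vs) has_derivative L) (at (coord N i p, t))"
  proof (rule has_derivative_transform_within_open[OF L])
    show "open ?S" using smooth_atlas_open[OF N i] by (intro open_Times) auto
    show "(coord N i p, t) \<in> ?S" using p t by blast
    show "g (coord_inv N i (fst z)) (snd z) = G i (coord_inv (sin_cone N) i z) vs" if "z \<in> ?S" for z
    proof -
      obtain q s where z: "z = (coord N i q, s)" "q \<in> cdom N i" "s \<in> {0<..<pi}" using \<open>z \<in> ?S\<close> by blast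
      then have "coord_inv (sin_cone N) i z = (q, s)"
        using coord_inv_sin_cone[OF N i, of "coord N i q" s] smooth_atlas_coord_inv[OF N i z(2)]
        by (simp add: z(1) imageI[OF z(2)] z(3)[simplified])
      then show ?thesis using z g[OF z(2)] smooth_atlas_coord_inv[OF N i z(2)] by simp
    qed
  qed
  then show ?thesis
    unfolding chart_deriv_def by (simp add: frechet_derivative_at[symmetric])
qed

lemma chart_deriv_cone_F:
  assumes SU2: "SU2_structure N \<eta> \<omega>" and i: "i \<in> charts N" and p: "p \<in> cdom N i" and t: "t \<in> {0<..<pi}"
  shows "chart_deriv (sin_cone N) (cone_F \<eta> \<omega>) i (p, t) vs v =
    sin t ^ 3 * chart_deriv N (\<omega> 1) i p (pair (fst (vs 0)) (fst (vs 1))) (fst v)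
    + 3 * (sin t)\<^sup>2 * cos t * snd v * ev2 (\<omega> 1 i p) (fst (vs 0)) (fst (vs 1))
    + ((sin t)\<^sup>2 * cos t * chart_deriv N (\<omega> 3) i p (pair (fst (vs 0)) (fst (vs 1))) (fst v)
      + (2 * sin t * (cos t)\<^sup>2 - sin t ^ 3) * snd v * ev2 (\<omega> 3 i p) (fst (vs 0)) (fst (vs 1)))
    + (snd (vs 1) * (sin t * chart_deriv N \<eta> i p (\<lambda>_. fst (vs 0)) (fst v)
        + cos t * snd v * ev1 (\<eta> i p) (fst (vs 0)))
      - snd (vs 0) * (sin t * chart_deriv N \<eta> i p (\<lambda>_. fst (vs 1)) (fst v)
        + cos t * snd v * ev1 (\<eta> i p) (fst (vs 1))))"
proof -
  note N = smooth_manifold_imp_smooth_atlas[OF SU2_structure_manifold[OF SU2]]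
  note \<eta> = SU2_structure_eta[OF SU2] and \<omega> = SU2_structure_omega[OF SU2]
  have 1: "((\<lambda>s. sin s ^ 3) has_real_derivative 3 * (sin t)\<^sup>2 * cos t) (at t)"
    and 3: "((\<lambda>s. (sin s)\<^sup>2 * cos s) has_real_derivative 2 * sin t * (cos t)\<^sup>2 - sin t ^ 3) (at t)"
    by (auto intro!: derivative_eq_intros simp: power2_eq_square power3_eq_cube)
  have \<omega>1: "diff_form N 2 (\<omega> 1)" and \<omega>3: "diff_form N 2 (\<omega> 3)" by (simp_all add: \<omega>)
  note D = has_derivative_add[OF has_derivative_add[OF
        cone_term_has_derivative[OF N \<omega>1 i p 1, of "pair (fst (vs 0)) (fst (vs 1))"]
        cone_term_has_derivative[OF N \<omega>3 i p 3, of "pair (fst (vs 0)) (fst (vs 1))"]]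
      has_derivative_diff[OF
        has_derivative_mult_right[OF cone_term_has_derivative[OF N \<eta> i p DERIV_sin, of "\<lambda>_. fst (vs 0)"], of "snd (vs 1)"]
        has_derivative_mult_right[OF cone_term_has_derivative[OF N \<eta> i p DERIV_sin, of "\<lambda>_. fst (vs 1)"], of "snd (vs 0)"]]]
  show ?thesis
    by (subst chart_deriv_cone[where g = "\<lambda>q s. sin s ^ 3 * \<omega> 1 i q (pair (fst (vs 0)) (fst (vs 1)))
        + (sin s)\<^sup>2 * cos s * \<omega> 3 i q (pair (fst (vs 0)) (fst (vs 1)))
        + (snd (vs 1) * (sin s * \<eta> i q (\<lambda>_. fst (vs 0))) - snd (vs 0) * (sin s * \<eta> i q (\<lambda>_. fst (vs 1))))",
        OF N i p t D])
      (simp_all add: cone_F_eval[OF SU2 i] ev_pair algebra_simps power2_eq_square power3_eq_cube)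
qed

text \<open>For the derivative it is convenient to keep the 3-forms \<open>\<omega>\<^sub>r \<and> \<eta>\<close> of \<open>N\<close> together.\<close>

lemma cone_Psim_eval_wedge:
  assumes SU2: "SU2_structure N \<eta> \<omega>" and i: "i \<in> charts N" and p: "p \<in> cdom N i"
  shows "cone_\<Psi>m \<eta> \<omega> i (p, t) vs =
    sin t ^ 4 * (\<omega> 3 \<and>\<^bsub>2,1\<^esub> \<eta>) i p (\<lambda>m. fst (vs m)) - sin t ^ 3 * cos t * (\<omega> 1 \<and>\<^bsub>2,1\<^esub> \<eta>) i p (\<lambda>m. fst (vs m))
    + (snd (vs 2) * ((sin t)\<^sup>2 * \<omega> 2 i p (pair (fst (vs 0)) (fst (vs 1))))
      - snd (vs 1) * ((sin t)\<^sup>2 * \<omega> 2 i p (pair (fst (vs 0)) (fst (vs 2))))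
      + snd (vs 0) * ((sin t)\<^sup>2 * \<omega> 2 i p (pair (fst (vs 1)) (fst (vs 2)))))"
proof -
  note \<eta> = SU2_structure_eta[OF SU2]
  have \<omega>: "diff_form N 2 (\<omega> 1)" "diff_form N 2 (\<omega> 3)" by (simp_all add: SU2_structure_omega[OF SU2])
  show ?thesis
    unfolding cone_Psim_eval[OF SU2 i p refl] wedge_2_1_form[OF \<omega>(1) \<eta> i p] wedge_2_1_form[OF \<omega>(2) \<eta> i p] ev_pair
    by (simp add: algebra_simps power2_eq_square power3_eq_cube power4_eq_xxxx)
qed

lemma chart_deriv_cone_Psim:
  assumes SU2: "SU2_structure N \<eta> \<omega>" and i: "i \<in> charts N" and p: "p \<in> cdom N i" and t: "t \<in> {0<..<pi}"
  shows "chart_deriv (sin_cone N) (cone_\<Psi>m \<eta> \<omega>) i (p, t) vs v =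
    sin t ^ 4 * chart_deriv N (\<omega> 3 \<and>\<^bsub>2,1\<^esub> \<eta>) i p (\<lambda>m. fst (vs m)) (fst v)
    + 4 * sin t ^ 3 * cos t * snd v * (\<omega> 3 \<and>\<^bsub>2,1\<^esub> \<eta>) i p (\<lambda>m. fst (vs m))
    - (sin t ^ 3 * cos t * chart_deriv N (\<omega> 1 \<and>\<^bsub>2,1\<^esub> \<eta>) i p (\<lambda>m. fst (vs m)) (fst v)
      + (3 * (sin t)\<^sup>2 * (cos t)\<^sup>2 - sin t ^ 4) * snd v * (\<omega> 1 \<and>\<^bsub>2,1\<^esub> \<eta>) i p (\<lambda>m. fst (vs m)))
    + (snd (vs 2) * ((sin t)\<^sup>2 * chart_deriv N (\<omega> 2) i p (pair (fst (vs 0)) (fst (vs 1))) (fst v)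
        + 2 * sin t * cos t * snd v * ev2 (\<omega> 2 i p) (fst (vs 0)) (fst (vs 1)))
      - snd (vs 1) * ((sin t)\<^sup>2 * chart_deriv N (\<omega> 2) i p (pair (fst (vs 0)) (fst (vs 2))) (fst v)
        + 2 * sin t * cos t * snd v * ev2 (\<omega> 2 i p) (fst (vs 0)) (fst (vs 2)))
      + snd (vs 0) * ((sin t)\<^sup>2 * chart_deriv N (\<omega> 2) i p (pair (fst (vs 1)) (fst (vs 2))) (fst v)
        + 2 * sin t * cos t * snd v * ev2 (\<omega> 2 i p) (fst (vs 1)) (fst (vs 2))))"
proof -
  note N = smooth_manifold_imp_smooth_atlas[OF SU2_structure_manifold[OF SU2]]
  note \<eta> = SU2_structure_eta[OF SU2]
  have \<omega>: "diff_form N 2 (\<omega> 1)" "diff_form N 2 (\<omega> 2)" "diff_form N 2 (\<omega> 3)"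
    by (simp_all add: SU2_structure_omega[OF SU2])
  note \<Theta> = diff_form_wedge[OF N \<omega>(1) \<eta>] diff_form_wedge[OF N \<omega>(3) \<eta>]
  have 1: "((\<lambda>s. sin s ^ 3 * cos s) has_real_derivative 3 * (sin t)\<^sup>2 * (cos t)\<^sup>2 - sin t ^ 4) (at t)"
    and 2: "((\<lambda>s. (sin s)\<^sup>2) has_real_derivative 2 * sin t * cos t) (at t)"
    and 3: "((\<lambda>s. sin s ^ 4) has_real_derivative 4 * sin t ^ 3 * cos t) (at t)"
    by (auto intro!: derivative_eq_intros simp: power2_eq_square power3_eq_cube power4_eq_xxxx)
  note D = has_derivative_add[OF has_derivative_diff[OF
        cone_term_has_derivative[OF N \<Theta>(2) i p 3, of "\<lambda>m. fst (vs m)"]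
        cone_term_has_derivative[OF N \<Theta>(1) i p 1, of "\<lambda>m. fst (vs m)"]]
      has_derivative_add[OF has_derivative_diff[OF
        has_derivative_mult_right[OF cone_term_has_derivative[OF N \<omega>(2) i p 2, of "pair (fst (vs 0)) (fst (vs 1))"], of "snd (vs 2)"]
        has_derivative_mult_right[OF cone_term_has_derivative[OF N \<omega>(2) i p 2, of "pair (fst (vs 0)) (fst (vs 2))"], of "snd (vs 1)"]]
        has_derivative_mult_right[OF cone_term_has_derivative[OF N \<omega>(2) i p 2, of "pair (fst (vs 1)) (fst (vs 2))"], of "snd (vs 0)"]]]
  note E = chart_deriv_cone[where G = "cone_\<Psi>m \<eta> \<omega>" and vs = vs, OF N i p t _ cone_Psim_eval_wedge[OF SU2 i]]
  show ?thesis
    by (subst E[OF D]) (simp_all add: ev_pair)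
qed

lemma diff_form_cone:
  assumes SU2: "SU2_structure N \<eta> \<omega>"
  shows "diff_form (sin_cone N) 2 (cone_F \<eta> \<omega>)" "diff_form (sin_cone N) 3 (cone_\<Psi>p \<eta> \<omega>)"
    "diff_form (sin_cone N) 3 (cone_\<Psi>m \<eta> \<omega>)"
proof -
  note N = smooth_manifold_imp_smooth_atlas[OF SU2_structure_manifold[OF SU2]]
  note M = smooth_atlas_sin_cone[OF N]
  note \<eta> = diff_form_pull[OF N SU2_structure_eta[OF SU2]]
  have \<omega>: "diff_form (sin_cone N) 2 (pull (\<omega> 1))" "diff_form (sin_cone N) 2 (pull (\<omega> 2))"
    "diff_form (sin_cone N) 2 (pull (\<omega> 3))"
    by (auto intro!: diff_form_pull[OF N] SU2_structure_omega[OF SU2])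
  have I: "open {0<..<pi}" by simp
  note sc = smooth_on_sin_cos_real[OF I]
  note scale = diff_form_scale_t[OF N]
  have eqs: "sin_t = (\<lambda>q. sin (snd q))" "cos_t = (\<lambda>q. cos (snd q))"
    by (simp_all add: fun_eq_iff sin_t_def cos_t_def)
  note dt = diff_form_dt[OF N]
  have S: "diff_form (sin_cone N) 2 ((\<lambda>q. - cos_t q) \<odot> pull (\<omega> 1) + sin_t \<odot> pull (\<omega> 3))"
    unfolding eqs
    by (rule diff_form_add[OF M scale[OF \<omega>(1) smooth_on_minus[OF I sc(2)]] scale[OF \<omega>(3) sc(1)]])
  have "diff_form (sin_cone N) 2 (pull \<eta> \<and>\<^bsub>1,1\<^esub> dt)" "diff_form (sin_cone N) 3 (pull \<eta> \<and>\<^bsub>1,2\<^esub> pull (\<omega> 2))"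
    "diff_form (sin_cone N) 3 (pull (\<omega> 2) \<and>\<^bsub>2,1\<^esub> dt)"
    "diff_form (sin_cone N) 3 (((\<lambda>q. - cos_t q) \<odot> pull (\<omega> 1) + sin_t \<odot> pull (\<omega> 3)) \<and>\<^bsub>2,1\<^esub> dt)"
    "diff_form (sin_cone N) 3 (((\<lambda>q. - cos_t q) \<odot> pull (\<omega> 1) + sin_t \<odot> pull (\<omega> 3)) \<and>\<^bsub>2,1\<^esub> pull \<eta>)"
    using diff_form_wedge[OF M \<eta> dt] diff_form_wedge[OF M \<eta> \<omega>(2)] diff_form_wedge[OF M \<omega>(2) dt]
      diff_form_wedge[OF M S dt] diff_form_wedge[OF M S \<eta>] by simp_all
  note w = this
  note sq = smooth_on_power[OF I sc(1)]
  show "diff_form (sin_cone N) 2 (cone_F \<eta> \<omega>)"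
    unfolding cone_F_def eqs
    by (rule diff_form_add[OF M scale[OF diff_form_add[OF M scale[OF \<omega>(1) sc(1)] scale[OF \<omega>(3) sc(2)]] sq]
          scale[OF w(1) sc(1)]])
  show "diff_form (sin_cone N) 3 (cone_\<Psi>p \<eta> \<omega>)"
    unfolding cone_\<Psi>p_def
    using diff_form_diff[OF M scale[OF w(2) sq[of 3]] scale[OF w(4) sq[of 2]]] by (simp add: eqs)
  show "diff_form (sin_cone N) 3 (cone_\<Psi>m \<eta> \<omega>)"
    unfolding cone_\<Psi>m_def
    using diff_form_add[OF M scale[OF w(5) sq[of 3]] scale[OF w(3) sq[of 2]]] by (simp add: eqs)
qed

text \<open>The derivative of \<open>sin t\<close> in the last term of \<open>F\<close> contributes \<open>dt \<and> dt = 0\<close>, so the last line has no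
  term with \<open>cos t\<close>.\<close>

lemma ext_deriv_cone_F:
  assumes SU2: "SU2_structure N \<eta> \<omega>" and i: "i \<in> charts N" and p: "p \<in> cdom N i" and t: "t \<in> {0<..<pi}"
    and d\<eta>: "\<And>us. ext_deriv N 1 \<eta> i p us = B (us 0) (us 1)"
    and x: "\<And>m. x m = fst (vs m)" and \<tau>: "\<And>m. \<tau> m = snd (vs m)"
  shows "ext_deriv (sin_cone N) 2 (cone_F \<eta> \<omega>) i (p, t) vs =
    sin t ^ 3 * ext_deriv N 2 (\<omega> 1) i p x + (sin t)\<^sup>2 * cos t * ext_deriv N 2 (\<omega> 3) i p x
    + 3 * (sin t)\<^sup>2 * cos t * (\<tau> 0 * ev2 (\<omega> 1 i p) (x 1) (x 2) - \<tau> 1 * ev2 (\<omega> 1 i p) (x 0) (x 2)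
        + \<tau> 2 * ev2 (\<omega> 1 i p) (x 0) (x 1))
    + (2 * sin t * (cos t)\<^sup>2 - sin t ^ 3) * (\<tau> 0 * ev2 (\<omega> 3 i p) (x 1) (x 2)
        - \<tau> 1 * ev2 (\<omega> 3 i p) (x 0) (x 2) + \<tau> 2 * ev2 (\<omega> 3 i p) (x 0) (x 1))
    + sin t * (\<tau> 0 * B (x 1) (x 2) - \<tau> 1 * B (x 0) (x 2) + \<tau> 2 * B (x 0) (x 1))"
proof -
  note N = smooth_manifold_imp_smooth_atlas[OF SU2_structure_manifold[OF SU2]]
  have \<omega>: "diff_form N 2 (\<omega> 1)" "diff_form N 2 (\<omega> 3)"
    by (simp_all add: SU2_structure_omega[OF SU2])
  have q: "i \<in> charts (sin_cone N)" "(p, t) \<in> cdom (sin_cone N) i" using i p t by auto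
  have B: "B y z = chart_deriv N \<eta> i p (\<lambda>_. z) y - chart_deriv N \<eta> i p (\<lambda>_. y) z" for y z
    using d\<eta>[of "pair y z"] ext_deriv_1[OF N SU2_structure_eta[OF SU2] i p, of "pair y z"] by simp
  show ?thesis
    unfolding ext_deriv_2[OF smooth_atlas_sin_cone[OF N] diff_form_cone(1)[OF SU2] q]
      chart_deriv_cone_F[OF SU2 i p t] pair_simps ext_deriv_2[OF N \<omega>(1) i p] ext_deriv_2[OF N \<omega>(2) i p] B x \<tau>
    by (simp add: algebra_simps)
qed

lemma ext_deriv_cone_Psim:
  assumes SU2: "SU2_structure N \<eta> \<omega>" and i: "i \<in> charts N" and p: "p \<in> cdom N i" and t: "t \<in> {0<..<pi}"
    and d\<omega>: "\<And>us. ext_deriv N 2 (\<omega> 2) i p us = A (us 0) (us 1) (us 2)"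
    and x: "x = (\<lambda>m. fst (vs m))" and \<tau>: "\<And>m. \<tau> m = snd (vs m)"
    and T: "\<And>j. T j = (sin t ^ 4 - 3 * (sin t)\<^sup>2 * (cos t)\<^sup>2) * (\<omega> 1 \<and>\<^bsub>2,1\<^esub> \<eta>) i p (drop_vec j x)
        + 4 * sin t ^ 3 * cos t * (\<omega> 3 \<and>\<^bsub>2,1\<^esub> \<eta>) i p (drop_vec j x)"
  shows "ext_deriv (sin_cone N) 3 (cone_\<Psi>m \<eta> \<omega>) i (p, t) vs =
    sin t ^ 4 * ext_deriv N 3 (\<omega> 3 \<and>\<^bsub>2,1\<^esub> \<eta>) i p x - sin t ^ 3 * cos t * ext_deriv N 3 (\<omega> 1 \<and>\<^bsub>2,1\<^esub> \<eta>) i p x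
    + (\<tau> 0 * T 0 - \<tau> 1 * T 1 + \<tau> 2 * T 2 - \<tau> 3 * T 3)
    + (sin t)\<^sup>2 * (\<tau> 3 * A (x 0) (x 1) (x 2) - \<tau> 2 * A (x 0) (x 1) (x 3)
        + \<tau> 1 * A (x 0) (x 2) (x 3) - \<tau> 0 * A (x 1) (x 2) (x 3))"
proof -
  note N = smooth_manifold_imp_smooth_atlas[OF SU2_structure_manifold[OF SU2]]
  have \<omega>: "diff_form N 2 (\<omega> 2)"
    by (simp_all add: SU2_structure_omega[OF SU2])
  have A: "A y z w = chart_deriv N (\<omega> 2) i p (pair z w) y - chart_deriv N (\<omega> 2) i p (pair y w) z
      + chart_deriv N (\<omega> 2) i p (pair y z) w" for y z w
    using d\<omega>[of "triple y z w"] ext_deriv_2[OF N \<omega> i p, of "triple y z w"] by simp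
  have drop: "(\<lambda>m. fst (drop_vec j vs m)) = drop_vec j x" for j
    by (auto simp: drop_vec_def x)
  show ?thesis
    unfolding ext_deriv_chart_deriv sum_atMost_1_2_3 chart_deriv_cone_Psim[OF SU2 i p t] drop drop_vec_simps A T
    by (simp add: \<tau> x algebra_simps)
qed

section \<open>The equivalence\<close>

subsection \<open>The \<open>SU(3)\<close>-structure of the sin-cone\<close>

lemma sum_1_6: "(\<Sum>a = 1..6. f a) = f 1 + f 2 + f 3 + f 4 + f 5 + f (6::nat)" for f :: "nat \<Rightarrow> real"
  by (simp add: eval_nat_numeral One_nat_def)

text \<open>With an adapted coframe \<open>e\<close> of \<open>N\<close>, the triple
  \<open>sin t \<omega>\<^sub>1 + cos t \<omega>\<^sub>3, \<omega>\<^sub>2, - cos t \<omega>\<^sub>1 + sin t \<omega>\<^sub>3\<close> has the adapted coframe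
  \<open>e\<^sub>1, sin t e\<^sub>2 + cos t e\<^sub>4, e\<^sub>3, - cos t e\<^sub>2 + sin t e\<^sub>4\<close>. These forms and \<open>\<eta>\<close>, all times \<open>sin t\<close>, together with
  \<open>dt\<close>, are the coframe of the cone.\<close>

lemma SU3_structure_sin_cone:
  fixes N :: "('a, 'i, 'e::euclidean_space) mfd"
  assumes SU2: "SU2_structure N \<eta> \<omega>"
  shows "SU3_structure (sin_cone N) (cone_F \<eta> \<omega>) (cone_\<Psi>p \<eta> \<omega>) (cone_\<Psi>m \<eta> \<omega>)"
  unfolding SU3_structure_def
proof (intro conjI ballI diff_form_cone[OF SU2] smooth_manifold_sin_cone)
  note N = SU2_structure_manifold[OF SU2]
  show "smooth_manifold N" by (rule N)
  have "DIM('e) = 5" using SU2 unfolding SU2_structure_def by blast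
  then show dim: "DIM('e \<times> real) = 6" by simp
  fix q0 assume "q0 \<in> topspace (space_top (sin_cone N))"
  then obtain p0 t0 where q0: "q0 = (p0, t0)" "p0 \<in> topspace (space_top N)" "t0 \<in> {0<..<pi}"
    by (auto simp: sin_cone_def)
  obtain V and e :: "nat \<Rightarrow> ('a, 'i, 'e, real) form" where V: "openin (space_top N) V" and "p0 \<in> V"
    and e: "\<And>k. k \<in> {1, 2, 3, 4} \<Longrightarrow> diff_form (open_submanifold N V) 1 (e k)"
    and \<omega>1: "\<And>j p x y. j \<in> charts N \<Longrightarrow> p \<in> cdom N j \<Longrightarrow> p \<in> V \<Longrightarrow> ev2 (\<omega> 1 j p) x y
      = wedge11 (ev1 (e 1 j p)) (ev1 (e 2 j p)) x y + wedge11 (ev1 (e 3 j p)) (ev1 (e 4 j p)) x y"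
    and \<omega>2: "\<And>j p x y. j \<in> charts N \<Longrightarrow> p \<in> cdom N j \<Longrightarrow> p \<in> V \<Longrightarrow> ev2 (\<omega> 2 j p) x y
      = wedge11 (ev1 (e 1 j p)) (ev1 (e 3 j p)) x y + wedge11 (ev1 (e 4 j p)) (ev1 (e 2 j p)) x y"
    and \<omega>3: "\<And>j p x y. j \<in> charts N \<Longrightarrow> p \<in> cdom N j \<Longrightarrow> p \<in> V \<Longrightarrow> ev2 (\<omega> 3 j p) x y
      = wedge11 (ev1 (e 1 j p)) (ev1 (e 4 j p)) x y + wedge11 (ev1 (e 2 j p)) (ev1 (e 3 j p)) x y"
    by (rule SU2_local_frame[OF SU2 q0(2)]) (rule that)
  let ?N = "open_submanifold N V" and ?V = "V \<times> {0<..<pi}"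
  let ?M = "open_submanifold (sin_cone N) ?V"
  have A: "smooth_atlas ?N" by (rule smooth_atlas_open_submanifold[OF N V])
  define E :: "nat \<Rightarrow> ('a \<times> real, 'i, 'e \<times> real, real) form" where "E = (\<lambda>k.
    if k = 1 then (\<lambda>q. sin (snd q)) \<odot> pull (e 1)
    else if k = 2 then (\<lambda>q. sin (snd q) * sin (snd q)) \<odot> pull (e 2) + (\<lambda>q. sin (snd q) * cos (snd q)) \<odot> pull (e 4)
    else if k = 3 then (\<lambda>q. sin (snd q)) \<odot> pull (e 3)
    else if k = 4 then (\<lambda>q. - (sin (snd q) * cos (snd q))) \<odot> pull (e 2) + (\<lambda>q. sin (snd q) * sin (snd q)) \<odot> pull (e 4)
    else if k = 5 then (\<lambda>q. sin (snd q)) \<odot> pull \<eta> else dt)"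
  have diffE: "diff_form (sin_cone ?N) 1 (E k)" for k
  proof -
    have I: "open {0<..<pi}" by simp
    note sc = smooth_on_sin_cos_real[OF I]
    note ss = smooth_on_mult[OF I sc(1) sc(1)] and sc' = smooth_on_mult[OF I sc(1) sc(2)]
    note M = smooth_atlas_sin_cone[OF A]
    have p: "diff_form (sin_cone ?N) 1 (pull (e 1))" "diff_form (sin_cone ?N) 1 (pull (e 2))"
      "diff_form (sin_cone ?N) 1 (pull (e 3))" "diff_form (sin_cone ?N) 1 (pull (e 4))"
      "diff_form (sin_cone ?N) 1 (pull \<eta>)"
      using diff_form_pull[OF A e] diff_form_pull[OF A diff_form_open_submanifold[OF N V SU2_structure_eta[OF SU2]]]
      by auto
    show ?thesis
      unfolding E_def
      using diff_form_scale_t[OF A p(1) sc(1)] diff_form_scale_t[OF A p(3) sc(1)] diff_form_scale_t[OF A p(5) sc(1)]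
        diff_form_add[OF M diff_form_scale_t[OF A p(2) ss] diff_form_scale_t[OF A p(4) sc']]
        diff_form_add[OF M diff_form_scale_t[OF A p(2) smooth_on_minus[OF I sc']] diff_form_scale_t[OF A p(4) ss]]
        diff_form_dt[OF A]
      by simp
  qed
  define Z where "Z = (\<lambda>k :: nat. \<lambda>j p t (v :: 'e \<times> real).
    if k = 1 then sin t * ev1 (e 1 j p) (fst v)
    else if k = 2 then sin t * (sin t * ev1 (e 2 j p) (fst v) + cos t * ev1 (e 4 j p) (fst v))
    else if k = 3 then sin t * ev1 (e 3 j p) (fst v)
    else if k = 4 then sin t * (- cos t * ev1 (e 2 j p) (fst v) + sin t * ev1 (e 4 j p) (fst v))
    else if k = 5 then sin t * ev1 (\<eta> j p) (fst v) else snd v)"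
  have Z: "Z 1 j p t v = sin t * ev1 (e 1 j p) (fst v)"
    "Z 2 j p t v = sin t * (sin t * ev1 (e 2 j p) (fst v) + cos t * ev1 (e 4 j p) (fst v))"
    "Z 3 j p t v = sin t * ev1 (e 3 j p) (fst v)"
    "Z 4 j p t v = sin t * (- cos t * ev1 (e 2 j p) (fst v) + sin t * ev1 (e 4 j p) (fst v))"
    "Z 5 j p t v = sin t * ev1 (\<eta> j p) (fst v)" "Z 6 j p t v = snd v" for j p t v
    by (simp_all add: Z_def)
  have alt_e: "alternating_form 1 (e k j p)" if "j \<in> charts N" "p \<in> cdom N j" "p \<in> V" "k \<in> {1, 2, 3, 4}" for j p k
    using diff_form_alternating[OF e[OF that(4)], of j p] that by simp
  have EZ: "E k j (p, t) us = Z k j p t (us 0)"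
    if jp: "j \<in> charts N" "p \<in> cdom N j" "p \<in> V" for k j p t us
  proof -
    have "e k j p (\<lambda>m. fst (us m)) = ev1 (e k j p) (fst (us 0))" if "k \<in> {1, 2, 3, 4}" for k
      by (rule ev1[OF alt_e[OF jp that]])
    moreover have "\<eta> j p (\<lambda>m. fst (us m)) = ev1 (\<eta> j p) (fst (us 0))"
      by (rule ev1_form[OF SU2_structure_eta[OF SU2] jp(1,2)])
    ultimately show ?thesis
      by (simp add: E_def Z_def fscale_def pull_def dt_def algebra_simps)
  qed
  have wedge_E: "(E k \<and>\<^bsub>1,1\<^esub> E l) j (p, t) us = Z k j p t (us 0) * Z l j p t (us 1) - Z k j p t (us 1) * Z l j p t (us 0)"
    if jp: "j \<in> charts N" "p \<in> cdom N j" "p \<in> V" for k l j p t us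
    by (rule wedge_1_1[where A = "Z k j p t" and B = "Z l j p t"]) (rule EZ[OF jp])+
  show "\<exists>V e. openin (space_top (sin_cone N)) V \<and> q0 \<in> V \<and> coframe (open_submanifold (sin_cone N) V) e \<and>
      form_eq (open_submanifold (sin_cone N) V) (cone_F \<eta> \<omega>)
        ((e 1 \<and>\<^bsub>1,1\<^esub> e 2) + (e 3 \<and>\<^bsub>1,1\<^esub> e 4) + (e 5 \<and>\<^bsub>1,1\<^esub> e 6)) \<and>
      form_eq (open_submanifold (sin_cone N) V) (complex_form (cone_\<Psi>p \<eta> \<omega>) (cone_\<Psi>m \<eta> \<omega>))
        ((complex_form (e 1) (e 2) \<and>\<^bsub>1,1\<^esub> complex_form (e 3) (e 4)) \<and>\<^bsub>2,1\<^esub> complex_form (e 5) (e 6))"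
  proof (intro exI[of _ ?V] exI[of _ E] conjI)
    show "openin (space_top (sin_cone N)) ?V"
      using V by (simp add: sin_cone_def openin_prod_Times_iff)
    show "q0 \<in> ?V" using q0 \<open>p0 \<in> V\<close> by simp
    show "coframe ?M E"
      unfolding coframe_def dim
    proof (intro conjI ballI allI impI)
      show "diff_form ?M 1 (E k)" for k
        using diffE[of k] by (simp add: sin_cone_open_submanifold)
      fix j q and c :: "nat \<Rightarrow> real" and k :: nat
      assume "j \<in> charts ?M" "q \<in> cdom ?M j" and dep: "\<forall>vs. (\<Sum>a = 1..6. c a * E a j q vs) = 0" and k: "k \<in> {1..6}"
      then obtain p t where q: "q = (p, t)" and jp: "j \<in> charts N" "p \<in> cdom N j" "p \<in> V" and t: "0 < t" "t < pi"
        by auto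
      have s: "sin t \<noteq> 0" using sin_gt_zero[OF t] by simp
      have lin: "linear (ev1 (e k j p))" if "k \<in> {1, 2, 3, 4}" for k
        by (rule linear_ev1[OF alt_e[OF jp that]])
      have lin\<eta>: "linear (ev1 (\<eta> j p))"
        by (rule linear_ev1[OF diff_form_alternating[OF SU2_structure_eta[OF SU2] jp(1,2)]])
      have sumZ: "c 1 * Z 1 j p t v + c 2 * Z 2 j p t v + c 3 * Z 3 j p t v + c 4 * Z 4 j p t v
          + c 5 * Z 5 j p t v + c 6 * Z 6 j p t v = 0" for v
        using spec[OF dep, of "\<lambda>_. v"] unfolding q sum_1_6 EZ[OF jp] .
      have c6: "c 6 = 0"
        using sumZ[of "(0, 1)"] linear_0[OF lin\<eta>] linear_0[OF lin[of 1]] linear_0[OF lin[of 2]]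
          linear_0[OF lin[of 3]] linear_0[OF lin[of 4]] by (simp add: Z)
      have "(c 1 * sin t) * ev1 (e 1 j p) z + (sin t * (c 2 * sin t - c 4 * cos t)) * ev1 (e 2 j p) z
          + (c 3 * sin t) * ev1 (e 3 j p) z + (sin t * (c 2 * cos t + c 4 * sin t)) * ev1 (e 4 j p) z
          + (c 5 * sin t) * ev1 (\<eta> j p) z = 0" for z
        using sumZ[of "(z, 0)"] by (simp add: Z algebra_simps)
      then have "c 1 * sin t = 0 \<and> sin t * (c 2 * sin t - c 4 * cos t) = 0 \<and> c 3 * sin t = 0
          \<and> sin t * (c 2 * cos t + c 4 * sin t) = 0 \<and> c 5 * sin t = 0"
        by (intro coframe_independent[OF SU2 jp(1,2) lin lin lin lin \<omega>1[OF jp]]) auto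
      then have c: "c 1 = 0" "c 3 = 0" "c 5 = 0" "c 2 * sin t = c 4 * cos t" "c 2 * cos t = - (c 4 * sin t)"
        using s by auto
      have "c 2 * ((sin t)\<^sup>2 + (cos t)\<^sup>2) = (c 2 * sin t) * sin t + (c 2 * cos t) * cos t"
        "c 4 * ((sin t)\<^sup>2 + (cos t)\<^sup>2) = (c 4 * cos t) * cos t + (c 4 * sin t) * sin t"
        by algebra+
      then have c24: "c 2 = 0" "c 4 * sin t = 0"
        unfolding c using c by simp_all
      have "k = 1 \<or> k = 2 \<or> k = 3 \<or> k = 4 \<or> k = 5 \<or> k = 6" using k by auto
      then show "c k = 0" using c c24 c6 s by auto
    qed
    show "form_eq ?M (cone_F \<eta> \<omega>) ((E 1 \<and>\<^bsub>1,1\<^esub> E 2) + (E 3 \<and>\<^bsub>1,1\<^esub> E 4) + (E 5 \<and>\<^bsub>1,1\<^esub> E 6))"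
      unfolding form_eq_def
    proof (intro ballI ext)
      fix j q and vs :: "nat \<Rightarrow> 'e \<times> real"
      assume "j \<in> charts ?M" "q \<in> cdom ?M j"
      then obtain p t where q: "q = (p, t)" and jp: "j \<in> charts N" "p \<in> cdom N j" "p \<in> V"
        by auto
      show "cone_F \<eta> \<omega> j q vs = ((E 1 \<and>\<^bsub>1,1\<^esub> E 2) + (E 3 \<and>\<^bsub>1,1\<^esub> E 4) + (E 5 \<and>\<^bsub>1,1\<^esub> E 6)) j q vs"
        unfolding q plus_fun_apply wedge_E[OF jp] Z cone_F_eval[OF SU2 jp(1,2)] \<omega>1[OF jp] \<omega>3[OF jp]
        by (simp add: algebra_simps power2_eq_square)
    qed
    show "form_eq ?M (complex_form (cone_\<Psi>p \<eta> \<omega>) (cone_\<Psi>m \<eta> \<omega>))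
        ((complex_form (E 1) (E 2) \<and>\<^bsub>1,1\<^esub> complex_form (E 3) (E 4)) \<and>\<^bsub>2,1\<^esub> complex_form (E 5) (E 6))"
      unfolding form_eq_def
    proof (intro ballI ext)
      fix j q and vs :: "nat \<Rightarrow> 'e \<times> real"
      assume "j \<in> charts ?M" "q \<in> cdom ?M j"
      then obtain p t where q: "q = (p, t)" and jp: "j \<in> charts N" "p \<in> cdom N j" "p \<in> V"
        by auto
      let ?C = "\<lambda>k l v. Complex (Z k j p t v) (Z l j p t v)"
      have C: "complex_form (E k) (E l) j (p, t) us = ?C k l (us 0)" for k l us
        by (simp add: complex_form_def EZ[OF jp])
      define S where "S = (\<lambda>x y. - cos t * ev2 (\<omega> 1 j p) x y + sin t * ev2 (\<omega> 3 j p) x y)"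
      define P where "P = (\<lambda>(v :: 'e \<times> real) (w :: 'e \<times> real).
        Complex ((sin t)\<^sup>2 * ev2 (\<omega> 2 j p) (fst v) (fst w)) ((sin t)\<^sup>2 * S (fst v) (fst w)))"
      have re: "Z 1 j p t v * Z 3 j p t w - Z 2 j p t v * Z 4 j p t w
          - (Z 1 j p t w * Z 3 j p t v - Z 2 j p t w * Z 4 j p t v)
          = (sin t)\<^sup>2 * ev2 (\<omega> 2 j p) (fst v) (fst w)" for v w
        using sin_cos_squared_add[of t] unfolding Z \<omega>2[OF jp] by algebra
      have im: "Z 1 j p t v * Z 4 j p t w + Z 2 j p t v * Z 3 j p t w
          - (Z 1 j p t w * Z 4 j p t v + Z 2 j p t w * Z 3 j p t v) = (sin t)\<^sup>2 * S (fst v) (fst w)" for v w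
        unfolding Z S_def \<omega>1[OF jp] \<omega>3[OF jp] by (simp add: algebra_simps power2_eq_square)
      have P: "?C 1 2 v * ?C 3 4 w - ?C 1 2 w * ?C 3 4 v = P v w" for v w
        unfolding P_def re[symmetric] im[symmetric] by (simp add: complex_eq_iff)
      have W: "(complex_form (E 1) (E 2) \<and>\<^bsub>1,1\<^esub> complex_form (E 3) (E 4)) j (p, t) us = P (us 0) (us 1)" for us
        unfolding P[symmetric] by (rule wedge_1_1[where A = "?C 1 2" and B = "?C 3 4"]) (rule C)+
      have skew: "P w v = - P v w" for v w unfolding P[symmetric] by simp
      have "((complex_form (E 1) (E 2) \<and>\<^bsub>1,1\<^esub> complex_form (E 3) (E 4)) \<and>\<^bsub>2,1\<^esub> complex_form (E 5) (E 6)) j (p, t) vs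
          = P (vs 0) (vs 1) * ?C 5 6 (vs 2) - P (vs 0) (vs 2) * ?C 5 6 (vs 1) + P (vs 1) (vs 2) * ?C 5 6 (vs 0)"
        by (rule wedge_2_1[where A = P and B = "?C 5 6"]) (rule W C skew)+
      also have "\<dots> = complex_form (cone_\<Psi>p \<eta> \<omega>) (cone_\<Psi>m \<eta> \<omega>) j (p, t) vs"
        unfolding complex_form_def cone_Psip_eval[OF SU2 jp(1,2) S_def[THEN fun_cong, THEN fun_cong]]
          cone_Psim_eval[OF SU2 jp(1,2) S_def[THEN fun_cong, THEN fun_cong]] P_def Z
        by (simp add: complex_eq_iff algebra_simps power2_eq_square power3_eq_cube)
      finally show "complex_form (cone_\<Psi>p \<eta> \<omega>) (cone_\<Psi>m \<eta> \<omega>) j q vs = ((complex_form (E 1) (E 2)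
          \<and>\<^bsub>1,1\<^esub> complex_form (E 3) (E 4)) \<and>\<^bsub>2,1\<^esub> complex_form (E 5) (E 6)) j q vs"
        unfolding q by (rule sym)
    qed
  qed
qed


lemma form_eqD: "form_eq M \<alpha> \<beta> \<Longrightarrow> i \<in> charts M \<Longrightarrow> p \<in> cdom M i \<Longrightarrow> \<alpha> i p vs = \<beta> i p vs"
  by (simp add: form_eq_def)

text \<open>For \<open>d\<Psi>\<^sub>-\<close> the terms without \<open>dt\<close> come from \<open>d (\<omega>\<^sub>1 \<and> \<eta>) = 0\<close> and \<open>d (\<omega>\<^sub>3 \<and> \<eta>) = - 2 v\<close>; both use the
  orthonormality of the triple.\<close>

lemma Sasaki_Einstein_imp_nearly_Kaehler:
  fixes N :: "('a, 'i, 'e::euclidean_space) mfd"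
  assumes "Sasaki_Einstein N \<eta> \<omega>"
  shows "nearly_Kaehler (sin_cone N) (cone_F \<eta> \<omega>) (cone_\<Psi>p \<eta> \<omega>) (cone_\<Psi>m \<eta> \<omega>)"
  unfolding nearly_Kaehler_def
proof (intro conjI)
  have SU2: "SU2_structure N \<eta> \<omega>"
    and SE: "form_eq N (ext_deriv N 1 \<eta>) ((\<lambda>_. - 2) \<odot> \<omega> 3)"
      "form_eq N (ext_deriv N 2 (\<omega> 1)) ((\<lambda>_. 3) \<odot> (\<eta> \<and>\<^bsub>1,2\<^esub> \<omega> 2))"
      "form_eq N (ext_deriv N 2 (\<omega> 2)) ((\<lambda>_. - 3) \<odot> (\<eta> \<and>\<^bsub>1,2\<^esub> \<omega> 1))"
    using assms unfolding Sasaki_Einstein_def by blast+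
  show "SU3_structure (sin_cone N) (cone_F \<eta> \<omega>) (cone_\<Psi>p \<eta> \<omega>) (cone_\<Psi>m \<eta> \<omega>)"
    by (rule SU3_structure_sin_cone[OF SU2])
  note A = smooth_manifold_imp_smooth_atlas[OF SU2_structure_manifold[OF SU2]]
  note \<eta> = SU2_structure_eta[OF SU2]
  have \<omega>: "diff_form N 2 (\<omega> 1)" "diff_form N 2 (\<omega> 2)" "diff_form N 2 (\<omega> 3)"
    by (simp_all add: SU2_structure_omega[OF SU2])
  let ?W = "\<lambda>r i p. ev2 (\<omega> r i p)" and ?H = "\<lambda>i p. ev1 (\<eta> i p)"
  have d\<eta>: "ext_deriv N 1 \<eta> i p us = - 2 * ?W 3 i p (us 0) (us 1)"
    and d1: "ext_deriv N 2 (\<omega> 1) i p us = 3 * (wedge12 (?H i p) (?W 2 i p) (us 0) (us 1) (us 2))"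
    and d2: "ext_deriv N 2 (\<omega> 2) i p us = - 3 * (wedge12 (?H i p) (?W 1 i p) (us 0) (us 1) (us 2))"
    if ip: "i \<in> charts N" "p \<in> cdom N i" for i p us
    using form_eqD[OF SE(1) ip, of us] form_eqD[OF SE(2) ip, of us] form_eqD[OF SE(3) ip, of us]
    by (simp_all add: fscale_apply ev2_form[OF \<omega>(3) ip, of us]
        wedge_1_2_form[OF \<eta> \<omega>(2) ip] wedge_1_2_form[OF \<eta> \<omega>(1) ip])
  have d3: "ext_deriv N 2 (\<omega> 3) i p us = 0" if ip: "i \<in> charts N" "p \<in> cdom N i" for i p us
  proof (rule ext_deriv_ext_deriv_1[OF A \<eta> \<omega>(3) ip])
    show "\<omega> 3 i q us = - (1 / 2) * ext_deriv N 1 \<eta> i q us" if "q \<in> cdom N i" for q us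
      using form_eqD[OF SE(1) ip(1) that, of us] by (simp add: fscale_apply)
  qed
  show "form_eq (sin_cone N) (ext_deriv (sin_cone N) 2 (cone_F \<eta> \<omega>)) ((\<lambda>_. 3) \<odot> cone_\<Psi>p \<eta> \<omega>)"
    unfolding form_eq_def
  proof (intro ballI ext)
    fix i q and vs :: "nat \<Rightarrow> 'e \<times> real"
    assume "i \<in> charts (sin_cone N)" "q \<in> cdom (sin_cone N) i"
    then obtain p t where q: "q = (p, t)" and ip: "i \<in> charts N" "p \<in> cdom N i" and t: "t \<in> {0<..<pi}"
      by auto
    show "ext_deriv (sin_cone N) 2 (cone_F \<eta> \<omega>) i q vs = ((\<lambda>_. 3) \<odot> cone_\<Psi>p \<eta> \<omega>) i q vs"
      unfolding q ext_deriv_cone_F[OF SU2 ip t d\<eta>[OF ip] refl refl] fscale_apply cone_Psip_eval[OF SU2 ip refl]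
        d1[OF ip] d3[OF ip]
      using sin_cos_squared_add[of t] by algebra
  qed
  show "form_eq (sin_cone N) (ext_deriv (sin_cone N) 3 (cone_\<Psi>m \<eta> \<omega>))
      ((\<lambda>_. - 2) \<odot> (cone_F \<eta> \<omega> \<and>\<^bsub>2,2\<^esub> cone_F \<eta> \<omega>))"
    unfolding form_eq_def
  proof (intro ballI ext)
    fix i q and vs :: "nat \<Rightarrow> 'e \<times> real"
    assume iq: "i \<in> charts (sin_cone N)" "q \<in> cdom (sin_cone N) i"
    then obtain p t where q: "q = (p, t)" and ip: "i \<in> charts N" "p \<in> cdom N i" and t: "t \<in> {0<..<pi}"
      by auto
    obtain v where v: "orthonormal_triple (\<lambda>r. ev2 (\<omega> r i p)) v"
      using SU2_structure_triple[OF SU2 ip] by metis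
    let ?x = "\<lambda>m :: nat. fst (vs m)"
    let ?a = "v (?x 0) (?x 1) (?x 2) (?x 3)"
    note w = orthonormal_triple.wedge[OF v, of _ _ "?x 0" "?x 1" "?x 2" "?x 3"]
    have w': "wedge22 (?W 1 i p) (?W 1 i p) (?x 0) (?x 1) (?x 2) (?x 3) = ?a"
      "wedge22 (?W 3 i p) (?W 3 i p) (?x 0) (?x 1) (?x 2) (?x 3) = ?a"
      "wedge22 (?W 1 i p) (?W 3 i p) (?x 0) (?x 1) (?x 2) (?x 3) = 0"
      using w[of 1 1] w[of 3 3] w[of 1 3] by simp_all
    have dT1: "ext_deriv N 3 (\<omega> 1 \<and>\<^bsub>2,1\<^esub> \<eta>) i p ?x = 0"
      unfolding ext_deriv_wedge_2_1[OF A \<omega>(1) \<eta> ip d1[OF ip] d\<eta>[OF ip]]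
      using w'(3) by (simp add: wedge22_def algebra_simps)
    have dT3: "ext_deriv N 3 (\<omega> 3 \<and>\<^bsub>2,1\<^esub> \<eta>) i p ?x = - 2 * ?a"
      unfolding ext_deriv_wedge_2_1[OF A \<omega>(3) \<eta> ip d3[OF ip] d\<eta>[OF ip]]
      using w'(2) by (simp add: wedge22_def algebra_simps)
    have F: "ev2 (cone_F \<eta> \<omega> i (p, t)) y z = (sin t)\<^sup>2 * (sin t * ?W 1 i p (fst y) (fst z) + cos t * ?W 3 i p (fst y) (fst z))
        + sin t * (?H i p (fst y) * snd z - ?H i p (fst z) * snd y)" for y z
      using cone_F_eval[OF SU2 ip, of t "pair y z"] by (simp add: ev_pair)
    have iq': "i \<in> charts (sin_cone N)" "(p, t) \<in> cdom (sin_cone N) i" using iq q by auto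
    \<comment> \<open>\<open>F = (sin t)\<^sup>2 G + sin t K\<close> with \<open>K = \<eta> \<and> dt\<close>, and \<open>K \<and> K = 0\<close>.\<close>
    let ?G = "\<lambda>y z. sin t * ?W 1 i p (fst y) (fst z) + cos t * ?W 3 i p (fst y) (fst z)"
    let ?K = "\<lambda>y z. ?H i p (fst y) * snd z - ?H i p (fst z) * snd y"
    have "wedge22 ?G ?G (vs 0) (vs 1) (vs 2) (vs 3)
        = (sin t)\<^sup>2 * wedge22 (?W 1 i p) (?W 1 i p) (?x 0) (?x 1) (?x 2) (?x 3)
          + (cos t)\<^sup>2 * wedge22 (?W 3 i p) (?W 3 i p) (?x 0) (?x 1) (?x 2) (?x 3)
          + 2 * sin t * cos t * wedge22 (?W 1 i p) (?W 3 i p) (?x 0) (?x 1) (?x 2) (?x 3)"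
      by (simp add: wedge22_def algebra_simps power2_eq_square)
    then have G: "wedge22 ?G ?G (vs 0) (vs 1) (vs 2) (vs 3) = (sin t)\<^sup>2 * ?a + (cos t)\<^sup>2 * ?a"
      unfolding w' by simp
    have FF: "(cone_F \<eta> \<omega> \<and>\<^bsub>2,2\<^esub> cone_F \<eta> \<omega>) i (p, t) vs = sin t ^ 4 * ((sin t)\<^sup>2 * ?a + (cos t)\<^sup>2 * ?a)
        + 2 * sin t ^ 3 * wedge22 ?G ?K (vs 0) (vs 1) (vs 2) (vs 3)"
      unfolding wedge_2_2_ev2[OF diff_form_cone(1)[OF SU2] diff_form_cone(1)[OF SU2] iq'] F G[symmetric]
      by (simp add: wedge22_def algebra_simps power2_eq_square power3_eq_cube power4_eq_xxxx)
    have one: "(sin t)\<^sup>2 * ?a + (cos t)\<^sup>2 * ?a = ?a"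
      using sin_cos_squared_add[of t] by (metis distrib_right mult_1)
    have cc: "(cos t)\<^sup>2 = 1 - (sin t)\<^sup>2" by (rule cos_squared_eq)
    show "ext_deriv (sin_cone N) 3 (cone_\<Psi>m \<eta> \<omega>) i q vs
        = ((\<lambda>_. - 2) \<odot> (cone_F \<eta> \<omega> \<and>\<^bsub>2,2\<^esub> cone_F \<eta> \<omega>)) i q vs"
      unfolding q ext_deriv_cone_Psim[OF SU2 ip t d2[OF ip] refl refl refl] fscale_apply FF one dT1 dT3
        wedge_2_1_form[OF \<omega>(1) \<eta> ip] wedge_2_1_form[OF \<omega>(3) \<eta> ip] drop_vec_simps cc
      by (simp add: wedge22_def algebra_simps power2_eq_square power3_eq_cube power4_eq_xxxx)
  qed
qed

text \<open>Everything can be read off at \<open>t = \<pi> / 2\<close>, where \<open>F = \<omega>\<^sub>1 + \<eta> \<and> dt\<close>. Vectors tangent to \<open>N\<close> see the terms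
  without \<open>dt\<close>; replacing the last vector by the unit vector of the second factor gives the others.\<close>

lemma nearly_Kaehler_imp_Sasaki_Einstein:
  fixes N :: "('a, 'i, 'e::euclidean_space) mfd"
  assumes SU2: "SU2_structure N \<eta> \<omega>"
    and NK: "nearly_Kaehler (sin_cone N) (cone_F \<eta> \<omega>) (cone_\<Psi>p \<eta> \<omega>) (cone_\<Psi>m \<eta> \<omega>)"
  shows "Sasaki_Einstein N \<eta> \<omega>"
proof -
  note A = smooth_manifold_imp_smooth_atlas[OF SU2_structure_manifold[OF SU2]]
  note \<eta> = SU2_structure_eta[OF SU2]
  have \<omega>: "diff_form N 2 (\<omega> 1)" "diff_form N 2 (\<omega> 2)" "diff_form N 2 (\<omega> 3)"
    by (simp_all add: SU2_structure_omega[OF SU2])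
  have NK: "form_eq (sin_cone N) (ext_deriv (sin_cone N) 2 (cone_F \<eta> \<omega>)) ((\<lambda>_. 3) \<odot> cone_\<Psi>p \<eta> \<omega>)"
      "form_eq (sin_cone N) (ext_deriv (sin_cone N) 3 (cone_\<Psi>m \<eta> \<omega>)) ((\<lambda>_. - 2) \<odot> (cone_F \<eta> \<omega> \<and>\<^bsub>2,2\<^esub> cone_F \<eta> \<omega>))"
    using NK unfolding nearly_Kaehler_def by blast+
  have h: "pi / 2 \<in> {0<..<pi}" by simp
  have "ext_deriv N 2 (\<omega> 1) i p us = ((\<lambda>_. 3) \<odot> (\<eta> \<and>\<^bsub>1,2\<^esub> \<omega> 2)) i p us \<and>
      ext_deriv N 1 \<eta> i p us = ((\<lambda>_. - 2) \<odot> \<omega> 3) i p us \<and>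
      ext_deriv N 2 (\<omega> 2) i p us = ((\<lambda>_. - 3) \<odot> (\<eta> \<and>\<^bsub>1,2\<^esub> \<omega> 1)) i p us"
    if ip: "i \<in> charts N" "p \<in> cdom N i" for i p us
  proof -
    have iq: "i \<in> charts (sin_cone N)" "(p, pi / 2) \<in> cdom (sin_cone N) i" using ip h by auto
    define B where "B = (\<lambda>y z. ext_deriv N 1 \<eta> i p (pair y z))"
    define C where "C = (\<lambda>x y z. ext_deriv N 2 (\<omega> 2) i p (triple x y z))"
    have B: "ext_deriv N 1 \<eta> i p vs = B (vs 0) (vs 1)" for vs
      by (simp add: B_def ext_deriv_1[OF A \<eta> ip])
    have C: "ext_deriv N 2 (\<omega> 2) i p vs = C (vs 0) (vs 1) (vs 2)" for vs
      by (simp add: C_def ext_deriv_2[OF A \<omega>(2) ip])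
    note dF = ext_deriv_cone_F[OF SU2 ip h B refl refl]
    note d\<Psi> = ext_deriv_cone_Psim[OF SU2 ip h C refl refl refl]
    have F: "ev2 (cone_F \<eta> \<omega> i (p, pi / 2)) y z = ev2 (\<omega> 1 i p) (fst y) (fst z)
        + (ev1 (\<eta> i p) (fst y) * snd z - ev1 (\<eta> i p) (fst z) * snd y)" for y z
      using cone_F_eval[OF SU2 ip, of "pi / 2" "pair y z"] by (simp add: ev_pair)
    have "ext_deriv N 2 (\<omega> 1) i p us = ((\<lambda>_. 3) \<odot> (\<eta> \<and>\<^bsub>1,2\<^esub> \<omega> 2)) i p us"
      using form_eqD[OF NK(1) iq, of "\<lambda>m. (us m, 0)"]
      by (simp add: dF fscale_apply cone_Psip_eval[OF SU2 ip refl] wedge_1_2_form[OF \<eta> \<omega>(2) ip])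
    moreover have "ext_deriv N 1 \<eta> i p us = ((\<lambda>_. - 2) \<odot> \<omega> 3) i p us"
    proof -
      let ?v = "\<lambda>m :: nat. if m < 2 then (us m, 0) else (0, 1 :: real)"
      have "?v 0 = (us 0, 0)" "?v 1 = (us 1, 0)" "?v 2 = (0, 1)" by simp_all
      moreover have "ext_deriv N 2 (\<omega> 1) i p (\<lambda>m. fst (?v m)) = 3 * (\<eta> \<and>\<^bsub>1,2\<^esub> \<omega> 2) i p (\<lambda>m. fst (?v m))"
        using form_eqD[OF NK(1) iq, of "\<lambda>m. (fst (?v m), 0)"]
        by (simp add: dF fscale_apply cone_Psip_eval[OF SU2 ip refl] wedge_1_2_form[OF \<eta> \<omega>(2) ip])
      ultimately have "B (us 0) (us 1) = - 2 * ev2 (\<omega> 3 i p) (us 0) (us 1)"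
        using form_eqD[OF NK(1) iq, of ?v]
        by (simp add: dF fscale_apply cone_Psip_eval[OF SU2 ip refl] wedge_1_2_form[OF \<eta> \<omega>(2) ip])
      then show ?thesis by (simp add: B fscale_apply ev2_form[OF \<omega>(3) ip, of us])
    qed
    moreover have "ext_deriv N 2 (\<omega> 2) i p us = ((\<lambda>_. - 3) \<odot> (\<eta> \<and>\<^bsub>1,2\<^esub> \<omega> 1)) i p us"
    proof -
      let ?v = "\<lambda>m :: nat. if m < 3 then (us m, 0) else (0, 1 :: real)"
      have v: "?v 0 = (us 0, 0)" "?v 1 = (us 1, 0)" "?v 2 = (us 2, 0)" "?v 3 = (0, 1)" by simp_all
      \<comment> \<open>At \<open>t = \<pi> / 2\<close> this is the part of the equation for \<open>\<Psi>\<^sub>-\<close> without \<open>dt\<close>; it cancels below.\<close>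
      have 0: "ext_deriv N 3 (\<omega> 3 \<and>\<^bsub>2,1\<^esub> \<eta>) i p (\<lambda>m. fst (?v m))
          = - 2 * wedge22 (ev2 (\<omega> 1 i p)) (ev2 (\<omega> 1 i p)) (fst (?v 0)) (fst (?v 1)) (fst (?v 2)) (fst (?v 3))"
        using form_eqD[OF NK(2) iq, of "\<lambda>m. (fst (?v m), 0)"]
        by (simp add: d\<Psi> fscale_apply F
            wedge_2_2_ev2[OF diff_form_cone(1)[OF SU2] diff_form_cone(1)[OF SU2] iq] wedge22_def)
      have "C (us 0) (us 1) (us 2) = - 3 * (wedge12 (ev1 (\<eta> i p)) (ev2 (\<omega> 1 i p)) (us 0) (us 1) (us 2))"
        using form_eqD[OF NK(2) iq, of ?v, unfolded d\<Psi> 0 fscale_apply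
            wedge_2_2_ev2[OF diff_form_cone(1)[OF SU2] diff_form_cone(1)[OF SU2] iq] F
            wedge_2_1_form[OF \<omega>(1) \<eta> ip] wedge_2_1_form[OF \<omega>(3) \<eta> ip] drop_vec_simps v fst_conv snd_conv]
        by (simp add: wedge22_def algebra_simps)
      then show ?thesis by (simp add: C fscale_apply wedge_1_2_form[OF \<eta> \<omega>(1) ip])
    qed
    ultimately show ?thesis by blast
  qed
  then show ?thesis
    unfolding Sasaki_Einstein_def form_eq_def using SU2 by (auto intro!: ext)
qed

theorem corollary3p8:
  fixes N :: "('a, 'i, 'e::euclidean_space) mfd"
    and \<eta> :: "('a, 'i, 'e, real) form"
    and \<omega> :: "nat \<Rightarrow> ('a, 'i, 'e, real) form"
  assumes "SU2_structure N \<eta> \<omega>"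
  shows "Sasaki_Einstein N \<eta> \<omega> \<longleftrightarrow>
         nearly_Kaehler (sin_cone N) (cone_F \<eta> \<omega>) (cone_\<Psi>p \<eta> \<omega>) (cone_\<Psi>m \<eta> \<omega>)"
  using Sasaki_Einstein_imp_nearly_Kaehler nearly_Kaehler_imp_Sasaki_Einstein[OF assms] by blast

end
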